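(* There exist $d \in \mathbf{Z}_{>0}$ and $B \in \Lambda_{\mathbf{Q}}$ such that every very general marked, primitively $d$-polarized K3 surface $(X,\theta)$ admits only signed $B$-twisted Hodge isometries; that is, for $(X,\theta)$ corresponding to a very general point of the moduli space $N_d$, every Hodge isometry $\widetilde H(X,\theta^{-1}(B),\mathbf{Z})\xrightarrow{\sim}\widetilde H(X,\theta^{-1}(B),\mathbf{Z})$ is signed.
   Context: Ground field $\mathbf{C}$. The K3 lattice is $\Lambda=E_8(-1)^{\oplus2}\oplus U^{\oplus3}$, where $U$ is the hyperbolic plane; $e_1,f_1$ are the standard basis vectors of the first copy of $U$ ($(e_1.e_1)=(f_1.f_1)=0$, $(e_1.f_1)=1$). Put $\ell=e_1+d f_1$ and $\Lambda_d=\Lambda\cap\ell^\perp$. A marked, primitively $d$-polarized K3 surface is a projective K3 surface $X$ with an ample line bundle $A$ (suppressed from the notation) and an isometry (marking) $\theta\colon H^2(X,\mathbf{Z})\xrightarrow{\sim}\Lambda$ with $\theta(c_1(A))=\ell$. They are parametrized by a fine moduli space $N_d$, a $19$-dimensional complex manifold, which via the period $(X,\theta)\mapsto[\theta(H^{2,0}(X))]$ is identified with $D_d\smallsetminus\bigcup_{\delta\in\Lambda_d,(\delta.\delta)=-2}\mathbf{P}(\delta^\perp)$, where $D_d=\{p\in\mathbf{P}(\Lambda_{d\mathbf{C}})\mid (p.p)=0,\ (p.\bar p)>0\}$. A property holds for a very general point of a complex manifold if it holds outside countably many closed submanifolds of positive codimension. For a K3 surface $X$ and $B\in H^2(X,\mathbf{Q})$,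 $\widetilde H(X,B,\mathbf{Z})$ is the lattice $H^*(X,\mathbf{Z})$ with the Mukai pairing $\langle\phi,\psi\rangle=\int_X(\phi_2\wedge\psi_2-\phi_0\wedge\psi_4-\phi_4\wedge\psi_0)$ (signature $(4,20)$) and the weight-$2$ Hodge structure with $(2,0)$-part $\mathbf{C}\cdot(1+B+\frac{B\wedge B}{2})\sigma$, $0\ne\sigma\in H^{2,0}(X)$, $(0,2)$-part its conjugate, and $(1,1)$-part the orthogonal complement of their sum. Hodge isometries are lattice isometries preserving the Hodge structure. An isometry of $\widetilde H(X,B,\mathbf{Z})$ is signed if it preserves each of the two connected components of the space of oriented, positive-definite, $4$-dimensional subspaces of $\widetilde H(X,B,\mathbf{R})$. *)

theory Defs
  imports "HOL-Analysis.Analysis"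
begin

section \<open>Lattices\<close>

text \<open>
  A lattice with a chosen basis is an integral Gram matrix on a finite index type \<open>'n\<close>.  The
  lattice tensored with \<open>\<complex>\<close> is \<open>complex^'n\<close>; the lattice itself, and its tensor products
  with \<open>\<rat>\<close> and \<open>\<real>\<close>, are the vectors with all coordinates in \<open>\<int>\<close>, \<open>\<rat>\<close> and
  \<open>\<real>\<close>.  The form is extended \<open>\<complex>\<close>-bilinearly (no complex conjugate).
\<close>

definition coords_in :: "complex set \<Rightarrow> (complex^'n) set" where
  "coords_in S = {v. \<forall>i. v $ i \<in> S}"

definition bil :: "int^'n^'n \<Rightarrow> complex^'n \<Rightarrow> complex^'n \<Rightarrow> complex" where
  "bil Q v w = (\<Sum>i\<in>UNIV. \<Sum>j\<in>UNIV. of_int (Q $ i $ j) * v $ i * w $ j)"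

definition cnj_vec :: "complex^'n \<Rightarrow> complex^'n" where
  "cnj_vec v = (\<chi> i. cnj (v $ i))"

definition complex_linear :: "(complex^'m \<Rightarrow> complex^'n) \<Rightarrow> bool" where
  "complex_linear f \<longleftrightarrow> Vector_Spaces.linear (*s) (*s) f"

text \<open>
  A homomorphism of lattices is represented by its unique \<open>\<complex>\<close>-linear extension.  The two forms
  are arbitrary functions, so that the same notion serves for \<open>bil\<close> and for the Mukai pairing.
\<close>

definition lattice_isometry ::
    "(complex^'m \<Rightarrow> complex^'m \<Rightarrow> complex) \<Rightarrow> (complex^'n \<Rightarrow> complex^'n \<Rightarrow> complex) \<Rightarrow>
     (complex^'m \<Rightarrow> complex^'n) \<Rightarrow> bool" where
  "lattice_isometry b b' f \<longleftrightarrow>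
     complex_linear f \<and>
     bij_betw f (coords_in \<int>) (coords_in \<int>) \<and>
     (\<forall>v\<in>coords_in \<int>. \<forall>w\<in>coords_in \<int>. b' (f v) (f w) = b v w)"

definition block_sum :: "int^'m^'m \<Rightarrow> int^'n^'n \<Rightarrow> int^('m + 'n)^('m + 'n)" where
  "block_sum P Q = (\<chi> i j. case (i, j) of
      (Inl a, Inl b) \<Rightarrow> P $ a $ b
    | (Inr a, Inr b) \<Rightarrow> Q $ a $ b
    | _ \<Rightarrow> 0)"

definition U_form :: "int^2^2" where
  "U_form = (\<chi> i j. if i = j then 0 else 1)"

text \<open>
  The \<open>E8\<close> Dynkin diagram: a chain of the seven nodes \<open>0, \<dots>, 6\<close>, with node \<open>7\<close> attached to
  node \<open>2\<close>.
\<close>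

definition E8_edges :: "8 set set" where
  "E8_edges = {{0,1}, {1,2}, {2,3}, {3,4}, {4,5}, {5,6}, {2,7}}"

definition E8_form :: "int^8^8" where
  "E8_form = (\<chi> i j. if i = j then 2 else if {i, j} \<in> E8_edges then -1 else 0)"

type_synonym k3_index = "8 + 8 + 2 + 2 + 2"

definition K3_form :: "int^k3_index^k3_index" where
  "K3_form = block_sum (- E8_form) (block_sum (- E8_form)
               (block_sum U_form (block_sum U_form U_form)))"

definition e1 :: "complex^k3_index" where
  "e1 = axis (Inr (Inr (Inl 0))) 1"

definition f1 :: "complex^k3_index" where
  "f1 = axis (Inr (Inr (Inl 1))) 1"

definition ell :: "nat \<Rightarrow> complex^k3_index" where
  "ell d = e1 + of_nat d *s f1"

definition Lambda_d :: "nat \<Rightarrow> (complex^k3_index) set" where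
  "Lambda_d d = {v \<in> coords_in \<int>. bil K3_form v (ell d) = 0}"


section \<open>Very general points of submanifolds of projective space\<close>

text \<open>
  A point of the projective space of \<open>complex^'n\<close> is a one-dimensional complex subspace.
\<close>

definition proj_points :: "(complex^'n) set set" where
  "proj_points = {p. vec.subspace p \<and> vec.dim p = 1}"

definition holomorphic_map_on :: "(complex^'m \<Rightarrow> complex^'n) \<Rightarrow> (complex^'m) set \<Rightarrow> bool" where
  "holomorphic_map_on f S \<longleftrightarrow>
     (\<forall>x\<in>S. \<exists>f'. complex_linear f' \<and> (f has_derivative f') (at x))"

definition biholomorphic :: "(complex^'n \<Rightarrow> complex^'n) \<Rightarrow> (complex^'n) set \<Rightarrow> (complex^'n) set \<Rightarrow> bool"
  where
  "biholomorphic h S T \<longleftrightarrow> open S \<and> open T \<and> bij_betw h S T \<and>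
     holomorphic_map_on h S \<and> holomorphic_map_on (inv_into S h) T"

definition complex_submanifold :: "nat \<Rightarrow> (complex^'n) set \<Rightarrow> bool" where
  "complex_submanifold k M \<longleftrightarrow>
     (\<forall>x\<in>M. \<exists>S T h W. x \<in> S \<and> biholomorphic h S T \<and>
        vec.subspace W \<and> vec.dim W = k \<and> h ` (S \<inter> M) = T \<inter> W)"

text \<open>
  Projective submanifolds are described by their punctured cones: the projection
  \<open>\<complex>\<^sup>n - {0} \<rightarrow> \<P>\<^sup>n\<^sup>-\<^sup>1\<close> is a surjective holomorphic submersion, so a set \<open>Z\<close> of points is a
  \<open>k\<close>-dimensional submanifold iff its preimage is a \<open>(k + 1)\<close>-dimensional one, and \<open>Z\<close> is closed in
  \<open>M\<close> iff the preimage of \<open>Z\<close> is closed in that of \<open>M\<close>.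
\<close>

definition punctured_cone :: "(complex^'n) set set \<Rightarrow> (complex^'n) set" where
  "punctured_cone Z = \<Union>Z - {0}"

definition closed_proj_submanifold :: "(complex^'n) set set \<Rightarrow> nat \<Rightarrow> (complex^'n) set set \<Rightarrow> bool"
  where
  "closed_proj_submanifold M k Z \<longleftrightarrow> Z \<subseteq> M \<and>
     closedin (top_of_set (punctured_cone M)) (punctured_cone Z) \<and>
     complex_submanifold (k + 1) (punctured_cone Z)"

text \<open>
  Here \<open>m\<close> is the dimension of \<open>M\<close>.  Requiring each submanifold to be of pure dimension is no
  restriction, since a submanifold is a countable union of closed pure-dimensional ones.
\<close>

definition holds_very_generally ::
    "(complex^'n) set set \<Rightarrow> nat \<Rightarrow> ((complex^'n) set \<Rightarrow> bool) \<Rightarrow> bool" where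
  "holds_very_generally M m P \<longleftrightarrow>
     (\<exists>\<Z>. countable \<Z> \<and>
        (\<forall>Z\<in>\<Z>. \<exists>k<m. closed_proj_submanifold M k Z) \<and>
        (\<forall>p\<in>M - \<Union>\<Z>. P p))"


section \<open>Periods and marked polarized K3 surfaces\<close>

text \<open>
  \<open>(p.\<bar>p)\<close> is automatically a real number, hence the \<open>Re\<close>.
\<close>

definition period_domain :: "nat \<Rightarrow> (complex^k3_index) set set" where
  "period_domain d = {p \<in> proj_points. \<forall>v\<in>p.
      bil K3_form v (ell d) = 0 \<and>
      bil K3_form v v = 0 \<and>
      (v \<noteq> 0 \<longrightarrow> Re (bil K3_form v (cnj_vec v)) > 0)}"

definition N_moduli :: "nat \<Rightarrow> (complex^k3_index) set set" where
  "N_moduli d = period_domain d -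
     (\<Union>\<delta>\<in>{\<delta> \<in> Lambda_d d. bil K3_form \<delta> \<delta> = -2}. {p. \<forall>v\<in>p. bil K3_form \<delta> v = 0})"

text \<open>
  The data of a polarized K3 surface \<open>(X, A)\<close> seen by its cohomology: after the choice of a basis
  of \<open>H\<^sup>2(X, \<int>)\<close>, the Gram matrix of the cup product, the subspace \<open>H\<^sup>2\<^sup>,\<^sup>0(X)\<close> of
  \<open>H\<^sup>2(X, \<complex>)\<close>, and the class \<open>c\<^sub>1(A)\<close>.
\<close>

record k3_cohomology =
  cup :: "int^22^22"
  H20 :: "(complex^22) set"
  c1 :: "complex^22"

text \<open>
  By the Torelli theorem and the surjectivity of the period map, a marked lattice with such data
  is that of a marked, primitively \<open>d\<close>-polarized K3 surface exactly if its period lies in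
  \<open>N_moduli d\<close>, and the surface is then unique up to isomorphism; the last conjunct thus
  expresses that the data come from a K3 surface on which the polarization is ample.
\<close>

definition marked_polarized_K3 ::
    "nat \<Rightarrow> k3_cohomology \<Rightarrow> (complex^22 \<Rightarrow> complex^k3_index) \<Rightarrow> bool" where
  "marked_polarized_K3 d X \<theta> \<longleftrightarrow>
     lattice_isometry (bil (cup X)) (bil K3_form) \<theta> \<and>
     c1 X \<in> coords_in \<int> \<and> \<theta> (c1 X) = ell d \<and>
     \<theta> ` H20 X \<in> N_moduli d"

definition period :: "k3_cohomology \<Rightarrow> (complex^22 \<Rightarrow> complex^k3_index) \<Rightarrow> (complex^k3_index) set"
  where "period X \<theta> = \<theta> ` H20 X"


section \<open>Twisted Mukai lattices\<close>

text \<open>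
  \<open>H\<^sup>* = H\<^sup>0 \<oplus> H\<^sup>2 \<oplus> H\<^sup>4\<close>, where \<open>H\<^sup>0\<close> and \<open>H\<^sup>4\<close> have the bases given by the unit and by the
  class of a point.
\<close>

type_synonym 'n total_index = "unit + 'n + unit"

definition total :: "complex \<Rightarrow> complex^'n \<Rightarrow> complex \<Rightarrow> complex^('n::finite total_index)" where
  "total a v b = (\<chi> i. case i of Inl _ \<Rightarrow> a | Inr (Inl j) \<Rightarrow> v $ j | Inr (Inr _) \<Rightarrow> b)"

definition deg0 :: "complex^('n::finite total_index) \<Rightarrow> complex" where
  "deg0 \<phi> = \<phi> $ Inl ()"

definition deg2 :: "complex^('n::finite total_index) \<Rightarrow> complex^'n" where
  "deg2 \<phi> = (\<chi> j. \<phi> $ Inr (Inl j))"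

definition deg4 :: "complex^('n::finite total_index) \<Rightarrow> complex" where
  "deg4 \<phi> = \<phi> $ Inr (Inr ())"

definition wedge :: "int^'n^'n \<Rightarrow> complex^('n::finite total_index) \<Rightarrow> complex^('n::finite total_index) \<Rightarrow>
    complex^('n::finite total_index)" where
  "wedge Q \<phi> \<psi> = total (deg0 \<phi> * deg0 \<psi>)
      (deg0 \<phi> *s deg2 \<psi> + deg0 \<psi> *s deg2 \<phi>)
      (deg0 \<phi> * deg4 \<psi> + bil Q (deg2 \<phi>) (deg2 \<psi>) + deg4 \<phi> * deg0 \<psi>)"

definition mukai :: "int^'n^'n \<Rightarrow> complex^('n::finite total_index) \<Rightarrow> complex^('n::finite total_index) \<Rightarrow> complex"
  where
  "mukai Q \<phi> \<psi> = bil Q (deg2 \<phi>) (deg2 \<psi>) - deg0 \<phi> * deg4 \<psi> - deg4 \<phi> * deg0 \<psi>"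

definition exp_class :: "int^'n^'n \<Rightarrow> complex^'n \<Rightarrow> complex^('n::finite total_index)" where
  "exp_class Q B = total 1 B (bil Q B B / 2)"

definition twisted_H20 :: "k3_cohomology \<Rightarrow> complex^22 \<Rightarrow> (complex^(22 total_index)) set" where
  "twisted_H20 X B = (\<lambda>\<sigma>. wedge (cup X) (exp_class (cup X) B) (total 0 \<sigma> 0)) ` H20 X"

definition twisted_H02 :: "k3_cohomology \<Rightarrow> complex^22 \<Rightarrow> (complex^(22 total_index)) set" where
  "twisted_H02 X B = cnj_vec ` twisted_H20 X B"

definition twisted_H11 :: "k3_cohomology \<Rightarrow> complex^22 \<Rightarrow> (complex^(22 total_index)) set" where
  "twisted_H11 X B =
     {\<phi>. \<forall>\<psi> \<in> twisted_H20 X B \<union> twisted_H02 X B. mukai (cup X) \<phi> \<psi> = 0}"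

definition twisted_Hodge_isometry ::
    "k3_cohomology \<Rightarrow> complex^22 \<Rightarrow>
     (complex^(22 total_index) \<Rightarrow> complex^(22 total_index)) \<Rightarrow> bool" where
  "twisted_Hodge_isometry X B f \<longleftrightarrow>
     lattice_isometry (mukai (cup X)) (mukai (cup X)) f \<and>
     f ` twisted_H20 X B = twisted_H20 X B \<and>
     f ` twisted_H11 X B = twisted_H11 X B \<and>
     f ` twisted_H02 X B = twisted_H02 X B"


section \<open>Signed isometries\<close>

text \<open>
  An oriented positive-definite 4-dimensional real subspace is represented by the set of its
  positively oriented bases, that is, by an orbit of matrices of positive determinant acting on
  the 4-tuples of real vectors that are bases of positive-definite subspaces.  (Such a tuple is
  automatically linearly independent.)
\<close>

definition positive_frames :: "(complex^'n \<Rightarrow> complex^'n \<Rightarrow> complex) \<Rightarrow> ((complex^'n)^4) set" where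
  "positive_frames b = {F. (\<forall>i. F $ i \<in> coords_in \<real>) \<and>
     (\<forall>c::real^4. c \<noteq> 0 \<longrightarrow>
        Re (b (\<Sum>i\<in>UNIV. c $ i *\<^sub>R F $ i) (\<Sum>i\<in>UNIV. c $ i *\<^sub>R F $ i)) > 0)}"

definition orientation_class :: "(complex^'n)^4 \<Rightarrow> ((complex^'n)^4) set" where
  "orientation_class F = {G. \<exists>A::real^4^4. det A > 0 \<and>
     G = (\<chi> i. \<Sum>j\<in>UNIV. A $ i $ j *\<^sub>R F $ j)}"

definition oriented_positive_subspaces ::
    "(complex^'n \<Rightarrow> complex^'n \<Rightarrow> complex) \<Rightarrow> ((complex^'n)^4) set topology" where
  "oriented_positive_subspaces b = topology (\<lambda>\<U>.
     \<U> \<subseteq> orientation_class ` positive_frames b \<and>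
     openin (top_of_set (positive_frames b)) {F \<in> positive_frames b. orientation_class F \<in> \<U>})"

lemma openin_oriented_positive_subspaces:
  "openin (oriented_positive_subspaces b) \<U> \<longleftrightarrow>
     \<U> \<subseteq> orientation_class ` positive_frames b \<and>
     openin (top_of_set (positive_frames b)) {F \<in> positive_frames b. orientation_class F \<in> \<U>}"
proof -
  let ?T = "top_of_set (positive_frames b)"
  let ?pre = "\<lambda>\<U>. {F \<in> positive_frames b. orientation_class F \<in> \<U>}"
  have "istopology (\<lambda>\<U>. \<U> \<subseteq> orientation_class ` positive_frames b \<and> openin ?T (?pre \<U>))"
    unfolding istopology_def
  proof (intro conjI allI impI; (elim conjE)?)
    fix S T assume "openin ?T (?pre S)" "openin ?T (?pre T)"
    moreover have "?pre (S \<inter> T) = ?pre S \<inter> ?pre T" by auto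
    ultimately show "openin ?T (?pre (S \<inter> T))" by (simp only: openin_Int)
  next
    fix \<K> assume "\<forall>K\<in>\<K>. K \<subseteq> orientation_class ` positive_frames b \<and> openin ?T (?pre K)"
    then have "openin ?T (\<Union>K\<in>\<K>. ?pre K)" by (intro openin_Union) blast
    moreover have "?pre (\<Union>\<K>) = (\<Union>K\<in>\<K>. ?pre K)" by auto
    ultimately show "openin ?T (?pre (\<Union>\<K>))" by (simp only:)
  qed auto
  then show ?thesis
    unfolding oriented_positive_subspaces_def by simp
qed

definition signed_isometry ::
    "(complex^'n \<Rightarrow> complex^'n \<Rightarrow> complex) \<Rightarrow> (complex^'n \<Rightarrow> complex^'n) \<Rightarrow> bool" where
  "signed_isometry b f \<longleftrightarrow>
     (\<forall>C \<in> connected_components_of (oriented_positive_subspaces b).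
        (\<lambda>\<O>. (\<lambda>F. \<chi> i. f (F $ i)) ` \<O>) ` C = C)"

end

(*
  Take d = 3 and B = e2/3.  For a period sigma outside countably many rational hyperplane sections
  and isotropic eigenspaces, a Hodge isometry F acts on the lattice T = exp(B) ell^perp as e = 1 or
  e = -1: the twisted period is an eigenvector of F; an eigenspace for an eigenvalue of square
  different from 1 is isotropic, and the remaining eigenspaces are cut out by rational equations.
  Then e F acts on the orthogonal complement N of T, whose form is 6 x^2 + 6 y z, and gluing
  N to T inside the unimodular Mukai lattice shows that e F = 1 modulo 3 on N.  An isotropic
  column (x, y, z) of e F restricted to N satisfies x^2 = - y z with y, z coprime, so y is plus or
  minus a square; as -1 is not a square modulo 3, the congruence y = 1 modulo 3 forces y > 0.
  Hence e F preserves the cone of negative vectors, and as its determinant is 1 modulo 3,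
  it also preserves the orientation of positive planes in N.
*)
theory Submission
  imports Defs
begin

section \<open>Isometries of \<open>6 x\<^sup>2 + 6 y z\<close> congruent to the identity\<close>

text \<open>The obstacle is the hyperbolic plane H^0 + H^4 of an untwisted Mukai lattice: -1 on it
  and 1 on H^2 form a Hodge isometry that reverses a single positive direction. Twisting by e2/3
  replaces this plane by the one spanned by 3 exp(B) = 3 + e2 and the point class, whose form is 3
  times as large and which is glued to T modulo 3; as -1 is not 1 modulo 3, the bad isometry no
  longer extends by the identity of T. Taking d = 3 does the same to ell, since ell = (e1 - 3 f1) +
  6 f1 is a vector of T up to a multiple of 3. Thus all of N is glued to T modulo 3. The prime 3
  serves because -1 is not a square modulo 3. The sign e does no harm: -1 has determinant 1 on a
  positive space of dimension four. The signature enters through explicit linear equations that cut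
  out a negative semidefinite subspace. On the geometric side, local finiteness of the root
  hyperplanes makes the moduli cone open in its quadric, so that charts can be written down on
  cones.\<close>

lemma isotropic_pos:
  fixes x y z :: int
  assumes "x^2 + y*z = 0" "coprime y z" "y mod 3 = 1"
  shows "y > 0 \<and> z \<le> 0"
proof -
  have yz: "y * z = - (x^2)" using assms(1) by simp
  \<comment> \<open>Because \<open>x^2 = - y z\<close> with \<open>y\<close> and \<open>z\<close>
    coprime, the greatest common divisor of \<open>x^2\<close> and \<open>y^2\<close> is the
    absolute value of \<open>y\<close>, which is therefore a square.\<close>
  have "(gcd x y)^2 = gcd (x^2) (y^2)" by simp
  also have "\<dots> = gcd (y * z) (y * y)" unfolding yz by (simp add: power2_eq_square)
  also have "\<dots> = \<bar>y\<bar>" using assms(2) by (simp add: gcd_mult_distrib_int[symmetric] coprime_commute abs_mult)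
  finally have g: "\<bar>y\<bar> = (gcd x y)^2" by simp
  have "y > 0"
  proof (rule ccontr)
    assume "\<not> y > 0"
    then have "y = - ((gcd x y)^2)" using g by simp
    then have "(- ((gcd x y)^2)) mod 3 = 1" using assms(3) by simp
    moreover have "gcd x y mod 3 \<in> {0,1,2}" by auto
    then have "(gcd x y)^2 mod 3 \<in> {0, 1}"
      by (auto simp: power2_eq_square mod_mult_left_eq[of "gcd x y" 3, symmetric] mod_mult_right_eq[of _ "gcd x y" 3, symmetric])
    ultimately show False by (auto simp: mod_minus_eq) presburger+
  qed
  moreover have "y * z \<le> 0" using yz by simp
  ultimately show ?thesis by (simp add: mult_le_0_iff)
qed

text \<open>For the form x^2 + y z the three triples are the images of a basis L, E, P with L of
  square 1 and E, P isotropic. The quantity in the conclusion is twice the determinant, on the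
  positive plane spanned by L and E + P, of the isometry followed by the orthogonal projection. For
  an isometry of determinant 1 this minor equals the complementary one, the coefficient of E - P in
  the image of E - P, and the signs of the isotropic images make that positive.\<close>

lemma congruence_isometry_minor_pos:
  fixes a b c x1 y1 z1 x2 y2 z2 :: int
  assumes g: "x1^2 + y1*z1 = 0" "x2^2 + y2*z2 = 0" "2*x1*x2 + y1*z2 + z1*y2 = 1"
    "a^2 + b*c = 1" "2*a*x1 + b*z1 + c*y1 = 0" "2*a*x2 + b*z2 + c*y2 = 0"
    and m: "3 dvd a - 1" "3 dvd b" "3 dvd c" "3 dvd x1" "3 dvd y1 - 1" "3 dvd z1"
      "3 dvd x2" "3 dvd y2" "3 dvd z2 - 1"
  shows "a*(y1+y2+z1+z2) - (b+c)*(x1+x2) > 0"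
proof -
  define D where "D = a*(y1*z2 - z1*y2) - b*(x1*z2 - z1*x2) + c*(x1*y2 - y1*x2)"
  have "D^2 = 1" unfolding D_def using g by algebra
  then have "D = 1 \<or> D = -1" by (simp add: power2_eq_1_iff)
  moreover have "3 dvd D - 1"
  proof -
    obtain a' b' c' x1' y1' z1' x2' y2' z2' where
      e: "a = 1 + 3*a'" "b = 3*b'" "c = 3*c'" "x1 = 3*x1'" "y1 = 1 + 3*y1'" "z1 = 3*z1'"
      "x2 = 3*x2'" "y2 = 3*y2'" "z2 = 1 + 3*z2'"
      using m by (auto simp: dvd_def algebra_simps eq_diff_eq)
    show ?thesis unfolding D_def e by (simp add: algebra_simps)
  qed
  ultimately have "D = 1" by auto
  then have key: "a*(y1+y2+z1+z2) - (b+c)*(x1+x2) = y1 - y2 - z1 + z2"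
    unfolding D_def using g by algebra
  \<comment> \<open>A Bezout identity for \<open>y1\<close> and \<open>z1\<close>. Squaring
    \<open>2 x1 x2 = 1 - s\<close> with \<open>s = y1 z2 + z1 y2\<close>, and replacing
    \<open>x1^2\<close> and \<open>x2^2\<close> by \<open>- y1 z1\<close> and
    \<open>- y2 z2\<close>, gives \<open>1 = 2 s - (y1 z2 - z1 y2)^2\<close>.\<close>
  have eq: "1 = y1 * (2*z2 - (y1*z2 - z1*y2)*z2) + z1 * (2*y2 + (y1*z2 - z1*y2)*y2)"
    using g(1-3) by algebra
  have "coprime y1 z1"
    by (rule coprimeI) (metis eq dvd_add dvd_mult2)
  then have 1: "y1 > 0 \<and> z1 \<le> 0"
    using g(1) m(5) by (intro isotropic_pos[of x1]) (auto simp: mod_eq_dvd_iff[of _ _ 1, simplified] intro: mod_eq_dvd_iff[of y1 3 1, THEN iffD2, simplified])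
  have "1 = z2 * (2*y1 - (y1*z2 - z1*y2)*y1) + y2 * (2*z1 + (y1*z2 - z1*y2)*z1)"
    using g(1-3) by algebra
  then have "coprime z2 y2"
    by (intro coprimeI) (metis dvd_add dvd_mult2)
  then have 2: "z2 > 0 \<and> y2 \<le> 0"
    using g(2) m(9) by (intro isotropic_pos[of x2]) (auto simp: mult.commute intro: mod_eq_dvd_iff[of z2 3 1, THEN iffD2, simplified])
  show ?thesis unfolding key using 1 2 by simp
qed

section \<open>The K3 form\<close>

lemma UNIV_8: "(UNIV :: 8 set) = {0,1,2,3,4,5,6,7}"
proof -
  have "x \<in> {0,1,2,3,4,5,6,7}" for x :: 8
  proof (induct x)
    case (of_int z)
    then have "z \<in> {0,1,2,3,4,5,6,7}" by auto
    then show ?case by auto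
  qed
  then show ?thesis by blast
qed

lemma sum_8: "sum f (UNIV :: 8 set) = f 0 + f 1 + f 2 + f 3 + f 4 + f 5 + f 6 + f 7"
  unfolding UNIV_8 by (simp add: add.assoc)

lemma sum_UNIV_sum:
  fixes f :: "('a::finite + 'b::finite) \<Rightarrow> 'c::comm_monoid_add"
  shows "sum f UNIV = (\<Sum>a\<in>UNIV. f (Inl a)) + (\<Sum>b\<in>UNIV. f (Inr b))"
  unfolding UNIV_Plus_UNIV[symmetric] by (subst sum.Plus) auto

lemma bil_block_sum:
  "bil (block_sum P Q) v w = bil P (\<chi> i. v $ Inl i) (\<chi> i. w $ Inl i) + bil Q (\<chi> i. v $ Inr i) (\<chi> i. w $ Inr i)"
  unfolding bil_def by (simp add: sum_UNIV_sum block_sum_def)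

lemma bil_zero_left: "bil Q 0 w = 0"
  unfolding bil_def by simp

lemma bil_uminus: "bil (- Q) v w = - bil Q v w"
  unfolding bil_def by (simp add: sum_negf)

lemma sum_2_from_0: "sum f (UNIV :: 2 set) = f 0 + f 1"
proof -
  have "(2::2) = 0" by simp
  then show ?thesis unfolding sum_2 by (metis add.commute)
qed

lemma bil_U: "bil U_form v w = v $ 0 * w $ 1 + v $ 1 * w $ 0"
  unfolding bil_def sum_2_from_0 U_form_def by simp

lemma bil_E8:
  "bil E8_form v w = 2 * (v$0*w$0 + v$1*w$1 + v$2*w$2 + v$3*w$3 + v$4*w$4 + v$5*w$5 + v$6*w$6 + v$7*w$7)
     - (v$0*w$1 + v$1*w$0 + v$1*w$2 + v$2*w$1 + v$2*w$3 + v$3*w$2 + v$3*w$4 + v$4*w$3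
        + v$4*w$5 + v$5*w$4 + v$5*w$6 + v$6*w$5 + v$2*w$7 + v$7*w$2)"
  unfolding bil_def sum_8 E8_form_def E8_edges_def
  by (simp add: doubleton_eq_iff algebra_simps)

lemma E8_quadratic_form_pos:
  fixes x0 :: real
  assumes "x0 \<noteq> 0 \<or> x1 \<noteq> 0 \<or> x2 \<noteq> 0 \<or> x3 \<noteq> 0 \<or> x4 \<noteq> 0 \<or> x5 \<noteq> 0 \<or> x6 \<noteq> 0 \<or> x7 \<noteq> 0"
  shows "2 * (x0*x0 + x1*x1 + x2*x2 + x3*x3 + x4*x4 + x5*x5 + x6*x6 + x7*x7)
     - 2 * (x0*x1 + x1*x2 + x2*x3 + x3*x4 + x4*x5 + x5*x6 + x2*x7) > 0" (is "?q > 0")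
proof -
  \<comment> \<open>Squares are completed along the three arms of the diagram from their ends
    towards the branch node 2. The arms use up 2/3, 1/2 and 4/5 of the coefficient 2 of
    \<open>x2^2\<close>, which leaves 1/30.\<close>
  have q: "?q = 2*(x0 - x1/2)^2 + 3/2*(x1 - 2/3*x2)^2 + 2*(x7 - x2/2)^2 + 2*(x6 - x5/2)^2
      + 3/2*(x5 - 2/3*x4)^2 + 4/3*(x4 - 3/4*x3)^2 + 5/4*(x3 - 4/5*x2)^2 + x2^2/30" (is "_ = ?s")
    by (simp add: power2_eq_square field_simps)
  have "?s \<ge> 0" by (intro add_nonneg_nonneg) auto
  moreover have "?s \<noteq> 0"
    using assms by (auto simp: add_nonneg_eq_0_iff)
  ultimately show ?thesis using q by linarith
qed

lemma coords_in_Reals_iff: "v \<in> coords_in \<real> \<longleftrightarrow> cnj_vec v = v"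
  by (auto simp: coords_in_def cnj_vec_def vec_eq_iff complex_is_Real_iff complex_eq_iff)

lemma bil_E8_pos:
  assumes "v \<in> coords_in \<real>" "v \<noteq> 0"
  shows "Re (bil E8_form v v) > 0"
proof -
  have im: "Im (v $ i) = 0" for i
    using assms(1) by (auto simp: coords_in_def complex_is_Real_iff)
  obtain i where "v $ i \<noteq> 0" using assms(2) by (auto simp: vec_eq_iff)
  then have i: "Re (v $ i) \<noteq> 0" using im[of i] by (auto simp: complex_eq_iff)
  have "i \<in> {0,1,2,3,4,5,6,7}" using UNIV_8 by blast
  with i have "Re (v$0) \<noteq> 0 \<or> Re (v$1) \<noteq> 0 \<or> Re (v$2) \<noteq> 0 \<or> Re (v$3) \<noteq> 0
      \<or> Re (v$4) \<noteq> 0 \<or> Re (v$5) \<noteq> 0 \<or> Re (v$6) \<noteq> 0 \<or> Re (v$7) \<noteq> 0"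
    by (elim insertE emptyE) simp_all
  from E8_quadratic_form_pos[OF this] show ?thesis
    unfolding bil_E8 by (simp add: im mult.commute algebra_simps)
qed

abbreviation (input) i1 :: k3_index where "i1 \<equiv> Inr (Inr (Inl 0))"
abbreviation (input) j1 :: k3_index where "j1 \<equiv> Inr (Inr (Inl 1))"
abbreviation (input) i2 :: k3_index where "i2 \<equiv> Inr (Inr (Inr (Inl 0)))"
abbreviation (input) j2 :: k3_index where "j2 \<equiv> Inr (Inr (Inr (Inl 1)))"
abbreviation (input) i3 :: k3_index where "i3 \<equiv> Inr (Inr (Inr (Inr 0)))"
abbreviation (input) j3 :: k3_index where "j3 \<equiv> Inr (Inr (Inr (Inr 1)))"

lemma bil_K3:
  "bil K3_form v w =
     - bil E8_form (\<chi> i. v $ Inl i) (\<chi> i. w $ Inl i)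
     - bil E8_form (\<chi> i. v $ Inr (Inl i)) (\<chi> i. w $ Inr (Inl i))
     + (v $ i1 * w $ j1 + v $ j1 * w $ i1) + (v $ i2 * w $ j2 + v $ j2 * w $ i2)
     + (v $ i3 * w $ j3 + v $ j3 * w $ i3)"
  unfolding K3_form_def bil_block_sum bil_uminus bil_U by simp

lemma UNIV_2_from_0: "(UNIV :: 2 set) = {0, 1}"
proof -
  have "(2::2) = 0" by simp
  then show ?thesis unfolding UNIV_2 by auto
qed

lemma k3_index_cases:
  fixes k :: k3_index
  obtains i where "k = Inl i" | i where "k = Inr (Inl i)" | "k = i1" | "k = j1" | "k = i2" | "k = j2"
    | "k = i3" | "k = j3"
proof -
  have two: "i = 0 \<or> i = 1" for i :: 2 using UNIV_2_from_0 by blast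
  show ?thesis
    apply (cases k)
    subgoal using that by blast
    subgoal for k'
      apply (cases k')
      subgoal using that by blast
      subgoal for k''
        apply (cases k'')
        subgoal for a using that two[of a] by auto
        subgoal for a
          apply (cases a)
          subgoal for b using that two[of b] by auto
          subgoal for b using that two[of b] by auto
          done
        done
      done
    done
qed

text \<open>The antidiagonal of each hyperbolic plane is negative, as are both copies of -E8. This
  stands in for the signature (3,19): three equations always have a nonzero solution in a real space
  of dimension four, so no such space can be positive definite.\<close>

lemma K3_negative_definite:
  assumes v: "v \<in> coords_in \<real>" "v \<noteq> 0"
    and s: "v $ i1 + v $ j1 = 0" "v $ i2 + v $ j2 = 0" "v $ i3 + v $ j3 = 0"
  shows "Re (bil K3_form v v) < 0"
proof -
  define a where "a = (\<chi> i. v $ Inl i)"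
  define b where "b = (\<chi> i. v $ Inr (Inl i))"
  have ab: "a \<in> coords_in \<real>" "b \<in> coords_in \<real>"
    using v(1) by (auto simp: a_def b_def coords_in_def)
  have im: "Im (v $ i) = 0" for i
    using v(1) by (auto simp: coords_in_def complex_is_Real_iff)
  have j: "v $ j1 = - v $ i1" "v $ j2 = - v $ i2" "v $ j3 = - v $ i3"
    using s by (simp_all add: eq_neg_iff_add_eq_0 add.commute)
  have "Re (bil K3_form v v) = - Re (bil E8_form a a) - Re (bil E8_form b b)
     - 2 * (Re (v $ i1))^2 - 2 * (Re (v $ i2))^2 - 2 * (Re (v $ i3))^2" (is "_ = ?r")
    unfolding bil_K3 a_def[symmetric] b_def[symmetric] j
    by (simp add: im power2_eq_square)
  also have "?r < 0"
  proof -
    have nn: "Re (bil E8_form a a) \<ge> 0" "Re (bil E8_form b b) \<ge> 0"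
      using bil_E8_pos[OF ab(1)] bil_E8_pos[OF ab(2)] bil_zero_left by (metis less_eq_real_def zero_complex.sel(1))+
    show ?thesis
    proof (cases "a = 0 \<and> b = 0")
      case True
      have "Re (v $ i1) \<noteq> 0 \<or> Re (v $ i2) \<noteq> 0 \<or> Re (v $ i3) \<noteq> 0"
      proof (rule ccontr)
        assume "\<not> ?thesis"
        then have "v $ i1 = 0" "v $ i2 = 0" "v $ i3 = 0" using im by (auto simp: complex_eq_iff)
        moreover have "v $ Inl i = 0" "v $ Inr (Inl l) = 0" for i l
          using True by (auto simp: a_def b_def vec_eq_iff)
        ultimately have "v $ k = 0" for k
          using j by (cases k rule: k3_index_cases) auto
        then show False using v(2) by (simp add: vec_eq_iff)
      qed
      then have "(Re (v $ i1))^2 + (Re (v $ i2))^2 + (Re (v $ i3))^2 > 0"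
        by (smt (verit) zero_le_power2 zero_less_power2)
      then show ?thesis using nn by linarith
    next
      case False
      then have "Re (bil E8_form a a) + Re (bil E8_form b b) > 0"
        using bil_E8_pos[OF ab(1)] bil_E8_pos[OF ab(2)] nn by linarith
      moreover have "(Re (v $ i1))^2 \<ge> 0" "(Re (v $ i2))^2 \<ge> 0" "(Re (v $ i3))^2 \<ge> 0" by auto
      ultimately show ?thesis by linarith
    qed
  qed
  finally show ?thesis .
qed

lemma E8_kernel:
  fixes x0 :: real
  assumes "2 * x0 = x1" "2 * x1 = x0 + x2" "2 * x2 = x1 + x3 + x7" "2 * x3 = x2 + x4"
    "2 * x4 = x3 + x5" "2 * x5 = x4 + x6" "2 * x6 = x5" "2 * x7 = x2"
  shows "x0 = 0 \<and> x1 = 0 \<and> x2 = 0 \<and> x3 = 0 \<and> x4 = 0 \<and> x5 = 0 \<and> x6 = 0 \<and> x7 = 0"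
  using assms by linarith

text \<open>Definiteness concerns real vectors, whereas \<open>v\<close> is complex. Pairing with
  the basis gives the rows of the Cartan matrix, and the kernel is computed for real and imaginary
  parts separately.\<close>

lemma E8_nondegenerate:
  assumes "\<And>w. bil E8_form v w = 0"
  shows "v = 0"
proof -
  note e = assms[unfolded bil_E8]
  have "2 * v$0 = v$1" "2 * v$1 = v$0 + v$2" "2 * v$2 = v$1 + v$3 + v$7" "2 * v$3 = v$2 + v$4"
    "2 * v$4 = v$3 + v$5" "2 * v$5 = v$4 + v$6" "2 * v$6 = v$5" "2 * v$7 = v$2"
    using e[of "axis 0 1"] e[of "axis 1 1"] e[of "axis 2 1"] e[of "axis 3 1"]
      e[of "axis 4 1"] e[of "axis 5 1"] e[of "axis 6 1"] e[of "axis 7 1"]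
    by (simp_all add: axis_def)
  \<comment> \<open>The variables of \<open>E8_kernel\<close> are instantiated in the order of their
    first occurrence, which places \<open>x7\<close> directly after \<open>x3\<close>.\<close>
  then have "v$0 = 0 \<and> v$1 = 0 \<and> v$2 = 0 \<and> v$3 = 0 \<and> v$4 = 0 \<and> v$5 = 0 \<and> v$6 = 0 \<and> v$7 = 0"
    using E8_kernel[of "Re (v$0)" "Re (v$1)" "Re (v$2)" "Re (v$3)" "Re (v$7)" "Re (v$4)" "Re (v$5)" "Re (v$6)"]
      E8_kernel[of "Im (v$0)" "Im (v$1)" "Im (v$2)" "Im (v$3)" "Im (v$7)" "Im (v$4)" "Im (v$5)" "Im (v$6)"]
    by (simp add: complex_eq_iff)
  note z = this
  have "v $ i = 0" for i
  proof -
    have "i \<in> {0,1,2,3,4,5,6,7}" using UNIV_8 by blast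
    then show ?thesis using z by (elim insertE emptyE) simp_all
  qed
  then show ?thesis by (simp add: vec_eq_iff)
qed

lemma K3_nondegenerate:
  assumes q: "\<And>w. bil K3_form v w = 0"
  shows "v = 0"
proof -
  have "bil E8_form (\<chi> i. v $ Inl i) u = 0" for u
    using q[of "\<chi> k. case k of Inl i \<Rightarrow> u $ i | _ \<Rightarrow> 0"] by (simp add: bil_K3) (simp add: bil_def)
  then have a: "(\<chi> i. v $ Inl i) = 0" by (rule E8_nondegenerate)
  have "bil E8_form (\<chi> i. v $ Inr (Inl i)) u = 0" for u
    using q[of "\<chi> k. case k of Inr (Inl i) \<Rightarrow> u $ i | _ \<Rightarrow> 0"] by (simp add: bil_K3) (simp add: bil_def)
  then have b: "(\<chi> i. v $ Inr (Inl i)) = 0" by (rule E8_nondegenerate)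
  have *: "v $ Inl i = 0" "v $ Inr (Inl i) = 0" for i
    using a b by (auto simp: vec_eq_iff)
  have "v $ i1 = 0" "v $ j1 = 0" "v $ i2 = 0" "v $ j2 = 0" "v $ i3 = 0" "v $ j3 = 0"
    using q[of "axis j1 1"] q[of "axis i1 1"] q[of "axis j2 1"] q[of "axis i2 1"] q[of "axis j3 1"] q[of "axis i3 1"]
    by (simp_all add: bil_K3 axis_def) (simp_all add: bil_def)
  then have "v $ k = 0" for k
    using * by (cases k rule: k3_index_cases) simp_all
  then show ?thesis by (simp add: vec_eq_iff)
qed

section \<open>Lattice isometries and bilinear forms\<close>

lemma complex_linear_imp:
  assumes "complex_linear f"
  shows complex_linear_add: "f (x + y) = f x + f y"
    and complex_linear_scale: "f (c *s x) = c *s f x"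
  using assms unfolding complex_linear_def
  by (simp_all add: Vector_Spaces.linear_iff)

lemma complex_linearI:
  assumes "\<And>x y. f (x + y) = f x + f y" "\<And>c x. f (c *s x) = c *s f x"
  shows "complex_linear f"
  unfolding complex_linear_def using assms by unfold_locales (auto simp: vec.scale_right_distrib vec.scale_left_distrib)

lemma scaleR_eq_vector_scalar_mult: "r *\<^sub>R (x :: complex^'n) = of_real r *s x"
  by (simp add: vec_eq_iff scaleR_conv_of_real[symmetric])

lemma complex_linear_simps:
  assumes "complex_linear f"
  shows complex_linear_zero: "f 0 = 0"
    and complex_linear_diff: "f (x - y) = f x - f y"
    and complex_linear_scaleR: "f (r *\<^sub>R x) = r *\<^sub>R f x"
    and complex_linear_sum: "f (\<Sum>i\<in>I. h i) = (\<Sum>i\<in>I. f (h i))"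
proof -
  note l = complex_linear_imp[OF assms]
  show z: "f 0 = 0" using l(2)[of 0 0] by simp
  show "f (r *\<^sub>R x) = r *\<^sub>R f x" unfolding scaleR_eq_vector_scalar_mult by (rule l(2))
  have m: "f (- x) = - f x" for x using l(2)[of "-1" x] by (simp add: vec_eq_iff)
  show "f (x - y) = f x - f y" using l(1)[of x "- y"] m by simp
  show "f (\<Sum>i\<in>I. h i) = (\<Sum>i\<in>I. f (h i))"
    by (induct I rule: infinite_finite_induct) (auto simp: z l(1))
qed

lemma complex_vec_expand: "(v :: complex^'n) = (\<Sum>i\<in>UNIV. v $ i *s axis i 1)"
  by (simp add: basis_expansion)

lemma complex_linear_expand:
  assumes "complex_linear f" shows "f v = (\<Sum>i\<in>UNIV. v $ i *s f (axis i 1))"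
  by (subst complex_vec_expand[of v])
    (simp add: complex_linear_sum[OF assms] complex_linear_scale[OF assms])

lemma complex_linear_compose:
  assumes "complex_linear f" "complex_linear g"
  shows "complex_linear (\<lambda>x. f (g x))"
  by (rule complex_linearI) (simp_all add: complex_linear_imp[OF assms(1)] complex_linear_imp[OF assms(2)])

lemma coords_in_Ints_sum:
  assumes "v \<in> coords_in \<int>" "\<And>i. h i \<in> coords_in \<int>"
  shows "(\<Sum>i\<in>UNIV. v $ i *s h i) \<in> coords_in \<int>"
  using assms by (auto simp: coords_in_def intro!: Ints_sum Ints_mult)

lemma axis_coords_in_Ints: "axis i 1 \<in> coords_in \<int>"
  by (auto simp: coords_in_def axis_def)

lemma lattice_isometry_axis:
  assumes "lattice_isometry b b' f" shows "f (axis i 1) \<in> coords_in \<int>"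
  using assms axis_coords_in_Ints unfolding lattice_isometry_def bij_betw_def by blast

lemma cnj_vec_simps:
  "cnj_vec (x + y) = cnj_vec x + cnj_vec y" "cnj_vec (x - y) = cnj_vec x - cnj_vec y"
  "cnj_vec (c *s x) = cnj c *s cnj_vec x" "cnj_vec (cnj_vec x) = x" "cnj_vec 0 = 0"
  "cnj_vec x $ i = cnj (x $ i)"
  "cnj_vec (\<Sum>j\<in>J. h j) = (\<Sum>j\<in>J. cnj_vec (h j))"
  by (simp_all add: cnj_vec_def vec_eq_iff)

lemma coords_in_Ints_Reals: "coords_in \<int> \<subseteq> coords_in \<real>"
  unfolding coords_in_def by (auto elim!: Ints_cases) (metis Ints_cases Reals_of_int)

text \<open>The matrix of a lattice isometry has integer entries, so it commutes with
  conjugation.\<close>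

lemma lattice_isometry_cnj:
  assumes "lattice_isometry b b' f" shows "f (cnj_vec v) = cnj_vec (f v)"
proof -
  have f: "complex_linear f" using assms by (simp add: lattice_isometry_def)
  have "cnj_vec (f (axis i 1)) = f (axis i 1)" for i
    using lattice_isometry_axis[OF assms, of i] coords_in_Ints_Reals
    by (auto simp: coords_in_Reals_iff[symmetric])
  then show ?thesis
    unfolding complex_linear_expand[OF f, of v] complex_linear_expand[OF f, of "cnj_vec v"]
    by (simp add: cnj_vec_simps)
qed

lemma lattice_isometry_real:
  assumes "lattice_isometry b b' f" "v \<in> coords_in \<real>" shows "f v \<in> coords_in \<real>"
  using lattice_isometry_cnj[OF assms(1), of v] assms(2) by (simp add: coords_in_Reals_iff)

text \<open>Bijectivity is given on integral vectors. The preimages of the basis vectors are the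
  columns of the inverse matrix, and linearity extends both inverse laws from the basis to all
  complex vectors.\<close>

lemma lattice_isometry_inverse:
  fixes f :: "complex^'m \<Rightarrow> complex^'n"
  assumes iso: "lattice_isometry b b' f"
  obtains g where "lattice_isometry b' b g" "\<And>x. g (f x) = x" "\<And>y. f (g y) = y"
proof -
  have f: "complex_linear f" and bij: "bij_betw f (coords_in \<int>) (coords_in \<int>)"
    using iso by (auto simp: lattice_isometry_def)
  define u where "u j = inv_into (coords_in \<int>) f (axis j 1)" for j
  have u: "u j \<in> coords_in \<int>" "f (u j) = axis j 1" for j
    using bij axis_coords_in_Ints[of j] unfolding u_def bij_betw_def
    by (metis inv_into_into, metis f_inv_into_f)
  define g where "g v = (\<Sum>j\<in>UNIV. v $ j *s u j)" for v
  have g: "complex_linear g"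
    unfolding g_def by (rule complex_linearI)
      (simp_all add: vec.scale_left_distrib sum.distrib vec.scale_sum_right)
  have fg: "f (g y) = y" for y
    unfolding g_def by (simp add: complex_linear_sum[OF f] complex_linear_scale[OF f] u basis_expansion)
  have gi: "g v \<in> coords_in \<int>" if "v \<in> coords_in \<int>" for v
    unfolding g_def using that u by (intro coords_in_Ints_sum)
  have fi: "f v \<in> coords_in \<int>" if "v \<in> coords_in \<int>" for v
    using bij that by (auto simp: bij_betw_def)
  have gf1: "g (f v) = v" if "v \<in> coords_in \<int>" for v
    using bij fg[of "f v"] gi[OF fi[OF that]] that unfolding bij_betw_def inj_on_def by blast
  have gf: "g (f x) = x" for x
  proof -
    have "g (f x) = (\<Sum>i\<in>UNIV. x $ i *s g (f (axis i 1)))"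
      by (rule complex_linear_expand[OF complex_linear_compose[OF g f]])
    then show ?thesis using gf1[OF axis_coords_in_Ints] by (simp add: basis_expansion)
  qed
  have "bij_betw g (coords_in \<int>) (coords_in \<int>)"
    by (rule bij_betw_byWitness[where f' = f]) (auto simp: gf fg gi fi)
  moreover have "b (g v) (g w) = b' v w" if "v \<in> coords_in \<int>" "w \<in> coords_in \<int>" for v w
    using iso gi[OF that(1)] gi[OF that(2)] fg unfolding lattice_isometry_def by metis
  ultimately have "lattice_isometry b' b g" unfolding lattice_isometry_def using g by blast
  then show ?thesis using that gf fg by blast
qed

text \<open>The structure shared by the cup product and the Mukai pairing, both on the K3 lattice
  and on the cohomology of \<open>X\<close>, so that each argument about frames is made
  once.\<close>

locale real_form =
  fixes b :: "complex^'n \<Rightarrow> complex^'n \<Rightarrow> complex"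
  assumes add_left: "b (x + y) z = b x z + b y z"
    and scale_left: "b (c *s x) z = c * b x z"
    and sym: "b x y = b y x"
    and cnj: "b (cnj_vec x) (cnj_vec y) = cnj (b x y)"
begin

lemma add_right: "b z (x + y) = b z x + b z y"
  using add_left sym by metis

lemma scale_right: "b z (c *s x) = c * b z x"
  using scale_left sym by metis

lemma zero_left: "b 0 z = 0"
  using scale_left[of 0 0 z] by simp

lemma zero_right: "b z 0 = 0"
  using zero_left sym by metis

lemma minus_left: "b (- x) z = - b x z"
  using scale_left[of "-1" x z] by (simp add: vector_scalar_mult_def minus_mult_left[symmetric] vec_eq_iff uminus_vec_def)

lemma minus_right: "b z (- x) = - b z x"
  using minus_left sym by metis

lemma diff_left: "b (x - y) z = b x z - b y z"
  using add_left[of x "- y"] minus_left by simp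

lemma diff_right: "b z (x - y) = b z x - b z y"
  using diff_left sym by metis

lemma scaleR_left: "b (r *\<^sub>R x) z = of_real r * b x z"
  unfolding scaleR_eq_vector_scalar_mult by (rule scale_left)

lemma scaleR_right: "b z (r *\<^sub>R x) = of_real r * b z x"
  using scaleR_left sym by metis

lemma sum_left: "b (\<Sum>i\<in>I. h i) z = (\<Sum>i\<in>I. b (h i) z)"
  by (induct I rule: infinite_finite_induct) (auto simp: zero_left add_left)

lemma sum_right: "b z (\<Sum>i\<in>I. h i) = (\<Sum>i\<in>I. b z (h i))"
  using sum_left sym by (metis (mono_tags, lifting) sum.cong)

lemmas form_simps = add_left add_right scale_left scale_right zero_left zero_right minus_left
  minus_right diff_left diff_right scaleR_left scaleR_right

end

lemma lattice_isometry_form: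
  assumes iso: "lattice_isometry b b' f" and "real_form b" "real_form b'"
  shows "b' (f v) (f w) = b v w"
proof -
  interpret b: real_form b by fact
  interpret b': real_form b' by fact
  have f: "complex_linear f" using iso by (auto simp: lattice_isometry_def)
  have e: "b' (f (axis i 1)) (f (axis j 1)) = b (axis i 1) (axis j 1)" for i j
    using iso axis_coords_in_Ints by (auto simp: lattice_isometry_def)
  have "b v w = (\<Sum>i\<in>UNIV. v $ i * (\<Sum>j\<in>UNIV. w $ j * b (axis i 1) (axis j 1)))"
    by (subst complex_vec_expand[of v], subst complex_vec_expand[of w])
      (simp only: b.sum_left b.scale_left, simp only: b.sum_right b.scale_right)
  also have "\<dots> = b' (f v) (f w)"
    unfolding complex_linear_expand[OF f, of v] complex_linear_expand[OF f, of w]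
    by (simp only: b'.sum_left b'.scale_left, simp only: b'.sum_right b'.scale_right e)
  finally show ?thesis by simp
qed

section \<open>A criterion for signed isometries\<close>

definition frame_act :: "real^4^4 \<Rightarrow> (complex^'n)^4 \<Rightarrow> (complex^'n)^4" where
  "frame_act A F = (\<chi> i. \<Sum>j\<in>UNIV. A $ i $ j *\<^sub>R F $ j)"

definition frame_comb :: "real^4 \<Rightarrow> (complex^'n)^4 \<Rightarrow> complex^'n" where
  "frame_comb c F = (\<Sum>i\<in>UNIV. c $ i *\<^sub>R F $ i)"

definition frame_map :: "(complex^'m \<Rightarrow> complex^'n) \<Rightarrow> (complex^'m)^4 \<Rightarrow> (complex^'n)^4" where
  "frame_map f F = (\<chi> i. f (F $ i))"

lemma orientation_class_eq: "orientation_class F = {frame_act A F |A. det A > 0}"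
  unfolding orientation_class_def frame_act_def by auto

lemma det_0_kernel:
  fixes A :: "real^'n^'n" assumes "det A = 0" shows "\<exists>c. c \<noteq> 0 \<and> A *v c = 0"
  using assms invertible_det_nz[of A] matrix_left_invertible_ker[of A] invertible_left_inverse[of A]
  by blast

lemma frame_act_mult: "frame_act (A ** B) F = frame_act A (frame_act B F)"
proof -
  have "(\<Sum>j\<in>UNIV. (\<Sum>k\<in>UNIV. A $ i $ k * B $ k $ j) *\<^sub>R F $ j)
      = (\<Sum>k\<in>UNIV. A $ i $ k *\<^sub>R (\<Sum>j\<in>UNIV. B $ k $ j *\<^sub>R F $ j))" for i
    by (simp add: scaleR_sum_left scaleR_sum_right) (rule sum.swap)
  then show ?thesis unfolding frame_act_def matrix_matrix_mult_def by (simp add: vec_eq_iff)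
qed

lemma frame_act_diff: "frame_act A (F - G) = frame_act A F - frame_act A G"
  unfolding frame_act_def by (simp add: vec_eq_iff scaleR_right_diff_distrib sum_subtractf)

lemma frame_map_act:
  assumes "complex_linear f"
  shows "frame_map f (frame_act A F) = frame_act A (frame_map f F)"
  unfolding frame_map_def frame_act_def
  by (simp add: vec_eq_iff complex_linear_sum[OF assms] complex_linear_scaleR[OF assms])

lemma frame_comb_act: "frame_comb c (frame_act A F) = frame_comb (transpose A *v c) F"
proof -
  have "(\<Sum>i\<in>UNIV. c $ i *\<^sub>R (\<Sum>j\<in>UNIV. A $ i $ j *\<^sub>R F $ j))
     = (\<Sum>j\<in>UNIV. (\<Sum>i\<in>UNIV. A $ i $ j * c $ i) *\<^sub>R F $ j)"
    by (simp add: scaleR_sum_left scaleR_sum_right mult.commute) (rule sum.swap)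
  then show ?thesis
    unfolding frame_comb_def frame_act_def transpose_def matrix_vector_mult_def by simp
qed

lemma frame_comb_add: "frame_comb c (F + G) = frame_comb c F + frame_comb c G"
  unfolding frame_comb_def by (simp add: scaleR_right_distrib sum.distrib)

lemma orientation_class_act:
  assumes "det A > 0"
  shows "orientation_class (frame_act A F) = orientation_class F"
proof -
  have "invertible A" using assms by (simp add: invertible_det_nz)
  then obtain B where B: "A ** B = mat 1" "B ** A = mat 1" unfolding invertible_def by blast
  have "det A * det B = 1" using B(1) by (metis det_I det_mul)
  then have dB: "det B > 0" using assms by (metis zero_less_mult_pos zero_less_one)
  show ?thesis
  proof (intro equalityI subsetI)
    fix G assume "G \<in> orientation_class (frame_act A F)"
    then obtain C where "det C > 0" "G = frame_act (C ** A) F"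
      by (auto simp: orientation_class_eq frame_act_mult)
    moreover from this have "det (C ** A) > 0" using assms by (simp add: det_mul)
    ultimately show "G \<in> orientation_class F" unfolding orientation_class_eq by blast
  next
    fix G assume "G \<in> orientation_class F"
    then obtain C where C: "det C > 0" "G = frame_act C F"
      by (auto simp: orientation_class_eq)
    have "G = frame_act (C ** B) (frame_act A F)"
      using B(2) by (simp add: C frame_act_mult[symmetric] matrix_mul_assoc[symmetric])
    moreover have "det (C ** B) > 0" using C dB by (simp add: det_mul)
    ultimately show "G \<in> orientation_class (frame_act A F)" unfolding orientation_class_eq by blast
  qed
qed

lemma orientation_class_image: "orientation_class F = (\<lambda>A. frame_act A F) ` {A. det A > 0}"
  unfolding orientation_class_eq by blast

lemma frame_map_orientation_class:
  assumes "complex_linear f"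
  shows "frame_map f ` orientation_class F = orientation_class (frame_map f F)"
  unfolding orientation_class_image by (simp add: image_image frame_map_act[OF assms])

context real_form begin

text \<open>\<open>A\<close> is the matrix of the orthogonal projection of the frame
  \<open>F\<close> to the span of \<open>G\<close>, written in the basis \<open>G\<close>. The sign
  of its determinant tells whether the projection respects the orientations.\<close>

definition frame_perp :: "(complex^'n)^4 \<Rightarrow> real^4^4 \<Rightarrow> (complex^'n)^4 \<Rightarrow> bool" where
  "frame_perp F A G \<longleftrightarrow> (\<forall>i k. Re (b ((F - frame_act A G) $ i) (G $ k)) = 0)"

lemma positive_frames_iff: "F \<in> positive_frames b \<longleftrightarrow> (\<forall>i. F $ i \<in> coords_in \<real>) \<and>
    (\<forall>c. c \<noteq> 0 \<longrightarrow> Re (b (frame_comb c F) (frame_comb c F)) > 0)"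
  unfolding positive_frames_def frame_comb_def by simp

lemma frame_comb_real:
  assumes "\<And>i. F $ i \<in> coords_in \<real>" shows "frame_comb c F \<in> coords_in \<real>"
  using assms by (auto simp: frame_comb_def coords_in_def complex_is_Real_iff)

lemma frame_act_real:
  assumes "\<And>i. F $ i \<in> coords_in \<real>" shows "frame_act A F $ i \<in> coords_in \<real>"
  using assms by (auto simp: frame_act_def coords_in_def complex_is_Real_iff)

lemma Re_b_frame_comb:
  "Re (b v (frame_comb c F)) = (\<Sum>i\<in>UNIV. c $ i * Re (b v (F $ i)))"
  unfolding frame_comb_def by (simp add: sum_right scaleR_right)

text \<open>The Gram matrix \<open>Q\<close> of \<open>G\<close> is definite, hence invertible, and
  the projection has as its matrix the mixed Gram matrix \<open>M\<close> times the inverse of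
  \<open>Q\<close>.\<close>

lemma frame_perp_exists:
  assumes G: "G \<in> positive_frames b"
  shows "\<exists>A. frame_perp F A G"
proof -
  define Q where "Q = (\<chi> i j. Re (b (G $ i) (G $ j)))"
  define M where "M = (\<chi> i j. Re (b (F $ i) (G $ j)))"
  have "c = 0" if "Q *v c = 0" for c
  proof (rule ccontr)
    assume "c \<noteq> 0"
    then have "Re (b (frame_comb c G) (frame_comb c G)) > 0" using G by (simp add: positive_frames_iff)
    also have "Re (b (frame_comb c G) (frame_comb c G)) = c \<bullet> (Q *v c)"
      by (subst Re_b_frame_comb, subst sym, subst Re_b_frame_comb)
        (simp add: inner_vec_def matrix_vector_mult_def Q_def mult.commute sym)
    finally show False using that by simp
  qed
  then have "invertible Q"
    using det_0_kernel[of Q] by (auto simp: invertible_det_nz)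
  then obtain R where R: "R ** Q = mat 1" unfolding invertible_def by blast
  have "(M ** R) ** Q = M" using R by (simp add: matrix_mul_assoc[symmetric])
  then have "(\<Sum>j\<in>UNIV. (M ** R) $ i $ j * Q $ j $ k) = M $ i $ k" for i k
    by (metis (mono_tags, lifting) matrix_matrix_mult_def sum.cong vec_lambda_beta)
  then have "frame_perp F (M ** R) G"
    unfolding frame_perp_def frame_act_def Q_def M_def
    by (simp add: diff_left sum_left scaleR_left)
  then show ?thesis ..
qed

end

lemma frame_map_positive:
  assumes f: "lattice_isometry b b' f" "real_form b" "real_form b'" and F: "F \<in> positive_frames b"
  shows "frame_map f F \<in> positive_frames b'"
proof -
  have lin: "complex_linear f" using f by (simp add: lattice_isometry_def)
  have "frame_comb c (frame_map f F) = f (frame_comb c F)" for c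
    unfolding frame_comb_def frame_map_def
    by (simp add: complex_linear_sum[OF lin] complex_linear_scaleR[OF lin])
  then show ?thesis
    using F lattice_isometry_real[OF f(1)] lattice_isometry_form[OF f]
    by (simp add: real_form.positive_frames_iff[OF f(2)] real_form.positive_frames_iff[OF f(3)]) (simp add: frame_map_def)
qed

lemma frame_perp_map:
  assumes f: "lattice_isometry b b' f" "real_form b" "real_form b'" and "real_form.frame_perp b F A G"
  shows "real_form.frame_perp b' (frame_map f F) A (frame_map f G)"
proof -
  have lin: "complex_linear f" using f by (simp add: lattice_isometry_def)
  have "(frame_map f F - frame_act A (frame_map f G)) $ i = f ((F - frame_act A G) $ i)" for i
    unfolding frame_map_act[OF lin, symmetric]
    by (simp add: frame_map_def complex_linear_diff[OF lin])
  then show ?thesis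
    using assms(4) lattice_isometry_form[OF f]
    unfolding real_form.frame_perp_def[OF f(2)] real_form.frame_perp_def[OF f(3)] by (simp add: frame_map_def)
qed

text \<open>"At most four positive directions", expressed by a real-linear map to R^4 with
  nonpositive kernel. In this form the property is easily pulled back along an isometry, and four is
  also the size of a frame.\<close>

locale four_positive_form = real_form b for b :: "complex^'n \<Rightarrow> complex^'n \<Rightarrow> complex" +
  fixes \<pi> :: "complex^'n \<Rightarrow> real^4"
  assumes linear_pi: "linear \<pi>"
    and nonpos_ker: "v \<in> coords_in \<real> \<Longrightarrow> \<pi> v = 0 \<Longrightarrow> Re (b v v) \<le> 0"
begin

text \<open>On the span of a positive 4-frame \<open>\<pi>\<close> is injective, hence onto. A
  vector of the span therefore moves \<open>v\<close> into the kernel of \<open>\<pi>\<close>; being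
  orthogonal to \<open>v\<close>, it only adds a nonnegative square, so a positive square of
  \<open>v\<close> would survive in the kernel.\<close>

lemma nonpos_perp:
  assumes G: "G \<in> positive_frames b" and v: "v \<in> coords_in \<real>"
    and perp: "\<And>k. Re (b v (G $ k)) = 0"
  shows "Re (b v v) \<le> 0"
proof (rule ccontr)
  assume "\<not> ?thesis"
  then have vv: "Re (b v v) > 0" by simp
  define L where "L c = \<pi> (frame_comb c G)" for c
  have lc: "linear (\<lambda>c. frame_comb c G)"
    unfolding frame_comb_def
    by (rule linearI) (simp_all add: scaleR_left_distrib sum.distrib scaleR_sum_right)
  have "linear L" unfolding L_def using linear_compose[OF lc linear_pi] by (simp add: o_def)
  have real: "frame_comb c G \<in> coords_in \<real>" for c
    using G by (intro frame_comb_real) (auto simp: positive_frames_iff)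
  have "inj L"
    unfolding linear_injective_0[OF \<open>linear L\<close>]
  proof (intro allI impI)
    fix c assume "L c = 0"
    then have "Re (b (frame_comb c G) (frame_comb c G)) \<le> 0"
      using nonpos_ker[OF real] by (simp add: L_def)
    then show "c = 0" using G by (force simp: positive_frames_iff)
  qed
  then have "surj L" using linear_injective_imp_surjective[OF \<open>linear L\<close>] by simp
  then obtain c where c: "L c = - \<pi> v" by (metis surjD)
  define u where "u = frame_comb c G + v"
  have "\<pi> u = 0" using c linear_pi by (simp add: u_def L_def linear_add)
  moreover have "u \<in> coords_in \<real>"
    using real[of c] v by (auto simp: u_def coords_in_def)
  ultimately have "Re (b u u) \<le> 0" by (rule nonpos_ker[rotated])
  moreover have "Re (b v (frame_comb c G)) = 0" unfolding Re_b_frame_comb by (simp add: perp)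
  then have "Re (b u u) = Re (b (frame_comb c G) (frame_comb c G)) + Re (b v v)"
    unfolding u_def by (simp add: form_simps sym[of "frame_comb c G" v])
  moreover have "Re (b (frame_comb c G) (frame_comb c G)) \<ge> 0"
  proof (cases "c = 0")
    case True then show ?thesis by (simp add: frame_comb_def zero_left)
  next
    case False then show ?thesis using G by (force simp: positive_frames_iff)
  qed
  ultimately show False using vv by simp
qed

text \<open>Pythagoras: a combination of \<open>F\<close> is its projection \<open>p\<close> to the
  span of \<open>G\<close> plus an orthogonal remainder \<open>r\<close>, and
  \<open>nonpos_perp\<close> applies to \<open>r\<close>.\<close>

lemma frame_perp_comb:
  assumes F: "F \<in> positive_frames b" and G: "G \<in> positive_frames b" and A: "frame_perp F A G"
  defines "p \<equiv> \<lambda>c. frame_comb c (frame_act A G)" and "r \<equiv> \<lambda>c. frame_comb c (F - frame_act A G)"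
  shows "Re (b (r c) (r c)) \<le> 0" and "Re (b (p c) (r c)) = 0"
    and "c \<noteq> 0 \<Longrightarrow> Re (b (p c) (p c)) + Re (b (r c) (r c)) > 0"
proof -
  have rG: "Re (b (r c) (G $ k)) = 0" for k
    unfolding r_def using A by (subst sym, subst Re_b_frame_comb) (simp add: frame_perp_def sym)
  have "(F - frame_act A G) $ i \<in> coords_in \<real>" for i
    using F G frame_act_real[of G A i] by (auto simp: positive_frames_iff coords_in_def)
  then have "r c \<in> coords_in \<real>"
    unfolding r_def by (rule frame_comb_real)
  then show "Re (b (r c) (r c)) \<le> 0" using nonpos_perp[OF G _ rG] by blast
  show pr: "Re (b (p c) (r c)) = 0"
    unfolding p_def frame_comb_act by (subst sym, subst Re_b_frame_comb) (simp add: rG)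
  have "frame_comb c F = p c + r c" unfolding p_def r_def frame_comb_add[symmetric] by simp
  then have eq: "Re (b (frame_comb c F) (frame_comb c F)) = Re (b (p c) (p c)) + Re (b (r c) (r c))"
    using pr by (simp add: form_simps sym[of "r c" "p c"])
  then show "c \<noteq> 0 \<Longrightarrow> Re (b (p c) (p c)) + Re (b (r c) (r c)) > 0"
    unfolding eq[symmetric] using F by (simp add: positive_frames_iff)
qed

text \<open>A combination of \<open>F\<close> killed by the projection would equal its remainder and
  have nonpositive square.\<close>

lemma frame_perp_det:
  assumes F: "F \<in> positive_frames b" and G: "G \<in> positive_frames b" and A: "frame_perp F A G"
  shows "det A \<noteq> 0"
proof
  assume "det A = 0"
  then have "det (transpose A) = 0" by (simp add: det_transpose)
  then obtain c where c: "c \<noteq> 0" "transpose A *v c = 0"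
    using det_0_kernel by blast
  then have "frame_comb c (frame_act A G) = 0" unfolding frame_comb_act by (simp add: c(2)) (simp add: frame_comb_def)
  then show False using frame_perp_comb[OF F G A, of c] c(1) by (simp add: zero_left)
qed

text \<open>The segment from the projected frame to \<open>F\<close> stays positive: at time
  \<open>t\<close> a combination has square (p.p) + t^2 (r.r), which is smallest at
  \<open>t = 1\<close> because (r.r) is nonpositive, and there it is the square of a combination of
  \<open>F\<close>. A positive determinant means that the projected frame represents the orientation
  class of \<open>G\<close>.\<close>

lemma frame_perp_connected:
  assumes F: "F \<in> positive_frames b" and G: "G \<in> positive_frames b" and A: "frame_perp F A G"
    and det: "det A > 0"
  shows "connected_component_of (oriented_positive_subspaces b) (orientation_class F) (orientation_class G)"
proof -
  define p where "p = frame_act A G"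
  define \<gamma> where "\<gamma> t = p + t *\<^sub>R (F - p)" for t :: real
  have pos: "\<gamma> t \<in> positive_frames b" if "t \<in> {0..1}" for t
    unfolding positive_frames_iff
  proof (intro conjI allI impI)
    fix i show "\<gamma> t $ i \<in> coords_in \<real>"
      using F G frame_act_real[of G A i]
      by (auto simp: positive_frames_iff coords_in_def \<gamma>_def p_def complex_is_Real_iff)
  next
    fix c :: "real^4" assume c: "c \<noteq> 0"
    define x where "x = frame_comb c p"
    define r where "r = frame_comb c (F - p)"
    note pc = frame_perp_comb[OF F G A, of c, folded p_def, folded x_def r_def]
    have "frame_comb c (\<gamma> t) = x + t *\<^sub>R r"
      unfolding \<gamma>_def frame_comb_add x_def r_def
      by (simp add: frame_comb_def scaleR_sum_right mult.commute)
    then have "Re (b (frame_comb c (\<gamma> t)) (frame_comb c (\<gamma> t))) = Re (b x x) + t^2 * Re (b r r)"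
      using pc(2) by (simp add: form_simps sym[of r x] power2_eq_square)
    moreover have "t^2 \<le> 1" using that by (simp add: power_le_one)
    then have "t^2 * Re (b r r) \<ge> 1 * Re (b r r)"
      using pc(1) by (rule mult_right_mono_neg)
    ultimately show "Re (b (frame_comb c (\<gamma> t)) (frame_comb c (\<gamma> t))) > 0"
      using pc(3)[OF c] by linarith
  qed
  let ?T = "top_of_set (positive_frames b)" and ?O = "oriented_positive_subspaces b"
  have top: "topspace ?O = orientation_class ` positive_frames b"
  proof (rule antisym)
    show "topspace ?O \<subseteq> orientation_class ` positive_frames b"
      using openin_topspace[of ?O] unfolding openin_oriented_positive_subspaces by blast
    have "{F \<in> positive_frames b. orientation_class F \<in> orientation_class ` positive_frames b} = positive_frames b"
      by blast
    then have "openin ?O (orientation_class ` positive_frames b)"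
      unfolding openin_oriented_positive_subspaces by simp
    then show "orientation_class ` positive_frames b \<subseteq> topspace ?O" by (rule openin_subset)
  qed
  have cont: "continuous_map ?T ?O orientation_class"
    unfolding continuous_map by (auto simp: top openin_oriented_positive_subspaces)
  have "continuous_on {0..1} \<gamma>" unfolding \<gamma>_def by (intro continuous_intros)
  then have "connected (\<gamma> ` {0..1})" by (intro connected_continuous_image) auto
  moreover have "\<gamma> ` {0..1} \<subseteq> positive_frames b" using pos by blast
  ultimately have "connectedin ?T (\<gamma> ` {0..1})" by (simp add: connectedin_subtopology)
  then have "connectedin ?O (orientation_class ` (\<gamma> ` {0..1}))"
    by (rule connectedin_continuous_map_image[OF cont])
  moreover have "orientation_class (\<gamma> t) \<in> orientation_class ` (\<gamma> ` {0..1})" if "t \<in> {0..1}" for t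
    using that by (intro imageI)
  then have "orientation_class (\<gamma> 1) \<in> orientation_class ` (\<gamma> ` {0..1})"
    "orientation_class (\<gamma> 0) \<in> orientation_class ` (\<gamma> ` {0..1})" by simp_all
  moreover have "\<gamma> 1 = F" by (simp add: \<gamma>_def)
  moreover have "orientation_class (\<gamma> 0) = orientation_class G"
    unfolding \<gamma>_def p_def by (simp add: orientation_class_act[OF det])
  ultimately show ?thesis unfolding connected_component_of_def by metis
qed

text \<open>Change of basis for a projection matrix, with \<open>D\<close> its own inverse.\<close>

lemma frame_perp_act:
  assumes "frame_perp F A G" "D ** D = mat 1"
  shows "frame_perp F (A ** D) (frame_act D G)"
    and "frame_perp (frame_act D F) (D ** A ** D) (frame_act D G)"
proof -
  have *: "frame_act (C ** D) (frame_act D G) = frame_act C G" for C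
    using assms(2) by (simp add: frame_act_mult[symmetric] matrix_mul_assoc[symmetric])
  have r: "Re (b ((F - frame_act A G) $ i) (frame_act D G $ k)) = 0" for i k
    using assms(1) unfolding frame_act_def frame_perp_def by (simp add: sum_right scaleR_right)
  show "frame_perp F (A ** D) (frame_act D G)"
    unfolding frame_perp_def * using r by simp
  have "(frame_act D F - frame_act (D ** A) G) = frame_act D (F - frame_act A G)"
    by (simp add: frame_act_diff frame_act_mult)
  then show "frame_perp (frame_act D F) (D ** A ** D) (frame_act D G)"
    unfolding frame_perp_def * using r by (simp add: frame_act_def[of D "F - _"] sum_left scaleR_left)
qed

lemma frame_act_positive:
  assumes F: "F \<in> positive_frames b" and "D ** D = mat 1"
  shows "frame_act D F \<in> positive_frames b"
  unfolding positive_frames_iff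
proof (intro conjI allI impI)
  fix i show "frame_act D F $ i \<in> coords_in \<real>"
    using F by (intro frame_act_real) (auto simp: positive_frames_iff)
next
  fix c :: "real^4" assume c: "c \<noteq> 0"
  have "transpose D ** transpose D = mat 1"
    using assms(2) by (metis matrix_transpose_mul transpose_mat)
  then have "transpose D *v (transpose D *v c) = c"
    by (simp only: matrix_vector_mul_assoc matrix_vector_mul_lid)
  then have nz: "transpose D *v c \<noteq> 0" using c by (metis matrix_vector_mult_0_right)
  then show "0 < Re (b (frame_comb c (frame_act D F)) (frame_comb c (frame_act D F)))"
    unfolding frame_comb_act using F nz by (simp only: positive_frames_iff)
qed

text \<open>One test frame decides for all frames. If \<open>F\<close> projects to \<open>F0\<close>
  with matrix \<open>B\<close>, then its image projects to the image of \<open>F0\<close> with the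
  same \<open>B\<close>; for \<open>det B > 0\<close> this gives a chain from \<open>F\<close> over
  \<open>F0\<close> and its image to the image of \<open>F\<close>.\<close>

lemma connected_orientation_class_map:
  assumes f: "lattice_isometry b b f" and F0: "F0 \<in> positive_frames b"
    and A: "frame_perp (frame_map f F0) A F0" "det A > 0"
    and F: "F \<in> positive_frames b"
  shows "connected_component_of (oriented_positive_subspaces b)
    (orientation_class F) (orientation_class (frame_map f F))"
proof -
  let ?conn = "\<lambda>F G. connected_component_of (oriented_positive_subspaces b) (orientation_class F) (orientation_class G)"
  have *: "?conn F (frame_map f F)"
    if F1: "F1 \<in> positive_frames b" "frame_perp F B F1" "det B > 0"
      "frame_perp (frame_map f F1) C F1" "det C > 0" for F1 B C
  proof -
    note fpos = frame_map_positive[OF f real_form_axioms real_form_axioms]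
    have "?conn F F1" using frame_perp_connected[OF F F1(1-3)] .
    moreover have "?conn (frame_map f F) (frame_map f F1)"
      using frame_perp_connected[OF fpos[OF F] fpos[OF F1(1)] frame_perp_map[OF f real_form_axioms real_form_axioms F1(2)] F1(3)] .
    moreover have "?conn (frame_map f F1) F1"
      using frame_perp_connected[OF fpos[OF F1(1)] F1(1) F1(4,5)] .
    ultimately show ?thesis
      by (meson connected_component_of_sym connected_component_of_trans)
  qed
  obtain B where B: "frame_perp F B F0" using frame_perp_exists[OF F0] by blast
  show ?thesis
  proof (cases "det B > 0")
    case True
    then show ?thesis using *[OF F0 B] A by blast
  next
    case False
    then have dB: "det B < 0" using frame_perp_det[OF F F0 B] by simp
    \<comment> \<open>If \<open>F\<close> and \<open>F0\<close> are oppositely oriented, the first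
      vector of \<open>F0\<close> is reversed. This changes the sign of \<open>det B\<close>, while
      conjugation by \<open>D\<close> preserves \<open>det A\<close>.\<close>
    define D :: "real^4^4" where "D = (\<chi> i j. if i = j then (if i = 1 then -1 else 1) else 0)"
    have DD: "D ** D = mat 1"
      unfolding D_def matrix_matrix_mult_def mat_def
      by (simp add: vec_eq_iff if_distrib[of "\<lambda>x. x * _"] cong: if_cong)
    have "det D = (\<Prod>i\<in>UNIV. D $ i $ i)" by (rule det_diagonal) (simp add: D_def)
    also have "\<dots> = -1" unfolding UNIV_4 by (simp add: D_def)
    finally have dD: "det D = -1" .
    have fD: "frame_map f (frame_act D F0) = frame_act D (frame_map f F0)"
      using f by (intro frame_map_act) (simp add: lattice_isometry_def)
    show ?thesis
    proof (rule *[of "frame_act D F0" "B ** D" "D ** A ** D"])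
      show "frame_act D F0 \<in> positive_frames b" by (rule frame_act_positive[OF F0 DD])
      show "frame_perp F (B ** D) (frame_act D F0)" by (rule frame_perp_act(1)[OF B DD])
      show "frame_perp (frame_map f (frame_act D F0)) (D ** A ** D) (frame_act D F0)"
        unfolding fD by (rule frame_perp_act(2)[OF A(1) DD])
    qed (use dB dD A(2) in \<open>simp_all add: det_mul\<close>)
  qed
qed

text \<open>Each class is connected to its image, so each component is mapped into itself. The
  inverse has the same property, as seen by applying the statement for \<open>f\<close> to the frame
  \<open>frame_map g F\<close>, and this turns the inclusion into equality.\<close>

theorem signed_isometry_criterion:
  assumes f: "lattice_isometry b b f" and F0: "F0 \<in> positive_frames b"
    and A: "frame_perp (frame_map f F0) A F0" "det A > 0"
  shows "signed_isometry b f"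
proof -
  let ?O = "oriented_positive_subspaces b"
  obtain g where g: "lattice_isometry b b g" and gf: "\<And>x. g (f x) = x" and fg: "\<And>x. f (g x) = x"
    using lattice_isometry_inverse[OF f] by blast
  have fgF: "frame_map f (frame_map g F) = F" and gfF: "frame_map g (frame_map f F) = F" for F
    by (simp_all add: frame_map_def fg gf)
  have F0g: "frame_map g F0 \<in> positive_frames b" by (rule frame_map_positive[OF g real_form_axioms real_form_axioms F0])
  have "frame_perp F0 A (frame_map g F0)"
    using frame_perp_map[OF g real_form_axioms real_form_axioms A(1)] by (simp add: gfF)
  then have Ag: "frame_perp (frame_map f (frame_map g F0)) A (frame_map g F0)" by (simp add: fgF)
  have sub: "(\<lambda>\<O>. frame_map h ` \<O>) ` C \<subseteq> C"
    if C: "C \<in> connected_components_of ?O" and h: "complex_linear h"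
      and conn: "\<And>F. F \<in> positive_frames b \<Longrightarrow>
        connected_component_of ?O (orientation_class F) (orientation_class (frame_map h F))" for C h
  proof (rule image_subsetI)
    fix \<O> assume O: "\<O> \<in> C"
    have "\<O> \<in> topspace ?O" using C O connected_components_of_subset by blast
    then obtain F where F: "F \<in> positive_frames b" "\<O> = orientation_class F"
      using openin_topspace[of ?O] unfolding openin_oriented_positive_subspaces by blast
    have "frame_map h ` \<O> = orientation_class (frame_map h F)"
      unfolding F(2) by (rule frame_map_orientation_class[OF h])
    moreover have "connected_component_of ?O \<O> (orientation_class (frame_map h F))"
      using conn[OF F(1)] F(2) by simp
    moreover obtain x where x: "C = connected_component_of_set ?O x"
      using C by (auto simp: connected_components_of_def)
    ultimately show "frame_map h ` \<O> \<in> C"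
      using O by (simp add: x) (meson connected_component_of_trans)
  qed
  have conn_f: "connected_component_of ?O (orientation_class F) (orientation_class (frame_map f F))"
    if "F \<in> positive_frames b" for F
    by (rule connected_orientation_class_map[OF f F0 A that])
  have conn_g: "connected_component_of ?O (orientation_class F) (orientation_class (frame_map g F))"
    if "F \<in> positive_frames b" for F
    using conn_f[OF frame_map_positive[OF g real_form_axioms real_form_axioms that]]
    by (simp add: fgF connected_component_of_sym)
  show ?thesis
    unfolding signed_isometry_def frame_map_def[symmetric]
  proof (intro ballI antisym)
    fix C assume C: "C \<in> connected_components_of ?O"
    show "(`) (frame_map f) ` C \<subseteq> C"
      using f by (intro sub C conn_f) (auto simp: lattice_isometry_def)
    have "(`) (frame_map g) ` C \<subseteq> C"
      using g by (intro sub C conn_g) (auto simp: lattice_isometry_def)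
    then have "\<O> = frame_map f ` (frame_map g ` \<O>) \<and> frame_map g ` \<O> \<in> C" if "\<O> \<in> C" for \<O>
      using that by (auto simp: image_image fgF)
    then show "C \<subseteq> (`) (frame_map f) ` C" by blast
  qed
qed

end

section \<open>Symmetry and continuity of the K3 form\<close>

lemma bil_axis: "bil Q (axis i 1) (axis j 1) = of_int (Q $ i $ j)"
proof -
  have "bil Q (axis i 1) (axis j 1) = (\<Sum>k\<in>UNIV. \<Sum>l\<in>UNIV. (if l = j then if k = i then of_int (Q $ k $ l) else 0 else 0))"
    unfolding bil_def by (intro sum.cong) (auto simp: axis_def)
  then show ?thesis by simp
qed

lemma real_form_bil:
  assumes "\<And>i j. Q $ i $ j = Q $ j $ i"
  shows "real_form (bil Q)"
proof
  show "bil Q x y = bil Q y x" for x y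
    unfolding bil_def by (subst sum.swap) (simp add: assms mult.commute mult.left_commute)
qed (simp_all add: bil_def sum.distrib distrib_left distrib_right sum_distrib_left cnj_vec_def mult.assoc mult.left_commute)

lemma E8_form_sym: "E8_form $ i $ j = E8_form $ j $ i"
  by (simp add: E8_form_def insert_commute)

lemma block_sum_sym:
  assumes "\<And>i j. P $ i $ j = P $ j $ i" "\<And>i j. Q $ i $ j = Q $ j $ i"
  shows "block_sum P Q $ i $ j = block_sum P Q $ j $ i"
  unfolding block_sum_def by (auto split: sum.splits simp: assms)

lemma K3_form_sym: "K3_form $ i $ j = K3_form $ j $ i"
  unfolding K3_form_def by (intro block_sum_sym) (auto simp: E8_form_sym U_form_def)

interpretation K3: real_form "bil K3_form"
  by (rule real_form_bil) (rule K3_form_sym)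

lemma bounded_bilinear_bil: "bounded_bilinear (bil Q)"
  unfolding bilinear_conv_bounded_bilinear[symmetric] bilinear_def
  by (auto intro!: linearI simp: bil_def sum.distrib distrib_left distrib_right sum_distrib_left scaleR_sum_right algebra_simps scaleR_conv_of_real[where 'a = complex])

lemma continuous_on_bil [continuous_intros]:
  assumes "continuous_on S f" "continuous_on S g"
  shows "continuous_on S (\<lambda>x. bil Q (f x) (g x))"
  using bounded_bilinear.continuous_on[OF bounded_bilinear_bil assms] .

lemma continuous_on_cnj_vec [continuous_intros]:
  assumes "continuous_on S f" shows "continuous_on S (\<lambda>x. cnj_vec (f x))"
  unfolding cnj_vec_def using assms by (intro continuous_intros)

lemma tendsto_bil:
  assumes "(f \<longlongrightarrow> a) F" "(g \<longlongrightarrow> c) F"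
  shows "((\<lambda>x. bil Q (f x) (g x)) \<longlongrightarrow> bil Q a c) F"
  using bounded_bilinear.tendsto[OF bounded_bilinear_bil assms] .

lemma bil_ell: "bil K3_form v (ell d) = of_nat d * v $ i1 + v $ j1"
  unfolding bil_K3 ell_def e1_def f1_def
  by (simp add: axis_def) (simp add: bil_def)

lemma ell_real: "ell d \<in> coords_in \<real>"
  by (auto simp: coords_in_def ell_def e1_def f1_def axis_def)

lemma cnj_ell [simp]: "cnj_vec (ell d) = ell d"
  using ell_real coords_in_Reals_iff by blast

lemma bil_ell_ell: "bil K3_form (ell d) (ell d) = 2 * of_nat d"
  unfolding bil_ell by (simp add: ell_def e1_def f1_def axis_def)

section \<open>Local finiteness of roots\<close>

definition period_cone :: "nat \<Rightarrow> (complex^k3_index) set" where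
  "period_cone d = {v. bil K3_form v (ell d) = 0 \<and> bil K3_form v v = 0 \<and> Re (bil K3_form v (cnj_vec v)) > 0}"

definition roots :: "nat \<Rightarrow> (complex^k3_index) set" where
  "roots d = {\<delta> \<in> Lambda_d d. bil K3_form \<delta> \<delta> = -2}"

lemma period_cone_parts:
  assumes x: "x \<in> period_cone d"
  defines "a \<equiv> (1/2) *s (x + cnj_vec x)" and "c \<equiv> (- \<i>/2) *s (x - cnj_vec x)"
  shows "x = a + \<i> *s c" "a \<in> coords_in \<real>" "c \<in> coords_in \<real>"
    "bil K3_form a (ell d) = 0" "bil K3_form c (ell d) = 0" "bil K3_form a c = 0"
    "bil K3_form a a = bil K3_form x (cnj_vec x) / 2" "bil K3_form c c = bil K3_form x (cnj_vec x) / 2"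
proof -
  have x0: "bil K3_form x x = 0" "bil K3_form x (ell d) = 0" using x by (auto simp: period_cone_def)
  have x1: "bil K3_form (cnj_vec x) (cnj_vec x) = 0" "bil K3_form (cnj_vec x) (ell d) = 0"
    using x0 K3.cnj[of x x] K3.cnj[of x "ell d"] by simp_all
  show "x = a + \<i> *s c" unfolding a_def c_def by (simp add: vec_eq_iff algebra_simps)
  show "a \<in> coords_in \<real>" "c \<in> coords_in \<real>"
    unfolding a_def c_def coords_in_Reals_iff
    by (simp_all add: cnj_vec_simps vec_eq_iff algebra_simps)
  show "bil K3_form a (ell d) = 0" "bil K3_form c (ell d) = 0"
    unfolding a_def c_def by (simp_all add: K3.form_simps x0 x1)
  show "bil K3_form a c = 0"
    "bil K3_form a a = bil K3_form x (cnj_vec x) / 2" "bil K3_form c c = bil K3_form x (cnj_vec x) / 2"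
    unfolding a_def c_def by (simp_all add: K3.form_simps x0 x1 K3.sym[of "cnj_vec x" x] algebra_simps)
qed

lemma real_kernel_4_3:
  fixes h :: "4 \<Rightarrow> 3 \<Rightarrow> real"
  shows "\<exists>c::real^4. c \<noteq> 0 \<and> (\<forall>j. (\<Sum>i\<in>UNIV. c $ i * h i j) = 0)"
proof -
  define \<iota> :: "4 \<Rightarrow> 3" where "\<iota> k = (if k = 1 then 1 else if k = 2 then 2 else 3)" for k
  define A :: "real^4^4" where "A = (\<chi> k i. if k = 4 then 0 else h i (\<iota> k))"
  have "det A = 0" by (rule det_zero_row[of 4]) (simp add: A_def row_def zero_vec_def)
  then obtain c where c: "c \<noteq> 0" "A *v c = 0" using det_0_kernel by blast
  have "(\<Sum>i\<in>UNIV. c $ i * h i (\<iota> k)) = 0" if "k \<noteq> 4" for k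
  proof -
    have "(A *v c) $ k = 0" using c by simp
    then show ?thesis using that by (simp add: matrix_vector_mult_def A_def mult.commute)
  qed
  from this[of 1] this[of 2] this[of 3]
  have "(\<Sum>i\<in>UNIV. c $ i * h i j) = 0" for j
    using exhaust_3[of j] by (auto simp: \<iota>_def)
  then show ?thesis using c by blast
qed

text \<open>The real part \<open>a\<close> and the imaginary part \<open>c\<close> of
  \<open>x\<close>, together with \<open>ell d\<close>, already account for the three positive
  directions. If \<open>u\<close>, orthogonal to them, had nonnegative square, some nontrivial
  combination of the four would satisfy the equations of \<open>K3_negative_definite\<close>. A
  nonzero combination would then have both negative and nonnegative square, and a vanishing one is
  excluded because the first three vectors have positive square and \<open>u\<close> is
  nonzero.\<close>

lemma period_perp_negative:
  assumes d: "d > 0" and x: "x \<in> period_cone d"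
    and u: "u \<in> coords_in \<real>" "u \<noteq> 0" "bil K3_form u (ell d) = 0" "bil K3_form u x = 0"
  shows "Re (bil K3_form u u) < 0"
proof (rule ccontr)
  assume uu: "\<not> ?thesis"
  define a where "a = (1/2) *s (x + cnj_vec x)"
  define c where "c = (- \<i>/2) *s (x - cnj_vec x)"
  define s where "s = Re (bil K3_form x (cnj_vec x)) / 2"
  note ac = period_cone_parts[OF x, folded a_def c_def]
  have s: "s > 0" using x by (simp add: s_def period_cone_def)
  have ss: "Re (bil K3_form a a) = s" "Re (bil K3_form c c) = s" unfolding ac(7,8) s_def by simp_all
  have "bil K3_form u (cnj_vec x) = 0"
    using K3.cnj[of u x] u(1,4) by (simp add: coords_in_Reals_iff)
  then have uac: "bil K3_form u a = 0" "bil K3_form u c = 0"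
    unfolding a_def c_def using u(4) by (simp_all add: K3.form_simps)
  define B :: "4 \<Rightarrow> complex^k3_index" where
    "B i = (if i = 1 then a else if i = 2 then c else if i = 3 then ell d else u)" for i
  define h where "h v j = (if j = (1::3) then Re (v $ i1 + v $ j1) else if j = 2 then Re (v $ i2 + v $ j2)
     else Re (v $ i3 + v $ j3))" for v :: "complex^k3_index" and j
  obtain t where t: "t \<noteq> 0" "\<And>j. (\<Sum>i\<in>UNIV. t $ i * h (B i) j) = 0"
    using real_kernel_4_3[of "\<lambda>i. h (B i)"] by blast
  define y where "y = t $ 1 *\<^sub>R a + t $ 2 *\<^sub>R c + t $ 3 *\<^sub>R ell d + t $ 4 *\<^sub>R u"
  have yr: "y \<in> coords_in \<real>"
    using ac(2,3) u(1) ell_real[of d] unfolding y_def coords_in_def by (auto simp: complex_is_Real_iff)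
  then have im: "Im (y $ k) = 0" for k by (auto simp: coords_in_def complex_is_Real_iff)
  have hy: "h y j = 0" for j
    using t(2)[of j] unfolding sum_4 by (simp add: h_def B_def y_def algebra_simps split: if_splits)
  have "y $ i1 + y $ j1 = 0" "y $ i2 + y $ j2 = 0" "y $ i3 + y $ j3 = 0"
    using hy[of 1] hy[of 2] hy[of 3] by (simp_all add: h_def complex_eq_iff im)
  then have neg: "y \<noteq> 0 \<Longrightarrow> Re (bil K3_form y y) < 0"
    using K3_negative_definite[OF yr] by blast
  have yy: "Re (bil K3_form y y) = (t $ 1)^2 * s + (t $ 2)^2 * s + (t $ 3)^2 * (2 * d) + (t $ 4)^2 * Re (bil K3_form u u)"
    unfolding y_def using ac(4-6) u(3) uac ss bil_ell_ell[of d]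
    by (simp add: K3.form_simps K3.sym[of c a] K3.sym[of "ell d" a] K3.sym[of "ell d" c] K3.sym[of "ell d" u] K3.sym[of a u] K3.sym[of c u] power2_eq_square)
  have nn: "(t $ 1)^2 * s \<ge> 0" "(t $ 2)^2 * s \<ge> 0" "(t $ 3)^2 * (2 * d) \<ge> 0" "(t $ 4)^2 * Re (bil K3_form u u) \<ge> 0"
    using s uu by simp_all
  then have y0: "y = 0" using neg yy by linarith
  then have "Re (bil K3_form y y) = 0" by (simp add: K3.zero_left)
  then have "(t $ 1)^2 * s = 0" "(t $ 2)^2 * s = 0" "(t $ 3)^2 * (2 * d) = 0" using yy nn by linarith+
  then have z: "t $ 1 = 0" "t $ 2 = 0" "t $ 3 = 0" using s d by simp_all
  then have "t $ 4 = 0" using y0 u(2) by (simp add: y_def)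
  then show False using t(1) z by (simp add: vec_eq_iff forall_4)
qed

lemma finite_bounded_lattice_vectors: "finite {v \<in> coords_in \<int> :: (complex^'n) set. norm v \<le> R}"
proof -
  define h :: "('n \<Rightarrow> int) \<Rightarrow> complex^'n" where "h f = (\<chi> i. of_int (f i))" for f
  have "v \<in> h ` (UNIV \<rightarrow>\<^sub>E {- \<lceil>R\<rceil>..\<lceil>R\<rceil>})" if "v \<in> coords_in \<int>" "norm v \<le> R" for v
  proof -
    have "\<forall>i. \<exists>z. v $ i = of_int z" using that by (auto simp: coords_in_def Ints_def)
    then obtain f where f: "v $ i = of_int (f i)" for i by metis
    have "\<bar>f i\<bar> \<le> \<lceil>R\<rceil>" for i
    proof -
      have "norm (v $ i) \<le> R" using that(2) Finite_Cartesian_Product.norm_nth_le[of v i] by linarith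
      then have "real_of_int \<bar>f i\<bar> \<le> R" by (simp add: f)
      then show ?thesis by linarith
    qed
    then have "f \<in> UNIV \<rightarrow>\<^sub>E {- \<lceil>R\<rceil>..\<lceil>R\<rceil>}" by (auto simp: abs_le_iff) (smt (verit) abs_le_iff)+
    moreover have "v = h f" by (simp add: h_def vec_eq_iff f)
    ultimately show ?thesis by blast
  qed
  moreover have "finite (h ` (UNIV \<rightarrow>\<^sub>E {- \<lceil>R\<rceil>..\<lceil>R\<rceil>}))" by (intro finite_imageI finite_PiE) auto
  ultimately show ?thesis by (auto intro: finite_subset)
qed

text \<open>Otherwise there are roots with norm tending to infinity, orthogonal to points tending to
  \<open>x\<close>. Their normalisations accumulate at a real unit vector \<open>u\<close>
  orthogonal to \<open>x\<close> and \<open>ell d\<close>, and (u.u) = 0 as the limit of -2 divided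
  by the squared norms. This contradicts \<open>period_perp_negative\<close>.\<close>

lemma roots_locally_bounded:
  assumes d: "d > 0" and x: "x \<in> period_cone d"
  shows "\<exists>e>0. \<exists>R. \<forall>v\<in>ball x e. \<forall>\<delta>\<in>roots d. bil K3_form \<delta> v = 0 \<longrightarrow> norm \<delta> \<le> R"
proof (rule ccontr)
  assume no: "\<not> ?thesis"
  have "\<exists>v \<delta>. v \<in> ball x (1 / (real n + 1)) \<and> \<delta> \<in> roots d \<and> bil K3_form \<delta> v = 0 \<and> norm \<delta> > real n + 1" for n :: nat
  proof (rule ccontr)
    assume "\<not> ?thesis"
    then have "\<forall>v\<in>ball x (1 / (real n + 1)). \<forall>\<delta>\<in>roots d. bil K3_form \<delta> v = 0 \<longrightarrow> norm \<delta> \<le> real n + 1"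
      by (meson not_le_imp_less)
    moreover have "1 / (real n + 1) > 0" by simp
    ultimately show False using no by blast
  qed
  then obtain v \<delta> where v: "\<And>n. v n \<in> ball x (1 / (real n + 1))" and \<delta>: "\<And>n. \<delta> n \<in> roots d"
    and perp: "\<And>n. bil K3_form (\<delta> n) (v n) = 0" and big: "\<And>n::nat. norm (\<delta> n) > real n + 1"
    by metis
  define w where "w n = (1 / norm (\<delta> n)) *\<^sub>R \<delta> n" for n
  have nz: "norm (\<delta> n) > 0" for n using big[of n] by linarith
  have w1: "w n \<in> sphere 0 1" for n using nz[of n] by (simp add: w_def)
  obtain u r where u: "u \<in> sphere 0 1" "strict_mono r" "(w \<circ> r) \<longlonglongrightarrow> u"
    using compact_sphere[of 0 1] w1 unfolding compact_def by metis
  have vlim: "v \<longlonglongrightarrow> x"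
  proof (rule metric_LIMSEQ_I)
    fix e :: real assume "e > 0"
    then obtain N where N: "1 / (real (Suc N)) < e" using reals_Archimedean by (metis inverse_eq_divide)
    show "\<exists>N. \<forall>n\<ge>N. dist (v n) x < e"
    proof (intro exI allI impI)
      fix n assume "n \<ge> N"
      then have "1 / (real n + 1) \<le> 1 / real (Suc N)" by (intro divide_left_mono) auto
      then show "dist (v n) x < e" using v[of n] N by (simp add: dist_commute)
    qed
  qed
  have vr: "(v \<circ> r) \<longlonglongrightarrow> x" using vlim u(2) by (rule LIMSEQ_subseq_LIMSEQ)
  have dint: "\<delta> n \<in> coords_in \<int>" "bil K3_form (\<delta> n) (ell d) = 0" "bil K3_form (\<delta> n) (\<delta> n) = -2" for n
    using \<delta>[of n] by (auto simp: roots_def Lambda_d_def)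
  have wr: "w n \<in> coords_in \<real>" for n
    using dint(1)[of n] coords_in_Ints_Reals by (force simp: w_def coords_in_def complex_is_Real_iff)
  have closed: "closed (coords_in \<real> :: (complex^k3_index) set)"
  proof -
    have "coords_in \<real> = {v :: complex^k3_index. cnj_vec v = v}" using coords_in_Reals_iff by blast
    moreover have "closed {v :: complex^k3_index. cnj_vec v = v}"
      by (intro closed_Collect_eq continuous_intros)
    ultimately show ?thesis by simp
  qed
  have ur: "u \<in> coords_in \<real>"
    using closed_sequentially[OF closed _ u(3)] wr by simp
  have "((\<lambda>n. bil K3_form ((w \<circ> r) n) (ell d)) \<longlongrightarrow> bil K3_form u (ell d)) sequentially"
    by (intro tendsto_bil u(3) tendsto_const)
  moreover have "bil K3_form ((w \<circ> r) n) (ell d) = 0" for n by (simp add: w_def K3.form_simps dint)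
  ultimately have u_ell: "bil K3_form u (ell d) = 0" by (simp add: LIMSEQ_const_iff)
  have "((\<lambda>n. bil K3_form ((w \<circ> r) n) ((v \<circ> r) n)) \<longlongrightarrow> bil K3_form u x) sequentially"
    by (intro tendsto_bil u(3) vr)
  moreover have "bil K3_form ((w \<circ> r) n) ((v \<circ> r) n) = 0" for n by (simp add: w_def K3.form_simps perp)
  ultimately have u_x: "bil K3_form u x = 0" by (simp add: LIMSEQ_const_iff)
  have "((\<lambda>n. bil K3_form (w n) (w n)) \<longlongrightarrow> 0) sequentially"
  proof (rule Lim_null_comparison)
    show "\<forall>\<^sub>F n in sequentially. norm (bil K3_form (w n) (w n)) \<le> 2 * (1 / (real (Suc n)))"
    proof (intro always_eventually allI)
      fix n
      have "norm (bil K3_form (w n) (w n)) = 2 * ((1 / norm (\<delta> n)) * (1 / norm (\<delta> n)))"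
        by (simp add: w_def K3.form_simps dint norm_mult norm_divide)
      also have "\<dots> \<le> 2 * ((1 / real (Suc n)) * 1)"
      proof (intro mult_left_mono mult_mono)
        show "1 / norm (\<delta> n) \<le> 1 / real (Suc n)" using big[of n] nz[of n] by (intro divide_left_mono mult_pos_pos) simp_all
        have "norm (\<delta> n) \<ge> 1" using big[of n] by linarith
        then show "1 / norm (\<delta> n) \<le> 1" using nz[of n] by (simp only: divide_le_eq_1_pos)
      qed auto
      finally show "norm (bil K3_form (w n) (w n)) \<le> 2 * (1 / (real (Suc n)))" by simp
    qed
    show "(\<lambda>n. 2 * (1 / (real (Suc n)))) \<longlonglongrightarrow> 0"
      using tendsto_mult_right_zero[OF LIMSEQ_inverse_real_of_nat, of 2] by (simp add: inverse_eq_divide)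
  qed
  then have "((\<lambda>n. bil K3_form ((w \<circ> r) n) ((w \<circ> r) n)) \<longlongrightarrow> 0) sequentially"
    using LIMSEQ_subseq_LIMSEQ[OF _ u(2), of "\<lambda>n. bil K3_form (w n) (w n)"] by (simp add: o_def)
  moreover have "((\<lambda>n. bil K3_form ((w \<circ> r) n) ((w \<circ> r) n)) \<longlongrightarrow> bil K3_form u u) sequentially"
    by (intro tendsto_bil u(3))
  ultimately have "bil K3_form u u = 0" using LIMSEQ_unique by blast
  moreover have "u \<noteq> 0" using u(1) by auto
  ultimately show False using period_perp_negative[OF d x ur _ u_ell u_x] by simp
qed

text \<open>The punctured cone over \<open>N_moduli d\<close>, on which submanifolds are
  tested.\<close>

definition moduli_cone :: "nat \<Rightarrow> (complex^k3_index) set" where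
  "moduli_cone d = {v \<in> period_cone d. \<forall>\<delta>\<in>roots d. bil K3_form \<delta> v \<noteq> 0}"

text \<open>Near \<open>x\<close> only roots of bounded norm can vanish, and there are finitely many
  of these. Avoiding them is thus an open condition, like positivity, and locally only the linear
  and the quadratic equation remain.\<close>

lemma moduli_cone_neighbourhood:
  assumes d: "d > 0" and x: "x \<in> moduli_cone d"
  obtains S where "open S" "x \<in> S"
    "\<And>v. v \<in> S \<Longrightarrow> v \<in> moduli_cone d \<longleftrightarrow> bil K3_form v (ell d) = 0 \<and> bil K3_form v v = 0"
proof -
  have xp: "x \<in> period_cone d" using x by (simp add: moduli_cone_def)
  obtain e R where e: "e > 0" and R: "\<And>v \<delta>. v \<in> ball x e \<Longrightarrow> \<delta> \<in> roots d \<Longrightarrow> bil K3_form \<delta> v = 0 \<Longrightarrow> norm \<delta> \<le> R"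
    using roots_locally_bounded[OF d xp] by blast
  define \<Delta> where "\<Delta> = {\<delta> \<in> roots d. norm \<delta> \<le> R}"
  have fin: "finite \<Delta>"
    by (rule finite_subset[OF _ finite_bounded_lattice_vectors[of R]])
      (auto simp: \<Delta>_def roots_def Lambda_d_def)
  define S where "S = ball x e \<inter> {v. Re (bil K3_form v (cnj_vec v)) > 0} \<inter> (\<Inter>\<delta>\<in>\<Delta>. {v. bil K3_form \<delta> v \<noteq> 0})"
  have "open S" unfolding S_def using fin
    by (intro open_Int open_INT ballI open_ball open_Collect_less open_Collect_neq continuous_intros)
  moreover have "x \<in> S" using x e by (auto simp: S_def \<Delta>_def moduli_cone_def period_cone_def)
  moreover have "v \<in> moduli_cone d \<longleftrightarrow> bil K3_form v (ell d) = 0 \<and> bil K3_form v v = 0" if v: "v \<in> S" for v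
  proof -
    have "bil K3_form \<delta> v \<noteq> 0" if "\<delta> \<in> roots d" for \<delta>
      using R[of v \<delta>] v that by (auto simp: S_def \<Delta>_def)
    then show ?thesis using v by (auto simp: moduli_cone_def period_cone_def S_def)
  qed
  ultimately show ?thesis using that by blast
qed

section \<open>Submanifolds of the moduli space\<close>

lemma dim_functional_kernel:
  fixes U :: "(complex^'n) set" and \<phi> :: "complex^'n \<Rightarrow> complex"
  assumes U: "vec.subspace U"
    and \<phi>: "\<And>x y. \<phi> (x + y) = \<phi> x + \<phi> y" "\<And>c x. \<phi> (c *s x) = c * \<phi> x"
    and u: "u \<in> U" "\<phi> u \<noteq> 0"
  shows "vec.dim {v \<in> U. \<phi> v = 0} + 1 = vec.dim U" and "vec.subspace {v \<in> U. \<phi> v = 0}"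
proof -
  let ?K = "{v \<in> U. \<phi> v = 0}"
  have \<phi>0: "\<phi> 0 = 0" using \<phi>(2)[of 0 0] by simp
  show K: "vec.subspace ?K"
    using U by (auto simp: vec.subspace_def \<phi> \<phi>0)
  have diff: "\<phi> (x - y) = \<phi> x - \<phi> y" for x y
    using \<phi>(1)[of "x - y" y] by simp
  have "U \<subseteq> vec.span (insert u ?K)"
  proof
    fix v assume v: "v \<in> U"
    have "v - (\<phi> v / \<phi> u) *s u \<in> ?K"
      using v u U by (auto simp: diff \<phi> intro!: vec.subspace_diff vec.subspace_scale)
    then have "v - (\<phi> v / \<phi> u) *s u \<in> vec.span (insert u ?K)"
      by (intro vec.span_base) blast
    moreover have "(\<phi> v / \<phi> u) *s u \<in> vec.span (insert u ?K)"
      by (intro vec.span_scale vec.span_base) blast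
    ultimately show "v \<in> vec.span (insert u ?K)"
      by (metis (no_types) diff_add_cancel vec.span_add)
  qed
  moreover have "vec.span (insert u ?K) \<subseteq> U" using u U by (intro vec.span_minimal) auto
  ultimately have "vec.span (insert u ?K) = U" by blast
  then have "vec.dim (insert u ?K) = vec.dim U" by (metis vec.dim_span)
  moreover have "u \<notin> vec.span ?K" using u K by (simp add: vec.span_eq_iff[THEN iffD2])
  ultimately show "vec.dim ?K + 1 = vec.dim U" by (simp add: vec.dim_insert)
qed

lemma proj_point_eq:
  assumes "p \<in> proj_points" "v \<in> p" "v \<noteq> 0"
  shows "p = range (\<lambda>c. c *s v)"
proof -
  have p: "vec.subspace p" "vec.dim p = 1" using assms by (auto simp: proj_points_def)
  have "vec.independent {v}" using assms(3) by simp
  moreover have "card {v} = vec.dim p" using p by simp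
  ultimately have "p \<subseteq> vec.span {v}" using assms(2) vec.card_eq_dim[of "{v}" p] by auto
  then show ?thesis using assms(2) p(1) by (auto simp: vec.span_singleton vec.subspace_scale)
qed

lemma range_scale_proj_point:
  fixes v :: "complex^'n" assumes "v \<noteq> 0" shows "range (\<lambda>c. c *s v) \<in> proj_points"
proof -
  have "vec.independent {v}" using assms by simp
  then have "vec.dim (vec.span {v}) = 1" using vec.dim_eq_card_independent[of "{v}"] by simp
  then show ?thesis unfolding proj_points_def vec.span_singleton[symmetric] by simp
qed

lemma scale_in_period_cone:
  assumes "v \<in> period_cone d" "c \<noteq> 0" shows "c *s v \<in> period_cone d"
proof -
  have "Re (c * cnj c * bil K3_form v (cnj_vec v)) > 0"
    unfolding complex_norm_square[symmetric] using assms
    by (simp add: period_cone_def)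
  moreover have "bil K3_form (c *s v) (cnj_vec (c *s v)) = c * cnj c * bil K3_form v (cnj_vec v)"
    by (simp add: K3.form_simps cnj_vec_simps)
  ultimately have "Re (bil K3_form (c *s v) (cnj_vec (c *s v))) > 0" by (simp only:)
  moreover have "bil K3_form (c *s v) (ell d) = 0" "bil K3_form (c *s v) (c *s v) = 0"
    using assms(1) by (simp_all add: period_cone_def K3.form_simps)
  ultimately show ?thesis unfolding period_cone_def by blast
qed

text \<open>All conditions are homogeneous, the hermitian one up to the positive factor of the
  squared absolute value, so one nonzero vector tests its whole line.\<close>

lemma mem_N_moduli:
  assumes p: "p \<in> proj_points" and v: "v \<in> p" "v \<noteq> 0"
  shows "p \<in> N_moduli d \<longleftrightarrow> v \<in> moduli_cone d"
proof
  have eq: "p = range (\<lambda>c. c *s v)" by (rule proj_point_eq[OF assms])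
  {
    assume N: "p \<in> N_moduli d"
    then have "p \<in> period_domain d" by (simp add: N_moduli_def)
    then have "v \<in> period_cone d" using v by (auto simp: period_domain_def period_cone_def)
    moreover have "bil K3_form \<delta> v \<noteq> 0" if "\<delta> \<in> roots d" for \<delta>
    proof
      assume "bil K3_form \<delta> v = 0"
      then have "\<forall>w\<in>p. bil K3_form \<delta> w = 0" unfolding eq by (auto simp: K3.scale_right)
      then show False using N that by (auto simp: N_moduli_def roots_def)
    qed
    ultimately show "v \<in> moduli_cone d" by (simp add: moduli_cone_def)
  }
  assume m: "v \<in> moduli_cone d"
  then have c: "v \<in> period_cone d" by (simp add: moduli_cone_def)
  have "w \<noteq> 0 \<longrightarrow> w \<in> period_cone d" if "w \<in> p" for w
    using that scale_in_period_cone[OF c] unfolding eq by auto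
  then have "p \<in> period_domain d"
    using p unfolding period_domain_def period_cone_def
    by (auto simp: K3.zero_left) (metis K3.zero_left)+
  then show "p \<in> N_moduli d"
    using m v by (auto simp: N_moduli_def moduli_cone_def roots_def)
qed

lemma moduli_cone_nonzero: "v \<in> moduli_cone d \<Longrightarrow> v \<noteq> 0"
  by (auto simp: moduli_cone_def period_cone_def K3.zero_left)

lemma punctured_cone_section:
  assumes W: "vec.subspace W"
  shows "punctured_cone {p \<in> N_moduli d. p \<subseteq> W} = moduli_cone d \<inter> W"
proof (intro equalityI subsetI)
  fix v assume "v \<in> punctured_cone {p \<in> N_moduli d. p \<subseteq> W}"
  then obtain p where p: "p \<in> N_moduli d" "p \<subseteq> W" "v \<in> p" "v \<noteq> 0" by (auto simp: punctured_cone_def)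
  moreover have "p \<in> proj_points" using p(1) by (simp add: N_moduli_def period_domain_def)
  ultimately show "v \<in> moduli_cone d \<inter> W" using mem_N_moduli by blast
next
  fix v assume v: "v \<in> moduli_cone d \<inter> W"
  then have nz: "v \<noteq> 0" using moduli_cone_nonzero by blast
  let ?p = "range (\<lambda>c. c *s v)"
  have p: "?p \<in> proj_points" "v \<in> ?p" by (rule range_scale_proj_point[OF nz]) (auto intro: range_eqI[of _ _ 1])
  have "?p \<in> N_moduli d" using mem_N_moduli[OF p nz] v by blast
  moreover have "?p \<subseteq> W" using v W by (auto intro: vec.subspace_scale)
  ultimately show "v \<in> punctured_cone {p \<in> N_moduli d. p \<subseteq> W}" using p(2) nz unfolding punctured_cone_def by blast
qed

lemma closed_vec_subspace:
  fixes W :: "(complex^'n) set" assumes "vec.subspace W" shows "closed W"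
proof (rule closed_subspace)
  show "subspace W" using assms unfolding subspace_def vec.subspace_def scaleR_eq_vector_scalar_mult by blast
qed

lemma closed_proj_submanifold_section:
  assumes W: "vec.subspace W" and "complex_submanifold (k + 1) (moduli_cone d \<inter> W)"
  shows "closed_proj_submanifold (N_moduli d) k {p \<in> N_moduli d. p \<subseteq> W}"
proof -
  have "punctured_cone (N_moduli d) = moduli_cone d"
    using punctured_cone_section[of UNIV d] by simp
  moreover have "closedin (top_of_set (moduli_cone d)) (moduli_cone d \<inter> W)"
    using closed_vec_subspace[OF W] by (rule closedin_closed_Int)
  ultimately show ?thesis
    using assms(2) unfolding closed_proj_submanifold_def punctured_cone_section[OF W] by auto
qed

section \<open>Holomorphic charts on linear sections of the moduli cone\<close>

definition holomorphic_function_at :: "(complex^'n \<Rightarrow> complex) \<Rightarrow> complex^'n \<Rightarrow> bool" where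
  "holomorphic_function_at g x \<longleftrightarrow> (\<exists>g'. (\<forall>u v. g' (u + v) = g' u + g' v) \<and> (\<forall>c v. g' (c *s v) = c * g' v) \<and>
     (g has_derivative g') (at x))"

lemma holomorphic_function_at_bil:
  assumes Q: "real_form (bil Q)"
  shows "holomorphic_function_at (\<lambda>v. bil Q v v) x" "holomorphic_function_at (\<lambda>v. bil Q v a) x"
proof -
  interpret real_form "bil Q" by fact
  have "((\<lambda>v. bil Q v v) has_derivative (\<lambda>u. bil Q x u + bil Q u x)) (at x)"
    using bounded_bilinear.FDERIV[OF bounded_bilinear_bil, of "\<lambda>v. v" "\<lambda>v. v" x UNIV "\<lambda>v. v" "\<lambda>v. v"] by simp
  then show "holomorphic_function_at (\<lambda>v. bil Q v v) x"
    unfolding holomorphic_function_at_def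
    by (intro exI[of _ "\<lambda>u. bil Q x u + bil Q u x"]) (simp add: form_simps distrib_left)
  have "((\<lambda>v. bil Q v a) has_derivative (\<lambda>u. bil Q u a)) (at x)"
    by (rule bounded_linear_imp_has_derivative[OF bounded_bilinear.bounded_linear_left[OF bounded_bilinear_bil]])
  then show "holomorphic_function_at (\<lambda>v. bil Q v a) x"
    unfolding holomorphic_function_at_def
    by (intro exI[of _ "\<lambda>u. bil Q u a"]) (simp add: form_simps)
qed

lemma holomorphic_function_at_diff_divide:
  assumes "holomorphic_function_at f x" "holomorphic_function_at g x"
  shows "holomorphic_function_at (\<lambda>v. f v - g v) x"
    and "g x \<noteq> 0 \<Longrightarrow> holomorphic_function_at (\<lambda>v. f v / g v) x"
proof -
  obtain f' where f: "\<And>u v. f' (u + v) = f' u + f' v" "\<And>c v. f' (c *s v) = c * f' v" "(f has_derivative f') (at x)"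
    using assms(1) by (auto simp: holomorphic_function_at_def)
  obtain g' where g: "\<And>u v. g' (u + v) = g' u + g' v" "\<And>c v. g' (c *s v) = c * g' v" "(g has_derivative g') (at x)"
    using assms(2) by (auto simp: holomorphic_function_at_def)
  show "holomorphic_function_at (\<lambda>v. f v - g v) x"
    unfolding holomorphic_function_at_def using has_derivative_diff[OF f(3) g(3)]
    by (intro exI[of _ "\<lambda>v. f' v - g' v"]) (simp add: f g algebra_simps)
  show "g x \<noteq> 0 \<Longrightarrow> holomorphic_function_at (\<lambda>v. f v / g v) x"
    unfolding holomorphic_function_at_def using has_derivative_divide'[OF f(3) g(3)]
    by (intro exI[of _ "\<lambda>h. (f' h * g x - f x * g' h) / (g x * g x)"])
      (simp add: f(1,2) g(1,2) add_divide_distrib[symmetric] algebra_simps)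
qed

lemma holomorphic_function_at_const: "holomorphic_function_at (\<lambda>v. c) x"
  unfolding holomorphic_function_at_def by (intro exI[of _ "\<lambda>v. 0"]) simp

lemma holomorphic_map_shear:
  fixes S :: "(complex^'n) set"
  assumes "\<And>x. x \<in> S \<Longrightarrow> holomorphic_function_at g x"
  shows "holomorphic_map_on (\<lambda>v. v + g v *s y) S"
  unfolding holomorphic_map_on_def
proof
  fix x assume "x \<in> S"
  then obtain g' where g: "\<And>u v. g' (u + v) = g' u + g' v" "\<And>c v. g' (c *s v) = c * g' v" "(g has_derivative g') (at x)"
    using assms[of x] unfolding holomorphic_function_at_def by blast
  have bl: "bounded_linear (\<lambda>z :: complex. z *s y)"
    by (intro linear_conv_bounded_linear[THEN iffD1] linearI)
      (simp_all add: vec_eq_iff distrib_right)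
  have "((\<lambda>v. g v *s y) has_derivative (\<lambda>u. g' u *s y)) (at x)"
    using bounded_linear.has_derivative[OF bl g(3)] .
  then have "((\<lambda>v. v + g v *s y) has_derivative (\<lambda>u. u + g' u *s y)) (at x)"
    by (intro has_derivative_add has_derivative_ident)
  moreover have "complex_linear (\<lambda>u. u + g' u *s y)"
    by (rule complex_linearI) (simp_all add: g(1,2) vec_eq_iff algebra_simps)
  ultimately show "\<exists>f'. complex_linear f' \<and> ((\<lambda>v. v + g v *s y) has_derivative f') (at x)" by blast
qed

lemma holomorphic_map_on_continuous:
  assumes "holomorphic_map_on f S" shows "continuous_on S f"
  using assms unfolding holomorphic_map_on_def
  by (meson continuous_at_imp_continuous_on has_derivative_continuous)

lemma biholomorphicI:
  assumes S: "open S" and T: "open T" and ST: "\<And>x. x \<in> S \<Longrightarrow> h x \<in> T \<and> k (h x) = x"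
    and TS: "\<And>y. y \<in> T \<Longrightarrow> k y \<in> S \<and> h (k y) = y"
    and h: "holomorphic_map_on h S" and k: "holomorphic_map_on k T"
  shows "biholomorphic h S T"
proof -
  have bij: "bij_betw h S T" using ST TS by (intro bij_betw_byWitness[where f' = k]) auto
  have eq: "k y = inv_into S h y" if "y \<in> T" for y
    using that TS[OF that] bij by (metis bij_betw_def inv_into_f_eq)
  have "holomorphic_map_on (inv_into S h) T"
    unfolding holomorphic_map_on_def
  proof
    fix y assume y: "y \<in> T"
    then obtain f' where f': "complex_linear f'" "(k has_derivative f') (at y)"
      using k by (auto simp: holomorphic_map_on_def)
    have "(inv_into S h has_derivative f') (at y)"
      by (rule has_derivative_transform_within_open[OF f'(2) T y]) (rule eq)
    then show "\<exists>f'. complex_linear f' \<and> (inv_into S h has_derivative f') (at y)" using f'(1) by blast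
  qed
  then show ?thesis using S T bij h by (simp add: biholomorphic_def)
qed

text \<open>
  The chart shears along \<open>\<bar>x\<close>.  Since \<open>(\<bar>x.\<bar>x) = 0\<close>, the equation for the inverse is linear in the
  shear parameter, and the chart carries the quadric to the hyperplane \<open>(w.x) = 0\<close>.
\<close>

lemma moduli_section_submanifold:
  assumes d: "d > 0" and W: "vec.subspace W" and ell: "\<And>v. v \<in> W \<Longrightarrow> bil K3_form v (ell d) = 0"
    and cnj: "\<And>v. v \<in> W \<Longrightarrow> cnj_vec v \<in> W" and dim: "vec.dim W = k + 1"
  shows "complex_submanifold k (moduli_cone d \<inter> W)"
  unfolding complex_submanifold_def
proof
  let ?q = "bil K3_form"
  fix x assume x: "x \<in> moduli_cone d \<inter> W"
  define y where "y = cnj_vec x"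
  define c where "c = ?q x y"
  have yW: "y \<in> W" using cnj x by (simp add: y_def)
  have xx: "?q x x = 0" and c0: "c \<noteq> 0"
    using x by (auto simp: moduli_cone_def period_cone_def c_def y_def)
  have yy: "?q y y = 0" using K3.cnj[of x x] xx by (simp add: y_def)
  have yx: "?q y x = c" by (simp add: c_def K3.sym)
  obtain S1 where S1: "open S1" "x \<in> S1"
    "\<And>v. v \<in> S1 \<Longrightarrow> v \<in> moduli_cone d \<longleftrightarrow> ?q v (ell d) = 0 \<and> ?q v v = 0"
    using moduli_cone_neighbourhood[OF d, of x] x by blast
  \<comment> \<open>The parameter \<open>g v\<close> is determined by demanding that
    \<open>h v\<close> pair with \<open>x\<close> to \<open>?q v v\<close>. Conversely
    \<open>g' w\<close> solves \<open>?q w w + 2 g' ?q w y = ?q w x\<close>. Both shears leave the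
    pairing with \<open>y\<close> unchanged, so the denominator stays nonzero on
    \<open>S0\<close>.\<close>
  define g where "g v = (?q v v - ?q v x) / c" for v
  define h where "h v = v + g v *s y" for v
  define g' where "g' w = ((?q w x - ?q w w) / ?q w y) / 2" for w
  define k' where "k' w = w + g' w *s y" for w
  define S0 where "S0 = {v. ?q v y \<noteq> 0}"
  have S0: "open S0" unfolding S0_def by (intro open_Collect_neq continuous_intros)
  have hy: "?q (h v) y = ?q v y" for v by (simp add: h_def K3.form_simps yy)
  have ky: "?q (k' v) y = ?q v y" for v by (simp add: k'_def K3.form_simps yy)
  have hx: "?q (h v) x = ?q v v" for v using c0 by (simp add: h_def K3.form_simps yx g_def)
  have hh: "?q (h v) (h v) = ?q v v + 2 * g v * ?q v y" for v
    by (simp add: h_def K3.form_simps yy K3.sym[of y v] algebra_simps)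
  have kk: "?q (k' v) (k' v) = ?q v v + 2 * g' v * ?q v y" for v
    by (simp add: k'_def K3.form_simps yy K3.sym[of y v] algebra_simps)
  have kh: "k' (h v) = v" if "v \<in> S0" for v
  proof -
    have "g' (h v) = - g v" using that unfolding g'_def hh hx hy S0_def by (simp add: field_simps)
    then show ?thesis by (simp add: k'_def) (simp add: h_def)
  qed
  have hk: "h (k' w) = w" if "w \<in> S0" for w
  proof -
    have "?q (k' w) (k' w) = ?q w x" using that unfolding kk g'_def S0_def by (simp add: field_simps)
    moreover have "?q (k' w) x = ?q w x + g' w * c" by (simp add: k'_def K3.form_simps yx)
    ultimately have "g (k' w) = - g' w" using c0 by (simp add: g_def)
    then show ?thesis by (simp add: h_def) (simp add: k'_def)
  qed
  have hhol: "holomorphic_map_on h A" for A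
    unfolding h_def g_def
    by (intro holomorphic_map_shear holomorphic_function_at_diff_divide holomorphic_function_at_bil
        holomorphic_function_at_const K3.real_form_axioms c0)
  have khol: "holomorphic_map_on k' S0"
    unfolding k'_def g'_def S0_def
    by (intro holomorphic_map_shear holomorphic_function_at_diff_divide holomorphic_function_at_bil
        holomorphic_function_at_const K3.real_form_axioms) simp_all
  define S where "S = S0 \<inter> S1"
  define T where "T = S0 \<inter> k' -` S1"
  have "open T" unfolding T_def
    using continuous_open_preimage[OF holomorphic_map_on_continuous[OF khol] S0 S1(1)] .
  have bih: "biholomorphic h S T"
  proof (rule biholomorphicI[where k = k'])
    show "open S" using S0 S1 by (auto simp: S_def)
    show "open T" by fact
    show "h v \<in> T \<and> k' (h v) = v" if "v \<in> S" for v
      using that kh[of v] by (auto simp: S_def T_def) (auto simp: S0_def hy)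
    show "k' w \<in> S \<and> h (k' w) = w" if "w \<in> T" for w
      using that hk[of w] by (auto simp: S_def T_def) (auto simp: S0_def ky)
    show "holomorphic_map_on k' T" using khol by (auto simp: holomorphic_map_on_def T_def)
  qed (rule hhol)
  define V where "V = {v \<in> W. ?q v x = 0}"
  have V: "vec.dim V + 1 = vec.dim W" "vec.subspace V"
    unfolding V_def using dim_functional_kernel[OF W, of "\<lambda>v. ?q v x" y] yW yx c0
    by (auto simp: K3.form_simps)
  have hW: "h v \<in> W \<longleftrightarrow> v \<in> W" for v
  proof -
    have "g v *s y \<in> W" using yW W by (intro vec.subspace_scale)
    then show ?thesis
      unfolding h_def using W by (metis add_diff_cancel_right' vec.subspace_add vec.subspace_diff)
  qed
  have "h v \<in> V \<longleftrightarrow> v \<in> moduli_cone d \<inter> W" if "v \<in> S" for v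
    using that S1(3)[of v] ell[of v] by (auto simp: V_def hW hx S_def)
  moreover have "bij_betw h S T" using bih by (simp add: biholomorphic_def)
  ultimately have "h ` (S \<inter> (moduli_cone d \<inter> W)) = T \<inter> V"
    by (auto simp: bij_betw_def)
  moreover have "x \<in> S" using S1(2) c0 by (simp add: S_def S0_def c_def)
  ultimately show "\<exists>S T h V. x \<in> S \<and> biholomorphic h S T \<and> vec.subspace V \<and> vec.dim V = k \<and>
      h ` (S \<inter> (moduli_cone d \<inter> W)) = T \<inter> V"
    using bih V dim by (intro exI[of _ S] exI[of _ T] exI[of _ h] exI[of _ V]) simp
qed

text \<open>On an isotropic \<open>W\<close> the quadratic equation holds automatically, so the
  moduli cone is open in \<open>W\<close> and the identity is a chart. This covers eigenspaces,
  which need not be stable under the conjugation that the sheared chart relies on.\<close>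

lemma isotropic_section_submanifold:
  assumes d: "d > 0" and W: "vec.subspace W" and ell: "\<And>v. v \<in> W \<Longrightarrow> bil K3_form v (ell d) = 0"
    and iso: "\<And>v. v \<in> W \<Longrightarrow> bil K3_form v v = 0"
  shows "complex_submanifold (vec.dim W) (moduli_cone d \<inter> W)"
  unfolding complex_submanifold_def
proof
  fix x assume x: "x \<in> moduli_cone d \<inter> W"
  obtain S where S: "open S" "x \<in> S"
    "\<And>v. v \<in> S \<Longrightarrow> v \<in> moduli_cone d \<longleftrightarrow> bil K3_form v (ell d) = 0 \<and> bil K3_form v v = 0"
    using moduli_cone_neighbourhood[OF d, of x] x by blast
  have "holomorphic_map_on (\<lambda>v. v) S"
    unfolding holomorphic_map_on_def using complex_linearI[of "\<lambda>v. v"] has_derivative_ident by blast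
  then have "biholomorphic (\<lambda>v. v) S S" using S(1) by (intro biholomorphicI[where k = "\<lambda>v. v"]) auto
  moreover have "(\<lambda>v. v) ` (S \<inter> (moduli_cone d \<inter> W)) = S \<inter> W"
    using S(3) ell iso by auto
  ultimately show "\<exists>S T h V. x \<in> S \<and> biholomorphic h S T \<and> vec.subspace V \<and> vec.dim V = vec.dim W \<and>
      h ` (S \<inter> (moduli_cone d \<inter> W)) = T \<inter> V"
    using S(2) W by (intro exI[of _ S] exI[of _ S] exI[of _ "\<lambda>v. v"] exI[of _ W]) simp
qed

lemma dim_ell_perp: "vec.dim {v. bil K3_form v (ell d) = 0} = 21" and subspace_ell_perp: "vec.subspace {v. bil K3_form v (ell d) = 0}"
proof -
  have "bil K3_form (axis j1 1) (ell d) \<noteq> 0" unfolding bil_ell by (simp add: axis_def)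
  from dim_functional_kernel[of UNIV "\<lambda>v. bil K3_form v (ell d)", OF _ _ _ _ this]
  have "vec.dim {v. bil K3_form v (ell d) = 0} + 1 = vec.dim (UNIV :: (complex^k3_index) set)"
    "vec.subspace {v. bil K3_form v (ell d) = 0}"
    by (simp_all add: K3.form_simps)
  then show "vec.dim {v. bil K3_form v (ell d) = 0} = 21" "vec.subspace {v. bil K3_form v (ell d) = 0}"
    by (simp_all add: vec.dim_UNIV card_cart_basis)
qed

text \<open>If \<open>W\<close> is more than the line of \<open>x\<close>, it lies in the common
  orthogonal complement of \<open>ell d\<close>, \<open>x\<close> and a further vector
  \<open>z\<close> of \<open>W\<close>, which has dimension 22 - 3. This is far from sharp, but
  makes the projective dimension less than 19.\<close>

lemma dim_isotropic:
  assumes d: "d > 0" and W: "vec.subspace W" and ell: "\<And>v. v \<in> W \<Longrightarrow> bil K3_form v (ell d) = 0"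
    and iso: "\<And>v w. v \<in> W \<Longrightarrow> w \<in> W \<Longrightarrow> bil K3_form v w = 0"
    and x: "x \<in> moduli_cone d \<inter> W"
  shows "vec.dim W \<le> 19"
proof (cases "W \<subseteq> range (\<lambda>c. c *s x)")
  case True
  then have "vec.dim W \<le> vec.dim (vec.span {x})" by (intro vec.dim_subset) (simp add: vec.span_singleton)
  also have "\<dots> \<le> card {x}" using vec.dim_le_card'[of "{x}"] by simp
  finally show ?thesis by simp
next
  case False
  let ?q = "bil K3_form"
  obtain w where w: "w \<in> W" "w \<notin> range (\<lambda>c. c *s x)" using False by blast
  define y where "y = cnj_vec x"
  have x0: "?q x (ell d) = 0" and xy: "?q x y \<noteq> 0"
    using x by (auto simp: moduli_cone_def period_cone_def y_def)
  have ye: "?q y (ell d) = 0" using K3.cnj[of x "ell d"] x0 by (simp add: y_def)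
  \<comment> \<open>\<open>z\<close> is made orthogonal to the conjugate \<open>y\<close> of
    \<open>x\<close>, so that multiples of \<open>y\<close> can move a vector into the complement of
    \<open>x\<close> without changing its pairing with \<open>z\<close>.\<close>
  define z where "z = w - (?q w y / ?q x y) *s x"
  have zW: "z \<in> W" unfolding z_def using w(1) x W by (intro vec.subspace_diff vec.subspace_scale) auto
  have z0: "z \<noteq> 0" using w(2) by (auto simp: z_def)
  have zy: "?q z y = 0" using xy by (simp add: z_def K3.form_simps)
  define U where "U = {v \<in> {v. ?q v (ell d) = 0}. ?q v x = 0}"
  have U: "vec.dim U + 1 = 21" "vec.subspace U"
    unfolding U_def dim_ell_perp[of d, symmetric]
    using dim_functional_kernel[OF subspace_ell_perp, of "\<lambda>v. ?q v x" y d] ye xy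
    by (simp_all add: K3.form_simps K3.sym[of y x])
  have "\<exists>u\<in>U. ?q u z \<noteq> 0"
  proof (rule ccontr)
    assume no: "\<not> ?thesis"
    have "?q z v = 0" for v
    proof -
      define v' where "v' = v - (?q v (ell d) / ?q (ell d) (ell d)) *s ell d"
      define u where "u = v' - (?q v' x / ?q y x) *s y"
      have v': "?q v' (ell d) = 0" using d by (simp add: v'_def K3.form_simps bil_ell_ell)
      have "u \<in> U" unfolding U_def u_def using xy by (simp add: K3.form_simps v' ye K3.sym[of y x])
      then have "?q u z = 0" using no by blast
      then have "?q v' z = 0" using zy by (simp add: u_def K3.form_simps K3.sym[of y z])
      then show ?thesis
        using ell[OF zW] by (simp add: v'_def K3.form_simps K3.sym[of "ell d" z] K3.sym[of v z])
    qed
    then show False using K3_nondegenerate z0 by blast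
  qed
  then obtain u where u: "u \<in> U" "?q u z \<noteq> 0" by blast
  have "vec.dim {v \<in> U. ?q v z = 0} + 1 = vec.dim U"
    by (rule dim_functional_kernel(1)[where \<phi> = "\<lambda>v. ?q v z", OF U(2) _ _ u]) (simp_all add: K3.form_simps)
  moreover have "W \<subseteq> {v \<in> U. ?q v z = 0}"
    using ell iso x zW by (auto simp: U_def)
  then have "vec.dim W \<le> vec.dim {v \<in> U. ?q v z = 0}" by (rule vec.dim_subset)
  ultimately show ?thesis using U by linarith
qed

lemma isotropic_section_closed_submanifold:
  assumes d: "d > 0" and W: "vec.subspace W" and ell: "\<And>v. v \<in> W \<Longrightarrow> bil K3_form v (ell d) = 0"
    and iso: "\<And>v w. v \<in> W \<Longrightarrow> w \<in> W \<Longrightarrow> bil K3_form v w = 0"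
  shows "\<exists>k<19. closed_proj_submanifold (N_moduli d) k {p \<in> N_moduli d. p \<subseteq> W}"
proof (cases "moduli_cone d \<inter> W = {}")
  case True
  \<comment> \<open>The empty set is a submanifold of any dimension; 0 is picked.\<close>
  have "complex_submanifold (0 + 1) (moduli_cone d \<inter> W)" unfolding True complex_submanifold_def by blast
  from closed_proj_submanifold_section[OF W this] show ?thesis by (intro exI[of _ 0]) simp
next
  case False
  then obtain x where x: "x \<in> moduli_cone d \<inter> W" by blast
  have "vec.dim W \<le> 19" by (rule dim_isotropic[OF d W ell iso x])
  moreover have "vec.dim W \<noteq> 0"
    using x moduli_cone_nonzero[of x d] vec.dim_eq_0[of W] by blast
  ultimately obtain k where k: "k < 19" "vec.dim W = k + 1" by (cases "vec.dim W") auto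
  have "complex_submanifold (k + 1) (moduli_cone d \<inter> W)"
    using isotropic_section_submanifold[OF d W ell iso] k by simp
  from closed_proj_submanifold_section[OF W this] show ?thesis using k by blast
qed

lemma hyperplane_section_closed_submanifold:
  fixes \<phi> :: "complex^k3_index \<Rightarrow> complex"
  assumes d: "d > 0"
    and \<phi>: "\<And>x y. \<phi> (x + y) = \<phi> x + \<phi> y" "\<And>c x. \<phi> (c *s x) = c * \<phi> x" "\<And>x. \<phi> (cnj_vec x) = cnj (\<phi> x)"
    and u: "bil K3_form u (ell d) = 0" "\<phi> u \<noteq> 0"
  shows "\<exists>k<19. closed_proj_submanifold (N_moduli d) k
    {p \<in> N_moduli d. p \<subseteq> {v. bil K3_form v (ell d) = 0 \<and> \<phi> v = 0}}"
proof -
  let ?W = "{v. bil K3_form v (ell d) = 0 \<and> \<phi> v = 0}"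
  have W: "vec.subspace ?W" "vec.dim ?W + 1 = 21"
    using dim_functional_kernel[OF subspace_ell_perp, of \<phi> u d] \<phi> u unfolding dim_ell_perp by auto
  \<comment> \<open>\<open>?W\<close> has dimension 20 and the quadric takes away one; the cone over
    a projective submanifold of dimension 18 has dimension 19.\<close>
  have "complex_submanifold (18 + 1) (moduli_cone d \<inter> ?W)"
  proof (rule moduli_section_submanifold[OF d W(1)])
    show "cnj_vec v \<in> ?W" if "v \<in> ?W" for v
      using that \<phi>(3)[of v] K3.cnj[of v "ell d"] by simp
  qed (use W in auto)
  from closed_proj_submanifold_section[OF W(1) this] show ?thesis by (intro exI[of _ 18]) simp
qed

section \<open>Transport along isometries, countability of isometries and of their
  eigenvalues\<close>

lemma lattice_isometry_compose:
  assumes f: "lattice_isometry b b' f" and g: "lattice_isometry b' b'' g"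
  shows "lattice_isometry b b'' (\<lambda>x. g (f x))"
proof -
  have "bij_betw (g \<circ> f) (coords_in \<int>) (coords_in \<int>)"
    using f g bij_betw_trans unfolding lattice_isometry_def by blast
  moreover have "f v \<in> coords_in \<int>" if "v \<in> coords_in \<int>" for v
    using f that by (auto simp: lattice_isometry_def bij_betw_def)
  ultimately show ?thesis
    using f g complex_linear_compose[of g f] by (auto simp: lattice_isometry_def o_def)
qed

lemma four_positive_form_pullback:
  assumes b': "four_positive_form b' \<pi>" and b: "real_form b" and f: "lattice_isometry b b' f"
  shows "four_positive_form b (\<lambda>x. \<pi> (f x))"
proof -
  interpret b': four_positive_form b' \<pi> by fact
  interpret b: real_form b by fact
  have lin: "complex_linear f" using f by (simp add: lattice_isometry_def)
  show ?thesis
  proof (intro four_positive_form.intro four_positive_form_axioms.intro b.real_form_axioms)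
    show "linear (\<lambda>x. \<pi> (f x))"
      by (rule linearI) (simp_all add: complex_linear_add[OF lin] complex_linear_scaleR[OF lin]
          linear_add[OF b'.linear_pi] linear_scale[OF b'.linear_pi])
    show "Re (b v v) \<le> 0" if "v \<in> coords_in \<real>" "\<pi> (f v) = 0" for v
      using b'.nonpos_ker[OF lattice_isometry_real[OF f that(1)] that(2)]
        lattice_isometry_form[OF f b b'.real_form_axioms] by simp
  qed
qed

lemma countable_lattice_isometries:
  fixes b :: "complex^'m \<Rightarrow> complex^'m \<Rightarrow> complex" and b' :: "complex^'n \<Rightarrow> complex^'n \<Rightarrow> complex"
  shows "countable {f. lattice_isometry b b' f}"
proof (rule countableI')
  define m where "m f = (\<lambda>i j. \<lfloor>Re (f (axis i 1) $ j)\<rfloor>)" for f :: "complex^'m \<Rightarrow> complex^'n"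
  show "inj_on (\<lambda>f. to_nat (m f)) {f. lattice_isometry b b' f}"
  proof (rule inj_onI)
    fix f g assume f: "f \<in> {f. lattice_isometry b b' f}" and g: "g \<in> {f. lattice_isometry b b' f}"
      and "to_nat (m f) = to_nat (m g)"
    then have eq: "m f i j = m g i j" for i j by simp
    have int: "h (axis i 1) $ j = of_int (m h i j)" if "lattice_isometry b b' h" for h i j
      using lattice_isometry_axis[OF that, of i] unfolding coords_in_def m_def
      by (auto elim!: Ints_cases dest!: spec[of _ j])
    have axis: "f (axis i 1) = g (axis i 1)" for i
      unfolding vec_eq_iff using int[of f] int[of g] eq f g by simp
    have lin: "complex_linear f" "complex_linear g" using f g by (simp_all add: lattice_isometry_def)
    show "f = g"
    proof
      fix v show "f v = g v"
        unfolding complex_linear_expand[OF lin(1), of v] complex_linear_expand[OF lin(2), of v] axis ..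
    qed
  qed
qed

text \<open>This keeps the family of eigenspaces of all lattice isometries countable. In the
  induction, applying \<open>f\<close> minus \<open>\<mu>\<close> removes the term of
  \<open>\<mu>\<close> and multiplies each other coefficient by the nonzero number
  \<open>\<kappa> - \<mu>\<close>.\<close>

lemma finite_eigenvalues:
  fixes f :: "complex^'n \<Rightarrow> complex^'n"
  assumes f: "complex_linear f"
  shows "finite {\<kappa>. \<exists>v. v \<noteq> 0 \<and> f v = \<kappa> *s v}" (is "finite ?E")
proof (rule ccontr)
  assume "infinite ?E"
  then obtain T where T: "T \<subseteq> ?E" "finite T" "card T = CARD('n) + 1"
    using infinite_arbitrarily_large by blast
  from T(1) have "\<forall>\<kappa>\<in>T. \<exists>v. v \<noteq> 0 \<and> f v = \<kappa> *s v" by blast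
  then obtain v where v: "\<And>\<kappa>. \<kappa> \<in> T \<Longrightarrow> v \<kappa> \<noteq> 0 \<and> f (v \<kappa>) = \<kappa> *s v \<kappa>" by metis
  have indep: "\<forall>\<kappa>\<in>S. c \<kappa> = 0" if "S \<subseteq> T" "(\<Sum>\<kappa>\<in>S. c \<kappa> *s v \<kappa>) = 0" for S c
  proof -
    have "finite S" using that(1) T(2) finite_subset by blast
    then show ?thesis using that
    proof (induction S arbitrary: c rule: finite_induct)
      case (insert \<mu> S)
      have sum0: "c \<mu> *s v \<mu> + (\<Sum>\<kappa>\<in>S. c \<kappa> *s v \<kappa>) = 0" using insert by simp
      have "(\<Sum>\<kappa>\<in>S. (c \<kappa> * (\<kappa> - \<mu>)) *s v \<kappa>) = f (c \<mu> *s v \<mu> + (\<Sum>\<kappa>\<in>S. c \<kappa> *s v \<kappa>)) - \<mu> *s (c \<mu> *s v \<mu> + (\<Sum>\<kappa>\<in>S. c \<kappa> *s v \<kappa>))"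
      proof -
        have "f (\<Sum>\<kappa>\<in>S. c \<kappa> *s v \<kappa>) = (\<Sum>\<kappa>\<in>S. (c \<kappa> * \<kappa>) *s v \<kappa>)"
          unfolding complex_linear_sum[OF f] using insert.prems(1) v
          by (intro sum.cong) (auto simp: complex_linear_scale[OF f])
        moreover have "f (v \<mu>) = \<mu> *s v \<mu>" using v insert.prems(1) by blast
        ultimately have "f (c \<mu> *s v \<mu> + (\<Sum>\<kappa>\<in>S. c \<kappa> *s v \<kappa>)) = (c \<mu> * \<mu>) *s v \<mu> + (\<Sum>\<kappa>\<in>S. (c \<kappa> * \<kappa>) *s v \<kappa>)"
          by (simp add: complex_linear_add[OF f] complex_linear_scale[OF f])
        then show ?thesis
          by (simp add: vec_eq_iff sum_distrib_left algebra_simps sum_subtractf)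
      qed
      also have "\<dots> = 0" unfolding sum0 by (simp add: complex_linear_zero[OF f])
      finally have "\<forall>\<kappa>\<in>S. c \<kappa> * (\<kappa> - \<mu>) = 0" using insert.IH[of "\<lambda>x. c x * (x - \<mu>)"] insert.prems(1) by blast
      then have S0: "\<forall>\<kappa>\<in>S. c \<kappa> = 0" using insert.hyps(2) by auto
      then have "c \<mu> *s v \<mu> = 0" using sum0 by simp
      then have "c \<mu> = 0" using v[of \<mu>] insert.prems(1) by auto
      then show ?case using S0 by simp
    qed simp
  qed
  have inj: "inj_on v T"
  proof (rule inj_onI, rule ccontr)
    fix x y assume xy: "x \<in> T" "y \<in> T" "v x = v y" "x \<noteq> y"
    have "(\<Sum>\<kappa>\<in>{x,y}. (if \<kappa> = x then 1 else -1) *s v \<kappa>) = 0" using xy by simp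
    from indep[OF _ this] xy show False by simp
  qed
  have "vec.independent (v ` T)"
    unfolding vec.independent_explicit_module
  proof (intro allI impI)
    fix t u w assume t: "finite t" "t \<subseteq> v ` T" "(\<Sum>w\<in>t. u w *s w) = 0" "w \<in> t"
    obtain S where S: "S \<subseteq> T" "t = v ` S" using t(2) by (meson subset_imageE)
    then have "(\<Sum>\<kappa>\<in>S. u (v \<kappa>) *s v \<kappa>) = 0"
      using t(3) inj by (simp add: sum.reindex inj_on_subset)
    from indep[OF S(1) this] show "u w = 0" using S t(4) by auto
  qed
  then have "card (v ` T) \<le> vec.dim (UNIV :: (complex^'n) set)"
    by (intro vec.independent_card_le_dim) auto
  then show False using T(3) card_image[OF inj] by (simp add: vec.dim_UNIV card_cart_basis)
qed

section \<open>The Mukai lattice\<close>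

lemma total_simps [simp]:
  "deg0 (total a v c) = a" "deg2 (total a v c) = v" "deg4 (total a v c) = c"
  "deg0 (x + y) = deg0 x + deg0 y" "deg2 (x + y) = deg2 x + deg2 y" "deg4 (x + y) = deg4 x + deg4 y"
  "deg0 (x - y) = deg0 x - deg0 y" "deg2 (x - y) = deg2 x - deg2 y" "deg4 (x - y) = deg4 x - deg4 y"
  "deg0 (k *s x) = k * deg0 x" "deg2 (k *s x) = k *s deg2 x" "deg4 (k *s x) = k * deg4 x"
  "deg0 (cnj_vec x) = cnj (deg0 x)" "deg2 (cnj_vec x) = cnj_vec (deg2 x)" "deg4 (cnj_vec x) = cnj (deg4 x)"
  "deg0 0 = 0" "deg2 0 = 0" "deg4 0 = 0"
  by (simp_all add: deg0_def deg2_def deg4_def total_def vec_eq_iff cnj_vec_def)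

lemma total_eqI: "deg0 x = deg0 y \<Longrightarrow> deg2 x = deg2 y \<Longrightarrow> deg4 x = deg4 y \<Longrightarrow> x = y"
  by (auto simp: deg0_def deg2_def deg4_def vec_eq_iff split_sum_all)

lemma coords_in_total: "x \<in> coords_in S \<longleftrightarrow> deg0 x \<in> S \<and> deg2 x \<in> coords_in S \<and> deg4 x \<in> S"
  by (auto simp: deg0_def deg2_def deg4_def coords_in_def split_sum_all)

lemma real_form_mukai:
  assumes "real_form (bil Q)" shows "real_form (mukai Q)"
proof -
  interpret real_form "bil Q" by fact
  show ?thesis
  proof
    show "mukai Q x y = mukai Q y x" for x y
      using sym[of "deg2 x" "deg2 y"] by (simp add: mukai_def)
  qed (simp_all add: mukai_def form_simps cnj algebra_simps)
qed

interpretation M: real_form "mukai K3_form"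
  by (rule real_form_mukai) (rule K3.real_form_axioms)

text \<open>Degrees 0 and 4 contribute \<open>-2 * deg0 v * deg4 v\<close> to the square, which is
  nonpositive for real vectors with \<open>deg0 v = deg4 v\<close>. The difference of the two is
  thus the fourth coordinate, next to the three equations of the K3 lattice.\<close>

interpretation M4: four_positive_form "mukai K3_form" "\<lambda>v. \<chi> k. if k = 1 then Re (deg0 v - deg4 v)
   else if k = 2 then Re (deg2 v $ i1 + deg2 v $ j1) else if k = 3 then Re (deg2 v $ i2 + deg2 v $ j2)
   else Re (deg2 v $ i3 + deg2 v $ j3)"
proof (intro four_positive_form.intro four_positive_form_axioms.intro M.real_form_axioms)
  let ?\<pi> = "\<lambda>v. (\<chi> k. if k = 1 then Re (deg0 v - deg4 v)
   else if k = 2 then Re (deg2 v $ i1 + deg2 v $ j1) else if k = 3 then Re (deg2 v $ i2 + deg2 v $ j2)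
   else Re (deg2 v $ i3 + deg2 v $ j3)) :: real^4"
  show "linear ?\<pi>"
    by (rule linearI) (simp_all add: vec_eq_iff scaleR_eq_vector_scalar_mult algebra_simps)
  fix v :: "complex^k3_index total_index" assume v: "v \<in> coords_in \<real>" "?\<pi> v = 0"
  have r: "deg0 v \<in> \<real>" "deg2 v \<in> coords_in \<real>" "deg4 v \<in> \<real>" using v(1) by (auto simp: coords_in_total)
  then have im: "Im (deg0 v) = 0" "Im (deg4 v) = 0" "Im (deg2 v $ k) = 0" for k
    by (auto simp: complex_is_Real_iff coords_in_def)
  have "?\<pi> v $ 1 = 0" "?\<pi> v $ 2 = 0" "?\<pi> v $ 3 = 0" "?\<pi> v $ 4 = 0" unfolding v(2) by simp_all
  then have p: "Re (deg0 v) = Re (deg4 v)" "deg2 v $ i1 + deg2 v $ j1 = 0"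
    "deg2 v $ i2 + deg2 v $ j2 = 0" "deg2 v $ i3 + deg2 v $ j3 = 0"
    by (simp_all add: complex_eq_iff im)
  have "Re (bil K3_form (deg2 v) (deg2 v)) \<le> 0"
    using K3_negative_definite[OF r(2) _ p(2-4)] K3.zero_left by (cases "deg2 v = 0") auto
  moreover have "Re (mukai K3_form v v) = Re (bil K3_form (deg2 v) (deg2 v)) - 2 * (Re (deg4 v))^2"
    by (simp add: mukai_def p(1) im power2_eq_square)
  moreover have "(Re (deg4 v))^2 \<ge> 0" by simp
  ultimately show "Re (mukai K3_form v v) \<le> 0" by linarith
qed

definition total_map :: "(complex^'m \<Rightarrow> complex^'n) \<Rightarrow> complex^('m::finite total_index) \<Rightarrow> complex^('n::finite total_index)" where
  "total_map \<theta> x = total (deg0 x) (\<theta> (deg2 x)) (deg4 x)"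

lemma total_map_isometry:
  assumes \<theta>: "lattice_isometry (bil Q) (bil Q') \<theta>"
  shows "lattice_isometry (mukai Q) (mukai Q') (total_map \<theta>)"
proof -
  obtain \<eta> where \<eta>: "lattice_isometry (bil Q') (bil Q) \<eta>" "\<And>x. \<eta> (\<theta> x) = x" "\<And>y. \<theta> (\<eta> y) = y"
    using lattice_isometry_inverse[OF \<theta>] by blast
  have lin: "complex_linear \<theta>" using \<theta> by (simp add: lattice_isometry_def)
  have int: "h v \<in> coords_in \<int>" if "lattice_isometry b b' h" "v \<in> coords_in \<int>" for h b b' v
    using that by (auto simp: lattice_isometry_def bij_betw_def)
  have "complex_linear (total_map \<theta>)"
    by (rule complex_linearI; rule total_eqI)
      (simp_all add: total_map_def complex_linear_add[OF lin] complex_linear_scale[OF lin])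
  moreover have "bij_betw (total_map \<theta>) (coords_in \<int>) (coords_in \<int>)"
    by (rule bij_betw_byWitness[where f' = "total_map \<eta>"])
      (auto simp: total_map_def \<eta> coords_in_total int[OF \<theta>] int[OF \<eta>(1)] intro!: total_eqI)
  ultimately show ?thesis
    using \<theta> by (auto simp: lattice_isometry_def mukai_def total_map_def coords_in_total)
qed

text \<open>The product of exp(B) with a class of degree 2. The summand B^2/2 would land in degree 8
  and does not appear.\<close>

definition twist :: "int^'n^'n \<Rightarrow> complex^'n \<Rightarrow> complex^'n \<Rightarrow> complex^('n::finite total_index)" where
  "twist Q B \<tau> = total 0 \<tau> (bil Q B \<tau>)"

lemma twisted_H20_eq: "twisted_H20 X B = twist (cup X) B ` H20 X"
proof -
  have "wedge (cup X) (exp_class (cup X) B) (total 0 \<sigma> 0) = twist (cup X) B \<sigma>" for \<sigma>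
    unfolding wedge_def exp_class_def twist_def by (rule total_eqI) simp_all
  then show ?thesis unfolding twisted_H20_def by simp
qed

definition e2 :: "complex^k3_index" where "e2 = axis i2 1"
definition f2 :: "complex^k3_index" where "f2 = axis j2 1"
definition B0 :: "complex^k3_index" where "B0 = (1/3) *s e2"

abbreviation tw :: "complex^k3_index \<Rightarrow> complex^(k3_index total_index)" where
  "tw \<equiv> twist K3_form B0"

lemma bil_e2: "bil K3_form e2 v = v $ j2"
  unfolding bil_K3 e2_def by (simp add: axis_def) (simp add: bil_def)

lemma tw_eq: "tw \<tau> = total 0 \<tau> (\<tau> $ j2 / 3)"
  unfolding twist_def B0_def by (simp add: K3.form_simps bil_e2)

lemma tw_linear: "tw (x + y) = tw x + tw y" "tw (c *s x) = c *s tw x" "tw (cnj_vec x) = cnj_vec (tw x)"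
  unfolding tw_eq by (rule total_eqI; simp add: cnj_vec_simps add_divide_distrib)+

lemma mukai_tw: "mukai K3_form (tw x) (tw y) = bil K3_form x y"
  unfolding tw_eq mukai_def by simp

section \<open>The algebraic part\<close>

text \<open>Coordinates on N: the basis is \<open>ell 3\<close>, the class 3 exp(B) = 3 + e2 (there
  is no degree 4 part, since e2 is isotropic) and minus the point class. The last sign makes the
  second and third basis vectors pair to 3.\<close>

definition nvec :: "complex \<Rightarrow> complex \<Rightarrow> complex \<Rightarrow> complex^(k3_index total_index)" where
  "nvec x y z = total (3 * y) (x *s ell 3 + y *s e2) (- z)"

lemma bil_e2_values: "bil K3_form e2 e2 = 0" "bil K3_form e2 (ell d) = 0" "bil K3_form (ell d) e2 = 0"
  by (simp_all add: bil_e2 K3.sym[of "ell d"] bil_ell) (simp_all add: e2_def axis_def)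

lemma nvec_linear:
  "nvec x y z + nvec x' y' z' = nvec (x + x') (y + y') (z + z')" "c *s nvec x y z = nvec (c * x) (c * y) (c * z)"
  "nvec x y z - nvec x' y' z' = nvec (x - x') (y - y') (z - z')"
  unfolding nvec_def by (rule total_eqI; simp add: vec_eq_iff algebra_simps)+

lemma nvec_zero: "nvec 0 0 0 = 0"
  unfolding nvec_def by (rule total_eqI) simp_all

lemma mukai_nvec: "mukai K3_form (nvec x y z) (nvec x' y' z') = 6 * x * x' + 3 * (y * z' + z * y')"
  unfolding mukai_def nvec_def by (simp add: K3.form_simps bil_e2_values bil_ell_ell algebra_simps)

lemma mukai_nvec_tw:
  assumes "bil K3_form \<tau> (ell 3) = 0"
  shows "mukai K3_form (nvec x y z) (tw \<tau>) = 0" "mukai K3_form (tw \<tau>) (nvec x y z) = 0"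
proof -
  show "mukai K3_form (nvec x y z) (tw \<tau>) = 0"
    using assms unfolding mukai_def nvec_def tw_eq by (simp add: K3.form_simps bil_e2 K3.sym[of "ell 3" \<tau>])
  then show "mukai K3_form (tw \<tau>) (nvec x y z) = 0" using M.sym by metis
qed

text \<open>Multiplying by exp(-B) reduces to the untwisted case: in degree 2 this gives
  \<open>w\<close>, which is orthogonal to the complement of \<open>ell 3\<close> and hence a
  multiple of it. The 6 is the square of \<open>ell 3\<close>.\<close>

lemma nvec_of_perp:
  assumes "\<And>\<tau>. bil K3_form \<tau> (ell 3) = 0 \<Longrightarrow> mukai K3_form \<phi> (tw \<tau>) = 0"
  obtains x y z where "\<phi> = nvec x y z"
proof -
  define w where "w = deg2 \<phi> - deg0 \<phi> *s B0"
  have w: "bil K3_form w \<tau> = 0" if "bil K3_form \<tau> (ell 3) = 0" for \<tau>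
  proof -
    have "mukai K3_form \<phi> (tw \<tau>) = bil K3_form w \<tau>"
      by (simp add: mukai_def tw_eq) (simp add: w_def B0_def K3.form_simps bil_e2)
    then show ?thesis using assms[OF that] by simp
  qed
  define t where "t = bil K3_form w (ell 3) / 6"
  have "bil K3_form (w - t *s ell 3) v = 0" for v
  proof -
    define s where "s = bil K3_form v (ell 3) / 6"
    have "bil K3_form (v - s *s ell 3) (ell 3) = 0"
      by (simp add: K3.form_simps bil_ell_ell s_def)
    then have "bil K3_form w (v - s *s ell 3) = 0" by (rule w)
    then show ?thesis
      by (simp add: K3.form_simps s_def t_def K3.sym[of "ell 3" v])
  qed
  then have "w = t *s ell 3" using K3_nondegenerate by fastforce
  then have "\<phi> = nvec t (deg0 \<phi> / 3) (- deg4 \<phi>)"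
    unfolding nvec_def by (intro total_eqI) (simp_all add: w_def B0_def algebra_simps)
  then show ?thesis using that by blast
qed

text \<open>Each coordinate is read off where its coefficient is 1 or -1: \<open>x\<close> at
  \<open>e1\<close>, \<open>y\<close> at \<open>e2\<close> rather than in degree 0 with its factor
  3, and \<open>z\<close> in degree 4.\<close>

lemma nvec_divisible:
  assumes "nvec x y z = 3 *s u" "u \<in> coords_in \<int>"
  obtains a b c :: int where "x = of_int (3 * a)" "y = of_int (3 * b)" "z = of_int (3 * c)"
proof -
  have u: "deg2 u $ i1 \<in> \<int>" "deg2 u $ i2 \<in> \<int>" "deg4 u \<in> \<int>"
    using assms(2) by (auto simp: coords_in_total) (auto simp: coords_in_def)
  have "deg2 (nvec x y z) $ i1 = 3 * deg2 u $ i1" "deg2 (nvec x y z) $ i2 = 3 * deg2 u $ i2"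
    "deg4 (nvec x y z) = 3 * deg4 u" unfolding assms(1) by simp_all
  then have "x = 3 * deg2 u $ i1" "y = 3 * deg2 u $ i2" "- z = 3 * deg4 u"
    by (simp_all add: nvec_def ell_def e1_def f1_def e2_def axis_def)
  moreover from this(3) have "z = 3 * (- deg4 u)" by (metis minus_minus mult_minus_right)
  moreover obtain a b c where "deg2 u $ i1 = of_int a" "deg2 u $ i2 = of_int b" "- deg4 u = of_int c"
    using u by (metis Ints_cases Ints_minus)
  ultimately show ?thesis using that[of a b c] by simp
qed

text \<open>
  The gluing argument: a multiple of \<open>3\<close> differs from each basis vector of the algebraic part by a
  vector of the transcendental part, which \<open>G\<close> fixes.
\<close>

lemma transcendental_identity_congruence:
  assumes G: "lattice_isometry (mukai K3_form) (mukai K3_form) G"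
    and T: "\<forall>\<tau>. bil K3_form \<tau> (ell 3) = 0 \<longrightarrow> G (tw \<tau>) = tw \<tau>"
    and V: "nvec x y z = 3 *s u + tw w" "u \<in> coords_in \<int>" "bil K3_form w (ell 3) = 0"
  obtains a b c :: int where "G (nvec x y z) = nvec (x + of_int (3 * a)) (y + of_int (3 * b)) (z + of_int (3 * c))"
proof -
  have lin: "complex_linear G" using G by (simp add: lattice_isometry_def)
  have "mukai K3_form (G (nvec x y z)) (tw \<tau>) = 0" if "bil K3_form \<tau> (ell 3) = 0" for \<tau>
    using lattice_isometry_form[OF G M.real_form_axioms M.real_form_axioms, of "nvec x y z" "tw \<tau>"]
      T that mukai_nvec_tw[OF that] by simp
  then obtain x' y' z' where GV: "G (nvec x y z) = nvec x' y' z'" by (rule nvec_of_perp)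
  have "G (nvec x y z) = 3 *s G u + tw w"
    unfolding V(1) complex_linear_add[OF lin] complex_linear_scale[OF lin] T[rule_format, OF V(3)] ..
  then have "nvec (x' - x) (y' - y) (z' - z) = 3 *s (G u - u)"
    unfolding nvec_linear(3)[symmetric] GV[symmetric] by (simp add: V(1) vec_eq_iff algebra_simps)
  moreover have "G u \<in> coords_in \<int>" using G V(2) by (auto simp: lattice_isometry_def bij_betw_def)
  then have "G u - u \<in> coords_in \<int>" using V(2) by (auto simp: coords_in_def)
  ultimately obtain a b c :: int where
    "x' - x = of_int (3 * a)" "y' - y = of_int (3 * b)" "z' - z = of_int (3 * c)"
    by (rule nvec_divisible)
  then show ?thesis using that[of a b c] GV by (simp add: diff_eq_eq add.commute)
qed

section \<open>From the congruence modulo 3 to a positive test frame\<close>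

lemma lattice_isometry_sign:
  assumes F: "lattice_isometry b b' F" and "real_form b'" and e: "e = 1 \<or> e = -1"
  shows "lattice_isometry b b' (\<lambda>x. e *s F x)"
proof -
  interpret real_form b' by fact
  obtain g where g: "lattice_isometry b' b g" "\<And>x. g (F x) = x" "\<And>x. F (g x) = x"
    using lattice_isometry_inverse[OF F] by blast
  have ee: "e * e = 1" using e by auto
  have linF: "complex_linear F" and ling: "complex_linear g" using F g(1) by (simp_all add: lattice_isometry_def)
  have int: "e *s h v \<in> coords_in \<int>" if "lattice_isometry c c' h" "v \<in> coords_in \<int>" for h c c' v
  proof -
    have "h v \<in> coords_in \<int>" using that by (auto simp: lattice_isometry_def bij_betw_def)
    then show ?thesis using e by (auto simp: coords_in_def)
  qed
  have "complex_linear (\<lambda>x. e *s F x)"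
    by (rule complex_linearI) (simp_all add: complex_linear_imp[OF linF] vec.scale_right_distrib mult.commute)
  moreover have "bij_betw (\<lambda>x. e *s F x) (coords_in \<int>) (coords_in \<int>)"
    by (rule bij_betw_byWitness[where f' = "\<lambda>x. e *s g x"])
      (auto simp: complex_linear_scale[OF linF] complex_linear_scale[OF ling] g ee int[OF F] int[OF g(1)])
  moreover have "b' (e *s F v) (e *s F w) = b' (F v) (F w)" for v w
    using ee by (simp add: form_simps mult.assoc[symmetric])
  ultimately show ?thesis using F by (simp add: lattice_isometry_def)
qed

lemma det_block_4:
  fixes A :: "real^4^4"
  assumes "A$1$2 = 0" "A$1$3 = 0" "A$1$4 = 0" "A$2$1 = 0" "A$2$3 = 0" "A$2$4 = 0"
    "A$3$1 = 0" "A$3$2 = 0" "A$4$1 = 0" "A$4$2 = 0"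
  shows "det A = A$1$1 * A$2$2 * (A$3$3 * A$4$4 - A$3$4 * A$4$3)"
proof -
  have f1: "finite {2, 3, 4::4}" "1 \<notin> {2, 3, 4::4}" by auto
  have f2: "finite {3, 4::4}" "2 \<notin> {3, 4::4}" by auto
  have f3: "finite {4::4}" "3 \<notin> {4::4}" by auto
  show ?thesis
    unfolding det_def UNIV_4
    unfolding sum_over_permutations_insert[OF f1]
    unfolding sum_over_permutations_insert[OF f2]
    unfolding sum_over_permutations_insert[OF f3]
    unfolding permutes_sing
    by (simp add: sign_swap_id permutation_swap_id permutation_compose sign_compose sign_id swap_id_eq assms algebra_simps)
qed

lemma algebraic_minor_pos:
  assumes G: "lattice_isometry (mukai K3_form) (mukai K3_form) G"
    and T: "\<forall>\<tau>. bil K3_form \<tau> (ell 3) = 0 \<longrightarrow> G (tw \<tau>) = tw \<tau>"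
  obtains a b c x s t :: real where "G (nvec 1 0 0) = nvec a b c"
    "G (nvec 0 1 1) = nvec x s t" "a * (s + t) - (b + c) * x > 0"
proof -
  note iso = lattice_isometry_form[OF G M.real_form_axioms M.real_form_axioms]
  have lin: "complex_linear G" using G by (simp add: lattice_isometry_def)
  \<comment> \<open>\<open>ell 3\<close> is \<open>6 f1\<close> plus the vector
    \<open>e1 - 3 f1\<close> orthogonal to it; here 3 divides \<open>2 d\<close>.\<close>
  have "nvec 1 0 0 = 3 *s total 0 (2 *s f1) 0 + tw (e1 - 3 *s f1)"
    unfolding nvec_def tw_eq
    by (intro total_eqI) (simp_all add: ell_def vec_eq_iff algebra_simps e1_def f1_def axis_def)
  moreover have "total 0 (2 *s f1) 0 \<in> coords_in \<int>"
    by (auto simp: coords_in_total) (auto simp: coords_in_def f1_def axis_def)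
  moreover have "bil K3_form (e1 - 3 *s f1) (ell 3) = 0"
    unfolding bil_ell by (simp add: e1_def f1_def axis_def)
  ultimately obtain a b c :: int where
    L: "G (nvec 1 0 0) = nvec (1 + of_int (3 * a)) (0 + of_int (3 * b)) (0 + of_int (3 * c))"
    by (rule transcendental_identity_congruence[OF G T])
  \<comment> \<open>Here \<open>tw e2\<close> has no degree 4 part, as \<open>e2\<close> is
    orthogonal to \<open>B0\<close>.\<close>
  have "nvec 0 1 0 = 3 *s total 1 0 0 + tw e2"
    unfolding nvec_def tw_eq by (intro total_eqI) (simp_all add: e2_def axis_def)
  moreover have "total 1 (0 :: complex^k3_index) 0 \<in> coords_in \<int>"
    by (auto simp: coords_in_total) (auto simp: coords_in_def)
  moreover have "bil K3_form e2 (ell 3) = 0" by (rule bil_e2_values)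
  ultimately obtain x1 y1 z1 :: int where
    E: "G (nvec 0 1 0) = nvec (0 + of_int (3 * x1)) (1 + of_int (3 * y1)) (0 + of_int (3 * z1))"
    by (rule transcendental_identity_congruence[OF G T])
  \<comment> \<open>\<open>B0\<close> pairs with \<open>-3 f2\<close> to -1, so the twist produces
    exactly minus the point class in degree 4.\<close>
  have "nvec 0 0 1 = 3 *s total 0 f2 0 + tw (- 3 *s f2)"
    unfolding nvec_def tw_eq by (intro total_eqI) (simp_all add: f2_def axis_def)
  moreover have "total 0 f2 0 \<in> coords_in \<int>"
    by (auto simp: coords_in_total f2_def axis_coords_in_Ints)
  moreover have "bil K3_form (- 3 *s f2) (ell 3) = 0"
    unfolding bil_ell by (simp add: f2_def axis_def)
  ultimately obtain x2 y2 z2 :: int where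
    P: "G (nvec 0 0 1) = nvec (0 + of_int (3 * x2)) (0 + of_int (3 * y2)) (1 + of_int (3 * z2))"
    by (rule transcendental_identity_congruence[OF G T])
  define A B C X1 Y1 Z1 X2 Y2 Z2 where
    "A = 1 + 3 * a" "B = 3 * b" "C = 3 * c" "X1 = 3 * x1" "Y1 = 1 + 3 * y1" "Z1 = 3 * z1"
    "X2 = 3 * x2" "Y2 = 3 * y2" "Z2 = 1 + 3 * z2"
  note d = this
  have L': "G (nvec 1 0 0) = nvec (of_int A) (of_int B) (of_int C)" using L by (simp add: d)
  have E': "G (nvec 0 1 0) = nvec (of_int X1) (of_int Y1) (of_int Z1)" using E by (simp add: d)
  have P': "G (nvec 0 0 1) = nvec (of_int X2) (of_int Y2) (of_int Z2)" using P by (simp add: d)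
  have int: "of_int m = (of_int n :: complex) \<Longrightarrow> m = n" for m n by simp
  have EE: "6 * X1 * X1 + 3 * (Y1 * Z1 + Z1 * Y1) = 0"
    by (rule int) (use iso[of "nvec 0 1 0" "nvec 0 1 0"] in \<open>simp add: E' mukai_nvec\<close>)
  have PP: "6 * X2 * X2 + 3 * (Y2 * Z2 + Z2 * Y2) = 0"
    by (rule int) (use iso[of "nvec 0 0 1" "nvec 0 0 1"] in \<open>simp add: P' mukai_nvec\<close>)
  have EP: "6 * X1 * X2 + 3 * (Y1 * Z2 + Z1 * Y2) = 3"
    by (rule int) (use iso[of "nvec 0 1 0" "nvec 0 0 1"] in \<open>simp add: E' P' mukai_nvec\<close>)
  have LL: "6 * A * A + 3 * (B * C + C * B) = 6"
    by (rule int) (use iso[of "nvec 1 0 0" "nvec 1 0 0"] in \<open>simp add: L' mukai_nvec\<close>)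
  have LE: "6 * A * X1 + 3 * (B * Z1 + C * Y1) = 0"
    by (rule int) (use iso[of "nvec 1 0 0" "nvec 0 1 0"] in \<open>simp add: L' E' mukai_nvec\<close>)
  have LP: "6 * A * X2 + 3 * (B * Z2 + C * Y2) = 0"
    by (rule int) (use iso[of "nvec 1 0 0" "nvec 0 0 1"] in \<open>simp add: L' P' mukai_nvec\<close>)
  have pos: "A*(Y1+Y2+Z1+Z2) - (B+C)*(X1+X2) > 0"
  proof (rule congruence_isometry_minor_pos)
    show "X1^2 + Y1*Z1 = 0" "X2^2 + Y2*Z2 = 0" "2*X1*X2 + Y1*Z2 + Z1*Y2 = 1"
      "A^2 + B*C = 1" "2*A*X1 + B*Z1 + C*Y1 = 0" "2*A*X2 + B*Z2 + C*Y2 = 0"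
      using EE PP EP LL LE LP by (simp_all add: power2_eq_square algebra_simps)
  qed (simp_all add: d)
  have sum: "nvec 0 1 1 = nvec 0 1 0 + nvec 0 0 1" unfolding nvec_linear by simp
  have N: "G (nvec 0 1 1) = nvec (of_int (X1 + X2)) (of_int (Y1 + Y2)) (of_int (Z1 + Z2))"
    unfolding sum complex_linear_add[OF lin] E' P' by (simp only: nvec_linear of_int_add)
  have "real_of_int (A*(Y1+Y2+Z1+Z2) - (B+C)*(X1+X2)) > 0" using pos by (simp only: of_int_0_less_iff)
  then have "real_of_int A * (real_of_int (Y1+Y2) + real_of_int (Z1+Z2))
    - (real_of_int B + real_of_int C) * real_of_int (X1+X2) > 0" by (simp add: algebra_simps)
  then show ?thesis
    using that[of "of_int A" "of_int B" "of_int C" "of_int (X1+X2)" "of_int (Y1+Y2)" "of_int (Z1+Z2)"] L' N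
    by simp
qed

text \<open>The test frame consists of the twisted real and imaginary parts of the period and of
  \<open>nvec 1 0 0\<close> and \<open>nvec 0 1 1\<close>; it is orthogonal with squares r, r, 6, 6.
  On the first pair \<open>F\<close> is the scalar \<open>e\<close>, and on the second the
  projection is given by the minor of \<open>algebraic_minor_pos\<close>, so the determinant is e^4
  times half of a positive number.\<close>

lemma signed_frame:
  assumes F: "lattice_isometry (mukai K3_form) (mukai K3_form) F"
    and e: "e = 1 \<or> e = (-1 :: real)"
    and T: "\<And>\<tau>. bil K3_form \<tau> (ell 3) = 0 \<Longrightarrow> F (tw \<tau>) = of_real e *s tw \<tau>"
    and \<sigma>: "\<sigma> \<in> period_cone 3"
  obtains F0 A where "F0 \<in> positive_frames (mukai K3_form)" "M.frame_perp (frame_map F F0) A F0" "det A > 0"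
proof -
  define G where "G x = of_real e *s F x" for x
  have ee: "e * e = 1" using e by auto
  have F_eq: "F x = of_real e *s G x" for x
    using ee unfolding G_def by (simp add: of_real_mult[symmetric] del: of_real_mult)
  have G: "lattice_isometry (mukai K3_form) (mukai K3_form) G"
    unfolding G_def using e by (intro lattice_isometry_sign[OF F M.real_form_axioms]) auto
  have GT: "\<forall>\<tau>. bil K3_form \<tau> (ell 3) = 0 \<longrightarrow> G (tw \<tau>) = tw \<tau>"
    using ee by (simp add: G_def T of_real_mult[symmetric] del: of_real_mult)
  obtain a b c x s t :: real where N: "G (nvec 1 0 0) = nvec a b c"
    "G (nvec 0 1 1) = nvec x s t" "a * (s + t) - (b + c) * x > 0"
    by (rule algebraic_minor_pos[OF G GT])
  define u where "u = (1/2) *s (\<sigma> + cnj_vec \<sigma>)"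
  define v where "v = (- \<i>/2) *s (\<sigma> - cnj_vec \<sigma>)"
  define r where "r = Re (bil K3_form \<sigma> (cnj_vec \<sigma>)) / 2"
  have uv: "u \<in> coords_in \<real>" "v \<in> coords_in \<real>" "bil K3_form u (ell 3) = 0" "bil K3_form v (ell 3) = 0"
    "bil K3_form u v = 0" "Re (bil K3_form u u) = r" "Re (bil K3_form v v) = r"
  proof -
    note p = period_cone_parts[OF \<sigma>, folded u_def v_def]
    show "u \<in> coords_in \<real>" "v \<in> coords_in \<real>" "bil K3_form u (ell 3) = 0" "bil K3_form v (ell 3) = 0"
      "bil K3_form u v = 0" by (fact p)+
    show "Re (bil K3_form u u) = r" "Re (bil K3_form v v) = r" unfolding p(7,8) r_def by simp_all
  qed
  have r: "r > 0" using \<sigma> by (simp add: r_def period_cone_def)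
  define F0 :: "(complex^(k3_index total_index))^4" where
    "F0 = (\<chi> i. if i = 1 then tw u else if i = 2 then tw v else if i = 3 then nvec 1 0 0 else nvec 0 1 1)"
  define A :: "real^4^4" where
    "A = (\<chi> i j. if i = 1 then (if j = 1 then e else 0) else if i = 2 then (if j = 2 then e else 0)
       else if i = 3 then (if j = 3 then e * a else if j = 4 then e * ((b + c) / 2) else 0)
       else (if j = 3 then e * x else if j = 4 then e * ((s + t) / 2) else 0))"
  have real: "F0 $ i \<in> coords_in \<real>" for i
  proof -
    have "tw w \<in> coords_in \<real>" if "w \<in> coords_in \<real>" for w
      using that by (auto simp: tw_eq coords_in_total) (auto simp: coords_in_def)
    moreover have "nvec (of_real p) (of_real q) (of_real q') \<in> coords_in \<real>" for p q q' :: real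
      unfolding coords_in_total nvec_def using ell_real[of 3] by (auto simp: coords_in_def e2_def axis_def)
    from this[of 1 0 0] this[of 0 1 1] have "nvec 1 0 0 \<in> coords_in \<real>" "nvec 0 1 1 \<in> coords_in \<real>" by simp_all
    ultimately show ?thesis using uv(1,2) by (simp add: F0_def)
  qed
  have gram: "mukai K3_form (F0 $ i) (F0 $ j) = (if i = j then (if i = 1 then bil K3_form u u else
      if i = 2 then bil K3_form v v else 6) else 0)" for i j
    unfolding F0_def using exhaust_4[of i] exhaust_4[of j] uv(3-5)
    by (auto simp: mukai_tw mukai_nvec mukai_nvec_tw K3.sym[of v u])
  have "Re (mukai K3_form (frame_comb k F0) (frame_comb k F0)) > 0" if "k \<noteq> 0" for k
  proof -
    have "Re (mukai K3_form (frame_comb k F0) (frame_comb k F0)) =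
      (\<Sum>i\<in>UNIV. k $ i * (\<Sum>j\<in>UNIV. k $ j * Re (mukai K3_form (F0 $ j) (F0 $ i))))"
      by (subst M.Re_b_frame_comb, subst M.sym, subst M.Re_b_frame_comb) (simp add: M.sym)
    also have "\<dots> = (k$1)^2 * r + (k$2)^2 * r + (k$3)^2 * 6 + (k$4)^2 * 6"
      unfolding sum_4 gram using uv(6,7) by (simp add: power2_eq_square)
    also have "\<dots> > 0"
    proof -
      have "k$1 \<noteq> 0 \<or> k$2 \<noteq> 0 \<or> k$3 \<noteq> 0 \<or> k$4 \<noteq> 0" using that by (simp add: vec_eq_iff forall_4)
      moreover have "(k$1)^2 * r \<ge> 0" "(k$2)^2 * r \<ge> 0" "(k$3)^2 * 6 \<ge> 0" "(k$4)^2 * 6 \<ge> 0" using r by simp_all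
      moreover have "k$1 \<noteq> 0 \<Longrightarrow> (k$1)^2 * r > 0" "k$2 \<noteq> 0 \<Longrightarrow> (k$2)^2 * r > 0"
        "k$3 \<noteq> 0 \<Longrightarrow> (k$3)^2 * 6 > 0" "k$4 \<noteq> 0 \<Longrightarrow> (k$4)^2 * 6 > 0" using r by simp_all
      ultimately show ?thesis by linarith
    qed
    finally show ?thesis .
  qed
  then have pos: "F0 \<in> positive_frames (mukai K3_form)" using real by (simp add: M.positive_frames_iff)
  \<comment> \<open>What the projection leaves over is a multiple of \<open>nvec 0 1 (-1)\<close>,
    the negative direction of N orthogonal to the frame.\<close>
  have res: "(frame_map F F0 - frame_act A F0) $ i =
      (if i = 3 then nvec 0 (e * ((b - c) / 2)) (- (e * ((b - c) / 2)))
       else if i = 4 then nvec 0 (e * ((s - t) / 2)) (- (e * ((s - t) / 2))) else 0)" for i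
  proof -
    have "F (tw u) = e *\<^sub>R tw u" "F (tw v) = e *\<^sub>R tw v"
      using T uv(3,4) by (simp_all add: scaleR_eq_vector_scalar_mult)
    moreover have "F (nvec 1 0 0) = nvec (e * a) (e * b) (e * c)" "F (nvec 0 1 1) = nvec (e * x) (e * s) (e * t)"
      by (simp_all add: F_eq N nvec_linear)
    moreover have "p *\<^sub>R nvec y y' y'' = nvec (p * y) (p * y') (p * y'')" for p y y' y''
      by (simp add: scaleR_eq_vector_scalar_mult nvec_linear)
    ultimately show ?thesis
      using exhaust_4[of i]
      by (auto simp: frame_map_def frame_act_def sum_4 A_def F0_def nvec_linear nvec_zero intro!: arg_cong3[of _ _ _ _ _ _ nvec])
         (simp_all add: field_simps)
  qed
  have "mukai K3_form (nvec 0 y (- y)) (F0 $ k) = 0" for y k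
    unfolding F0_def using uv(3,4) by (simp add: mukai_nvec mukai_nvec_tw)
  then have "M.frame_perp (frame_map F F0) A F0"
    unfolding M.frame_perp_def res by (simp add: M.zero_left)
  moreover have "det A = e * e * (e * a * (e * ((s + t) / 2)) - e * ((b + c) / 2) * (e * x))"
    by (subst det_block_4) (simp_all add: A_def)
  then have "det A = (e * e) * (e * e) * ((a * (s + t) - (b + c) * x) / 2)" by (simp add: field_simps)
  then have "det A > 0" using N(3) ee by simp
  ultimately show ?thesis using that pos by blast
qed

text \<open>The marking transports the test frame and its projection matrix back to the Mukai
  lattice of \<open>X\<close>, where the criterion is applied to \<open>f\<close> itself.\<close>

lemma twisted_isometry_signed:
  assumes Q: "real_form (bil Q)" and \<theta>: "lattice_isometry (bil Q) (bil K3_form) \<theta>"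
    and f: "lattice_isometry (mukai Q) (mukai Q) f"
    and F0: "F0 \<in> positive_frames (mukai K3_form)"
    and inv: "\<And>x. \<eta> (total_map \<theta> x) = x" "\<And>y. total_map \<theta> (\<eta> y) = y"
    and A: "M.frame_perp (frame_map (\<lambda>x. total_map \<theta> (f (\<eta> x))) F0) A F0" "det A > 0"
  shows "signed_isometry (mukai Q) f"
proof -
  note MQ = real_form_mukai[OF Q]
  note \<Theta> = total_map_isometry[OF \<theta>]
  obtain \<eta>' where \<eta>': "lattice_isometry (mukai K3_form) (mukai Q) \<eta>'"
    "\<And>x. \<eta>' (total_map \<theta> x) = x" "\<And>y. total_map \<theta> (\<eta>' y) = y"
    by (rule lattice_isometry_inverse[OF \<Theta>]) (rule that)
  have "\<eta>' y = \<eta> y" for y using \<eta>'(2)[of "\<eta> y"] by (simp only: inv(2))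
  then have "\<eta>' = \<eta>" by (rule ext)
  then have \<eta>: "lattice_isometry (mukai K3_form) (mukai Q) \<eta>" using \<eta>'(1) by (simp only:)
  interpret four_positive_form "mukai Q" "\<lambda>x. (\<lambda>v. \<chi> k. if k = 1 then Re (deg0 v - deg4 v)
    else if k = 2 then Re (deg2 v $ i1 + deg2 v $ j1) else if k = 3 then Re (deg2 v $ i2 + deg2 v $ j2)
    else Re (deg2 v $ i3 + deg2 v $ j3)) (total_map \<theta> x)"
    by (rule four_positive_form_pullback[OF M4.four_positive_form_axioms MQ \<Theta>])
  have "frame_perp (frame_map \<eta> (frame_map (\<lambda>x. total_map \<theta> (f (\<eta> x))) F0)) A (frame_map \<eta> F0)"
    by (rule frame_perp_map[OF \<eta> M.real_form_axioms MQ A(1)])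
  then have "frame_perp (frame_map f (frame_map \<eta> F0)) A (frame_map \<eta> F0)"
    by (simp add: frame_map_def inv)
  moreover have "frame_map \<eta> F0 \<in> positive_frames (mukai Q)"
    by (rule frame_map_positive[OF \<eta> M.real_form_axioms MQ F0])
  ultimately show ?thesis using signed_isometry_criterion[OF f] A(2) by blast
qed

section \<open>Very general periods\<close>

definition eigen_locus :: "(complex^(k3_index total_index) \<Rightarrow> complex^(k3_index total_index)) \<Rightarrow> complex \<Rightarrow> (complex^k3_index) set" where
  "eigen_locus F l = {\<tau>. bil K3_form \<tau> (ell 3) = 0 \<and> F (tw \<tau>) = l *s tw \<tau>}"

text \<open>One coordinate of the equation that \<open>F\<close> acts as \<open>l\<close>. Each is a
  single linear equation, so the locus is either a hyperplane section or all of the complement of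
  \<open>ell 3\<close>.\<close>

definition coordinate_locus :: "(complex^(k3_index total_index) \<Rightarrow> complex^(k3_index total_index)) \<Rightarrow> complex \<Rightarrow> k3_index total_index \<Rightarrow> (complex^k3_index) set" where
  "coordinate_locus F l i = {\<tau>. bil K3_form \<tau> (ell 3) = 0 \<and> (F (tw \<tau>) - l *s tw \<tau>) $ i = 0}"

lemma eigen_locus_submanifold:
  assumes F: "lattice_isometry (mukai K3_form) (mukai K3_form) F" and l: "l * l \<noteq> 1"
  shows "\<exists>k<19. closed_proj_submanifold (N_moduli 3) k {p \<in> N_moduli 3. p \<subseteq> eigen_locus F l}"
proof (rule isotropic_section_closed_submanifold)
  have lin: "complex_linear F" using F by (simp add: lattice_isometry_def)
  show "vec.subspace (eigen_locus F l)"
  proof (rule vec.subspaceI)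
    have "tw 0 = 0" unfolding tw_eq by (rule total_eqI) simp_all
    then show "0 \<in> eigen_locus F l" by (simp add: eigen_locus_def K3.zero_left complex_linear_zero[OF lin])
  qed (auto simp: eigen_locus_def K3.form_simps tw_linear complex_linear_imp[OF lin] vec.scale_right_distrib mult.commute)
  fix v w assume vw: "v \<in> eigen_locus F l" "w \<in> eigen_locus F l"
  have "mukai K3_form (F (tw v)) (F (tw w)) = bil K3_form v w"
    using lattice_isometry_form[OF F M.real_form_axioms M.real_form_axioms] by (simp add: mukai_tw)
  then have "l * l * bil K3_form v w = bil K3_form v w"
    using vw by (simp add: eigen_locus_def M.form_simps mukai_tw mult.assoc)
  then show "bil K3_form v w = 0" using l by (metis mult_cancel_right2)
qed (auto simp: eigen_locus_def)

lemma coordinate_locus_submanifold: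
  assumes F: "lattice_isometry (mukai K3_form) (mukai K3_form) F" and l: "cnj l = l"
    and u: "bil K3_form u (ell 3) = 0" "u \<notin> coordinate_locus F l i"
  shows "\<exists>k<19. closed_proj_submanifold (N_moduli 3) k {p \<in> N_moduli 3. p \<subseteq> coordinate_locus F l i}"
  unfolding coordinate_locus_def
proof (rule hyperplane_section_closed_submanifold)
  have lin: "complex_linear F" using F by (simp add: lattice_isometry_def)
  show "(F (tw (x + y)) - l *s tw (x + y)) $ i = (F (tw x) - l *s tw x) $ i + (F (tw y) - l *s tw y) $ i" for x y
    by (simp add: tw_linear complex_linear_imp[OF lin] algebra_simps)
  show "(F (tw (c *s x)) - l *s tw (c *s x)) $ i = c * (F (tw x) - l *s tw x) $ i" for c x
    by (simp add: tw_linear complex_linear_imp[OF lin] algebra_simps)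
  show "(F (tw (cnj_vec x)) - l *s tw (cnj_vec x)) $ i = cnj ((F (tw x) - l *s tw x) $ i)" for x
    by (simp add: tw_linear lattice_isometry_cnj[OF F] l cnj_vec_simps)
  show "bil K3_form u (ell 3) = 0" "(F (tw u) - l *s tw u) $ i \<noteq> 0"
    using u by (auto simp: coordinate_locus_def)
qed simp

definition exceptional_loci :: "(complex^k3_index) set set" where
  "exceptional_loci =
     (\<Union>F \<in> {F. lattice_isometry (mukai K3_form) (mukai K3_form) F}.
        eigen_locus F ` {l. l * l \<noteq> 1 \<and> (\<exists>v. v \<noteq> 0 \<and> F v = l *s v)}
        \<union> (\<Union>i. (\<lambda>l. coordinate_locus F l i) `
            {l \<in> {1, -1}. \<exists>u. bil K3_form u (ell 3) = 0 \<and> u \<notin> coordinate_locus F l i}))"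

lemma countable_exceptional_loci: "countable exceptional_loci"
  unfolding exceptional_loci_def
proof (intro countable_UN countable_lattice_isometries countable_Un)
  fix F assume "F \<in> {F. lattice_isometry (mukai K3_form) (mukai K3_form) F}"
  then have "finite {l. \<exists>v. v \<noteq> 0 \<and> F v = l *s v}"
    by (intro finite_eigenvalues) (simp add: lattice_isometry_def)
  then have "finite {l. l * l \<noteq> 1 \<and> (\<exists>v. v \<noteq> 0 \<and> F v = l *s v)}" by (rule rev_finite_subset) auto
  then show "countable (eigen_locus F ` {l. l * l \<noteq> 1 \<and> (\<exists>v. v \<noteq> 0 \<and> F v = l *s v)})"
    by (intro countable_finite finite_imageI)
qed (auto intro!: countable_image countable_finite[OF finite_subset[of _ "{1, -1}"]])

lemma exceptional_loci_submanifold: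
  assumes "W \<in> exceptional_loci"
  shows "\<exists>k<19. closed_proj_submanifold (N_moduli 3) k {p \<in> N_moduli 3. p \<subseteq> W}"
  using assms unfolding exceptional_loci_def
  by (auto intro: eigen_locus_submanifold coordinate_locus_submanifold)

lemma proj_point_nonzero:
  assumes "p \<in> proj_points" obtains v where "v \<in> p" "v \<noteq> 0"
proof -
  have "vec.dim p = 1" using assms by (simp add: proj_points_def)
  then have "\<not> p \<subseteq> {0}" using vec.dim_eq_0[of p] by linarith
  then show ?thesis using that by blast
qed

text \<open>The period line is an eigenline with some eigenvalue \<open>l\<close>, and avoiding the
  eigenspace loci gives \<open>l * l = 1\<close>. If \<open>F\<close> were not \<open>l\<close> on
  all of T, some coordinate locus would be proper and yet contain \<open>p\<close>.\<close>

lemma isometry_scalar_off_exceptional_loci: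
  assumes F: "lattice_isometry (mukai K3_form) (mukai K3_form) F"
    and p: "p \<in> N_moduli 3" "\<And>W. W \<in> exceptional_loci \<Longrightarrow> \<not> p \<subseteq> W"
    and Fp: "\<And>\<tau>. \<tau> \<in> p \<Longrightarrow> F (tw \<tau>) \<in> tw ` p"
  obtains e :: real where "e = 1 \<or> e = -1"
    "\<And>\<tau>. bil K3_form \<tau> (ell 3) = 0 \<Longrightarrow> F (tw \<tau>) = of_real e *s tw \<tau>"
proof -
  have pp: "p \<in> proj_points" and pell: "\<And>v. v \<in> p \<Longrightarrow> bil K3_form v (ell 3) = 0"
    using p(1) by (auto simp: N_moduli_def period_domain_def)
  have lin: "complex_linear F" using F by (simp add: lattice_isometry_def)
  obtain \<sigma> where \<sigma>: "\<sigma> \<in> p" "\<sigma> \<noteq> 0" by (rule proj_point_nonzero[OF pp])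
  have peq: "p = range (\<lambda>c. c *s \<sigma>)" by (rule proj_point_eq[OF pp \<sigma>])
  obtain l where "F (tw \<sigma>) = tw (l *s \<sigma>)" using Fp[OF \<sigma>(1)] unfolding peq by blast
  then have l: "F (tw \<sigma>) = l *s tw \<sigma>" by (simp only: tw_linear)
  have on_p: "F (tw \<tau>) = l *s tw \<tau>" if "\<tau> \<in> p" for \<tau>
    using that unfolding peq by (auto simp: tw_linear complex_linear_scale[OF lin] l mult.commute)
  have "tw \<sigma> \<noteq> 0" using \<sigma>(2) by (metis total_simps(2,17) tw_eq)
  have "l * l = 1"
  proof (rule ccontr)
    assume "l * l \<noteq> 1"
    then have "eigen_locus F l \<in> exceptional_loci"
      using F l \<open>tw \<sigma> \<noteq> 0\<close> unfolding exceptional_loci_def by blast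
    moreover have "p \<subseteq> eigen_locus F l" using on_p pell by (auto simp: eigen_locus_def)
    ultimately show False using p(2) by blast
  qed
  then have l1: "l \<in> {1, -1}" by (simp add: square_eq_1_iff)
  have all: "F (tw \<tau>) = l *s tw \<tau>" if \<tau>: "bil K3_form \<tau> (ell 3) = 0" for \<tau>
  proof (rule ccontr)
    assume "\<not> ?thesis"
    then have "F (tw \<tau>) - l *s tw \<tau> \<noteq> 0" by simp
    then obtain i where "(F (tw \<tau>) - l *s tw \<tau>) $ i \<noteq> 0" unfolding vec_eq_iff by auto
    then have "\<tau> \<notin> coordinate_locus F l i" by (simp add: coordinate_locus_def)
    then have "coordinate_locus F l i \<in> exceptional_loci"
      using F l1 \<tau> unfolding exceptional_loci_def by blast
    moreover have "p \<subseteq> coordinate_locus F l i" using on_p pell by (auto simp: coordinate_locus_def)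
    ultimately show False using p(2) by blast
  qed
  show ?thesis
    using l1 all that[of "Re l"] by auto
qed

theorem theorem4:
  shows "\<exists>(d::nat) (B::complex^k3_index). d > 0 \<and> B \<in> coords_in \<rat> \<and>
    holds_very_generally (N_moduli d) 19 (\<lambda>p.
      \<forall>X \<theta>. marked_polarized_K3 d X \<theta> \<and> period X \<theta> = p \<longrightarrow>
        (\<forall>f. twisted_Hodge_isometry X (inv \<theta> B) f \<longrightarrow> signed_isometry (mukai (cup X)) f))"
proof (intro exI conjI)
  show "B0 \<in> coords_in \<rat>" by (auto simp: B0_def e2_def coords_in_def axis_def)
  define \<Z> where "\<Z> = (\<lambda>W. {p \<in> N_moduli 3. p \<subseteq> W}) ` exceptional_loci"
  show "holds_very_generally (N_moduli 3) 19 (\<lambda>p.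
      \<forall>X \<theta>. marked_polarized_K3 3 X \<theta> \<and> period X \<theta> = p \<longrightarrow>
        (\<forall>f. twisted_Hodge_isometry X (inv \<theta> B0) f \<longrightarrow> signed_isometry (mukai (cup X)) f))"
    unfolding holds_very_generally_def
  proof (intro exI[of _ \<Z>] conjI ballI allI impI)
    show "countable \<Z>" using countable_exceptional_loci by (simp add: \<Z>_def)
    show "\<exists>k<19. closed_proj_submanifold (N_moduli 3) k Z" if "Z \<in> \<Z>" for Z
      using that exceptional_loci_submanifold by (auto simp: \<Z>_def)
    fix p X \<theta> f
    assume p: "p \<in> N_moduli 3 - \<Union>\<Z>" and X: "marked_polarized_K3 3 X \<theta> \<and> period X \<theta> = p"
      and f: "twisted_Hodge_isometry X (inv \<theta> B0) f"
    have \<theta>: "lattice_isometry (bil (cup X)) (bil K3_form) \<theta>" and per: "\<theta> ` H20 X = p"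
      using X by (auto simp: marked_polarized_K3_def period_def)
    obtain \<eta> where \<eta>: "lattice_isometry (bil K3_form) (bil (cup X)) \<eta>"
      "\<And>x. \<eta> (\<theta> x) = x" "\<And>y. \<theta> (\<eta> y) = y"
      using lattice_isometry_inverse[OF \<theta>] by blast
    \<comment> \<open>The cup product inherits its symmetry from the K3 form through the
      marking.\<close>
    have "cup X $ i $ j = cup X $ j $ i" for i j
    proof -
      have "bil K3_form (\<theta> (axis i 1)) (\<theta> (axis j 1)) = bil (cup X) (axis i 1) (axis j 1)" for i j
        using \<theta> axis_coords_in_Ints unfolding lattice_isometry_def by blast
      note this[unfolded bil_axis]
      then have "(of_int (cup X $ i $ j) :: complex) = of_int (cup X $ j $ i)"
        using K3.sym by metis
      then show ?thesis by simp
    qed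
    then have Q: "real_form (bil (cup X))" by (rule real_form_bil)
    let ?B = "inv \<theta> B0"
    \<comment> \<open>\<open>inv\<close> is a choice of preimage; surjectivity makes
      \<open>inv \<theta> B0\<close> a genuine preimage of \<open>B0\<close>.\<close>
    have "surj \<theta>" using \<eta>(3) by (rule surjI)
    then have \<theta>B: "\<theta> ?B = B0" by (rule surj_f_inv_f)
    \<comment> \<open>The marking, extended by the identity in degrees 0 and 4, carries the twist by
      the pulled-back B-field to the twist by \<open>B0\<close>.\<close>
    have total_tw: "total_map \<theta> (twist (cup X) ?B v) = tw (\<theta> v)" for v
      using lattice_isometry_form[OF \<theta> Q K3.real_form_axioms, of ?B v]
      by (simp add: total_map_def twist_def \<theta>B)
    have inv: "total_map \<eta> (total_map \<theta> x) = x" "total_map \<theta> (total_map \<eta> y) = y" for x y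
      by (rule total_eqI; simp add: total_map_def \<eta>)+
    have f_iso: "lattice_isometry (mukai (cup X)) (mukai (cup X)) f"
      and f20: "f ` twisted_H20 X ?B = twisted_H20 X ?B"
      using f by (auto simp: twisted_Hodge_isometry_def)
    define F where "F x = total_map \<theta> (f (total_map \<eta> x))" for x
    have F: "lattice_isometry (mukai K3_form) (mukai K3_form) F"
      unfolding F_def
      by (intro lattice_isometry_compose[OF lattice_isometry_compose[OF total_map_isometry[OF \<eta>(1)] f_iso]]
          total_map_isometry[OF \<theta>])
    have Fp: "F (tw \<tau>) \<in> tw ` p" if \<tau>: "\<tau> \<in> p" for \<tau>
    proof -
      obtain v where v: "v \<in> H20 X" "\<tau> = \<theta> v" using \<tau> per by blast
      then have "f (twist (cup X) ?B v) \<in> twist (cup X) ?B ` H20 X"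
        using f20 unfolding twisted_H20_eq by blast
      then obtain w where w: "w \<in> H20 X" "f (twist (cup X) ?B v) = twist (cup X) ?B w" by blast
      have "F (tw \<tau>) = tw (\<theta> w)"
        unfolding F_def v(2) total_tw[symmetric] inv w(2) ..
      then show ?thesis using w(1) per by blast
    qed
    have pN: "p \<in> N_moduli 3" using p by simp
    have off: "\<not> p \<subseteq> W" if "W \<in> exceptional_loci" for W
      using p that by (auto simp: \<Z>_def)
    obtain e :: real where e: "e = 1 \<or> e = -1"
      and T: "\<forall>\<tau>. bil K3_form \<tau> (ell 3) = 0 \<longrightarrow> F (tw \<tau>) = of_real e *s tw \<tau>"
      using isometry_scalar_off_exceptional_loci[OF F pN off Fp] by metis
    have pp: "p \<in> proj_points" using pN by (simp add: N_moduli_def period_domain_def)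
    obtain \<sigma> where \<sigma>: "\<sigma> \<in> p" "\<sigma> \<noteq> 0" by (rule proj_point_nonzero[OF pp])
    have "\<sigma> \<in> moduli_cone 3" using mem_N_moduli[OF pp \<sigma>] pN by blast
    then have "\<sigma> \<in> period_cone 3" by (simp add: moduli_cone_def)
    then obtain F0 A where F0: "F0 \<in> positive_frames (mukai K3_form)"
      "M.frame_perp (frame_map F F0) A F0" "det A > 0"
      using signed_frame[OF F e] T by metis
    show "signed_isometry (mukai (cup X)) f"
      by (rule twisted_isometry_signed[OF Q \<theta> f_iso F0(1) inv _ F0(3)])
        (use F0(2) in \<open>simp add: F_def[abs_def]\<close>)
  qed
qed simp

end
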